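(* Consider the sub-Gaussian mixture model $y_i=\theta_{z_i}+w_i$, $i\in[n]$, with $k$ clusters and sub-Gaussian parameter $\sigma$. Assume $\sqrt k=o(r_k)$ and $k\log n=o(n\alpha^2)$ as $n\to\infty$. Let $\hat z$ be the output of Lloyd's algorithm initialized by the spectral clustering algorithm after $\lceil4\log n\rceil$ iterations. Then $$\ell(\hat z,z)\le\exp\left(-(1+o(1))\frac{\Delta^2}{8\sigma^2}\right)$$ with probability greater than $1-5n^{-1}-2\exp(-\Delta/\sigma)$.
   Context: $[m]=\{1,\dots,m\}$ and $\|\cdot\|$ is the Euclidean norm. Model: $y_i=\theta_{z_i}+w_i\in\mathbb{R}^d$, $i\in[n]$, where $z_i\in[k]$ are unknown labels, $\theta_1,\dots,\theta_k\in\mathbb{R}^d$ are unknown centers, and $w_1,\dots,w_n$ are independent zero-mean random vectors satisfying $\mathbb{E}e^{\langle a,w_i\rangle}\le e^{\sigma^2\|a\|^2/2}$ for all $a\in\mathbb{R}^d$, $i\in[n]$. $\Delta=\min_{g\ne h\in[k]}\|\theta_g-\theta_h\|$, $\alpha=\min_{h\in[k]}|\{i:z_i=h\}|/n$, $r_k=\frac\Delta\sigma\sqrt{\frac{\alpha}{1+kd/n}}$. The loss is $\ell(\hat z,z)=\inf_\pi\frac1n\sum_{i=1}^n\mathbb{I}\{\pi(\hat z_i)\ne z_i\}$, the infimum being over all permutations $\pi$ of $[k]$. Spectral clustering algorithm: (1) compute the SVD $Y=[y_1,\dots,y_n]=UDV'$ of the $d\times n$ data matrix and let $U_k$ be the first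 $k$ columns of $U$ (top $k$ left singular vectors); (2) let $\hat y_i=U_kU_k'y_i$; (3) run an $O(1)$-approximation algorithm for the $k$-means problem on $\hat y_1,\dots,\hat y_n$, i.e. an algorithm returning $k$ points $\mu_1,\dots,\mu_k$ whose $k$-means objective $\sum_i\min_{j}\|\hat y_i-\mu_j\|^2$ is at most a universal constant times the minimum possible value. The returned centers are used as the initial centers $\hat\theta^{(0)}_h$ of Lloyd's algorithm. Lloyd's algorithm: given centers $\hat\theta^{(s)}$, set $\hat z_i^{(s+1)}\in\operatorname*{argmin}_{h\in[k]}\|y_i-\hat\theta_h^{(s)}\|^2$ for $i\in[n]$, and given labels $\hat z^{(s)}$ set $\hat\theta_h^{(s)}$ to be the sample mean of $\{y_i:\hat z_i^{(s)}=h\}$; alternate these two steps. Asymptotic statements refer to a sequence of problem instances indexed by $n$. *)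

theory Defs
  imports
    "HOL-Probability.Probability"
    "HOL-Library.Landau_Symbols"
    "Jordan_Normal_Form.Matrix"
begin

text \<open>
  The dimension \<open>d\<close> and the number of clusters \<open>k\<close> may vary along a sequence of instances, so vectors
  and matrices are those of Jordan-Normal-Form, with dimensions given by carriers.  From here on
  \<open>vec\<close>, \<open>$\<close> and \<open>\<bullet>\<close> refer to these and not to the finite Cartesian products of HOL-Analysis.
  The index sets \<open>[n]\<close> and \<open>[k]\<close> are \<open>{..<n}\<close> and \<open>{..<k}\<close>.
\<close>

hide_type (open) Finite_Cartesian_Product.vec
hide_const (open) Finite_Cartesian_Product.vec
unbundle no inner_syntax and no vec_syntax

definition enorm :: "real vec \<Rightarrow> real" where
  "enorm v = sqrt (v \<bullet> v)"


section \<open>The sub-Gaussian mixture model\<close>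

text \<open>
  \<open>2 \<le> k\<close> is implicit in the minimum over pairs of distinct clusters that defines the separation.
  Bochner integrals of non-integrable functions are 0, hence the explicit integrability.
\<close>

locale sub_gaussian_mixture = prob_space M
  for M :: "'a measure" and n d k :: nat and \<sigma> :: real
    and \<theta> :: "nat \<Rightarrow> real vec" and z :: "nat \<Rightarrow> nat" and w :: "nat \<Rightarrow> 'a \<Rightarrow> real vec" +
  assumes two_clusters: "2 \<le> k"
    and sigma_pos: "0 < \<sigma>"
    and centers: "\<And>h. h < k \<Longrightarrow> \<theta> h \<in> carrier_vec d"
    and labels: "\<And>i. i < n \<Longrightarrow> z i < k"
    and noise_carrier: "\<And>i \<omega>. i < n \<Longrightarrow> \<omega> \<in> space M \<Longrightarrow> w i \<omega> \<in> carrier_vec d"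
    and noise_indep: "indep_vars (\<lambda>_. \<Pi>\<^sub>M j\<in>{..<d}. borel) (\<lambda>i \<omega>. \<lambda>j\<in>{..<d}. w i \<omega> $ j) {..<n}"
    and noise_integrable: "\<And>i j. i < n \<Longrightarrow> j < d \<Longrightarrow> integrable M (\<lambda>\<omega>. w i \<omega> $ j)"
    and noise_mean: "\<And>i j. i < n \<Longrightarrow> j < d \<Longrightarrow> expectation (\<lambda>\<omega>. w i \<omega> $ j) = 0"
    and mgf_integrable:
      "\<And>i a. i < n \<Longrightarrow> a \<in> carrier_vec d \<Longrightarrow> integrable M (\<lambda>\<omega>. exp (a \<bullet> w i \<omega>))"
    and mgf_bound:
      "\<And>i a. i < n \<Longrightarrow> a \<in> carrier_vec d \<Longrightarrow>
         expectation (\<lambda>\<omega>. exp (a \<bullet> w i \<omega>)) \<le> exp (\<sigma>\<^sup>2 * (enorm a)\<^sup>2 / 2)"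

definition observation ::
  "(nat \<Rightarrow> real vec) \<Rightarrow> (nat \<Rightarrow> nat) \<Rightarrow> (nat \<Rightarrow> 'a \<Rightarrow> real vec) \<Rightarrow> 'a \<Rightarrow> nat \<Rightarrow> real vec" where
  "observation \<theta> z w \<omega> i = \<theta> (z i) + w i \<omega>"

definition separation :: "nat \<Rightarrow> (nat \<Rightarrow> real vec) \<Rightarrow> real" where
  "separation k \<theta> = Min {enorm (\<theta> g - \<theta> h) | g h. g < k \<and> h < k \<and> g \<noteq> h}"

definition min_cluster_frac :: "nat \<Rightarrow> nat \<Rightarrow> (nat \<Rightarrow> nat) \<Rightarrow> real" where
  "min_cluster_frac n k z = real (MIN h\<in>{..<k}. card {i. i < n \<and> z i = h}) / real n"

definition snr_k :: "nat \<Rightarrow> nat \<Rightarrow> nat \<Rightarrow> real \<Rightarrow> (nat \<Rightarrow> real vec) \<Rightarrow> (nat \<Rightarrow> nat) \<Rightarrow> real" where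
  "snr_k n d k \<sigma> \<theta> z =
     separation k \<theta> / \<sigma> * sqrt (min_cluster_frac n k z / (1 + real k * real d / real n))"

definition misclust_loss :: "nat \<Rightarrow> nat \<Rightarrow> (nat \<Rightarrow> nat) \<Rightarrow> (nat \<Rightarrow> nat) \<Rightarrow> real" where
  "misclust_loss n k zh z =
     (INF \<pi>\<in>{\<pi>. \<pi> permutes {..<k}}. 1 / real n * (\<Sum>i<n. of_bool (\<pi> (zh i) \<noteq> z i)))"


section \<open>Spectral initialization\<close>

text \<open>
  A full singular value decomposition.  (The library's \<open>orthogonal_mat\<close> only says that the columns
  are pairwise orthogonal and nonzero, so orthonormality is written out.)
\<close>

definition is_svd :: "real mat \<Rightarrow> real mat \<Rightarrow> real mat \<Rightarrow> real mat \<Rightarrow> bool" where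
  "is_svd Y U D V \<longleftrightarrow>
     U \<in> carrier_mat (dim_row Y) (dim_row Y) \<and>
     D \<in> carrier_mat (dim_row Y) (dim_col Y) \<and>
     V \<in> carrier_mat (dim_col Y) (dim_col Y) \<and>
     U\<^sup>T * U = 1\<^sub>m (dim_row Y) \<and>
     V\<^sup>T * V = 1\<^sub>m (dim_col Y) \<and>
     diagonal_mat D \<and>
     (\<forall>i < min (dim_row Y) (dim_col Y). 0 \<le> D $$ (i, i)) \<and>
     (\<forall>i j. i \<le> j \<and> j < min (dim_row Y) (dim_col Y) \<longrightarrow> D $$ (j, j) \<le> D $$ (i, i)) \<and>
     Y = U * D * V\<^sup>T"

definition data_matrix :: "nat \<Rightarrow> nat \<Rightarrow> (nat \<Rightarrow> real vec) \<Rightarrow> real mat" where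
  "data_matrix n d y = mat_of_cols d (map y [0..<n])"

text \<open>If \<open>U\<close> has fewer than \<open>k\<close> columns, all of them are taken.\<close>

definition first_cols :: "nat \<Rightarrow> real mat \<Rightarrow> real mat" where
  "first_cols k U = mat_of_cols (dim_row U) (take k (cols U))"

definition kmeans_cost :: "nat \<Rightarrow> nat \<Rightarrow> (nat \<Rightarrow> real vec) \<Rightarrow> (nat \<Rightarrow> real vec) \<Rightarrow> real" where
  "kmeans_cost n k x \<mu> = (\<Sum>i<n. MIN j\<in>{..<k}. (enorm (x i - \<mu> j))\<^sup>2)"

definition kmeans_approx ::
  "real \<Rightarrow> nat \<Rightarrow> nat \<Rightarrow> nat \<Rightarrow> (nat \<Rightarrow> real vec) \<Rightarrow> (nat \<Rightarrow> real vec) \<Rightarrow> bool" where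
  "kmeans_approx C n d k x \<mu> \<longleftrightarrow>
     (\<forall>h<k. \<mu> h \<in> carrier_vec d) \<and>
     kmeans_cost n k x \<mu> \<le> C * (INF \<nu>\<in>{\<nu>. \<forall>h<k. \<nu> h \<in> carrier_vec d}. kmeans_cost n k x \<nu>)"

text \<open>
  The algorithms are relations between data and possible outputs, because the singular value
  decomposition, the k-means routine and the choice among tied nearest centers are not unique.
\<close>

definition spectral_centers ::
  "real \<Rightarrow> nat \<Rightarrow> nat \<Rightarrow> nat \<Rightarrow> (nat \<Rightarrow> real vec) \<Rightarrow> (nat \<Rightarrow> real vec) \<Rightarrow> bool" where
  "spectral_centers C n d k y \<mu> \<longleftrightarrow>
     (\<exists>U D V. is_svd (data_matrix n d y) U D V \<and>
        kmeans_approx C n d k (\<lambda>i. (first_cols k U * (first_cols k U)\<^sup>T) *\<^sub>v y i) \<mu>)"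


section \<open>Lloyd's algorithm\<close>

definition sample_mean :: "nat \<Rightarrow> nat set \<Rightarrow> (nat \<Rightarrow> real vec) \<Rightarrow> real vec" where
  "sample_mean d S y = vec d (\<lambda>j. (\<Sum>i\<in>S. y i $ j) / real (card S))"

text \<open>
  \<open>c s\<close> and \<open>l s\<close> are the centers and labels after \<open>s\<close> iterations; \<open>l 0\<close> plays no role.
  The center of an empty cluster, whose sample mean is undefined, may be any vector, so that every
  convention for this case is covered.
\<close>

definition lloyd_iterates ::
  "nat \<Rightarrow> nat \<Rightarrow> nat \<Rightarrow> (nat \<Rightarrow> real vec) \<Rightarrow>
   (nat \<Rightarrow> nat \<Rightarrow> real vec) \<Rightarrow> (nat \<Rightarrow> nat \<Rightarrow> nat) \<Rightarrow> bool" where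
  "lloyd_iterates n d k y c l \<longleftrightarrow>
     (\<forall>s. (\<forall>i<n. is_arg_min (\<lambda>h. (enorm (y i - c s h))\<^sup>2) (\<lambda>h. h < k) (l (Suc s) i)) \<and>
          (\<forall>h<k. c (Suc s) h \<in> carrier_vec d \<and>
             (let S = {i. i < n \<and> l (Suc s) i = h}
              in S \<noteq> {} \<longrightarrow> c (Suc s) h = sample_mean d S y)))"

definition spectral_lloyd_output ::
  "real \<Rightarrow> nat \<Rightarrow> nat \<Rightarrow> nat \<Rightarrow> (nat \<Rightarrow> real vec) \<Rightarrow> nat \<Rightarrow> (nat \<Rightarrow> nat) \<Rightarrow> bool" where
  "spectral_lloyd_output C n d k y s zh \<longleftrightarrow>
     (\<exists>c l. spectral_centers C n d k y (c 0) \<and> lloyd_iterates n d k y c l \<and> zh = l s)"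

end

theory Submission
  imports Defs "Jordan_Normal_Form.Determinant"
begin

text \<open>
  The proof separates a deterministic core from two random events.  Write \<open>r = \<Delta> / \<sigma>\<close>, let \<open>m\<close> be the
  size of the smallest cluster, and put \<open>B\<^sup>2 = 224 \<sigma>\<^sup>2 (n + d)\<close> and \<open>\<rho>\<^sup>2 = 224 k / S\<^sup>2\<close>, where \<open>S\<close> is the
  signal-to-noise ratio of the statement.  Then \<open>\<rho>\<close> tends to 0 and \<open>k B\<^sup>2 \<le> \<rho>\<^sup>2 m \<Delta>\<^sup>2\<close>.

  The first event, of probability at least \<open>1 - exp (- n)\<close>, is that the noise matrix has operator norm
  at most \<open>B\<close> (\<open>tame_noise_prob\<close>).  On it the behaviour of the algorithm is deterministic.

  \<^item> Spectral initialization: some combination of the first \<open>k + 1\<close> right singular vectors annihilates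
    the signal, which has rank at most \<open>k\<close>.  So the \<open>(k + 1)\<close>-st singular value of the data is at most
    \<open>B\<close>, the projected data approximate the true centers with total squared error at most \<open>10 k B\<^sup>2\<close>,
    and an approximate solution of the k-means problem has a center within \<open>O(\<rho> \<Delta>)\<close> of every true
    center (\<open>spectral_centers_close\<close>).
  \<^item> Lloyd iterations: a point of cluster \<open>g\<close> is assigned to \<open>h\<close> only if its noise reaches about halfway
    from \<open>\<theta> g\<close> to \<open>\<theta> h\<close>, or if its noise has a large inner product with the error of an estimated
    center.  This error is the mean noise of the true cluster, which depends neither on the labels nor
    on the iteration, plus a remainder due to the misassigned points.  The squared remainders sum to
    at most a multiple of \<open>k B\<^sup>2 / m\<^sup>2\<close> times the number of errors (\<open>sum_center_update_le\<close>), and the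
    operator norm turns this into at most one third as many new errors (\<open>later_iteration\<close>).  Centers
    that are very far apart do no harm, because few points can be carried over a large distance
    (\<open>misassigned_drift\<close>).

  After \<open>4 ln n\<close> iterations the errors therefore number at most three times the points that are bad
  independently of the run: the noise reaches almost halfway to another center, or is aligned with the
  mean noise of some cluster.

  The second event bounds the number of bad points by Markov's inequality and has probability at least
  \<open>1 - exp (- r)\<close>.  By the sub-Gaussian tail the noise of a point reaches almost halfway to a given
  other center with probability at most \<open>exp (- (1 - o(1)) r\<^sup>2 / 8)\<close>.  Alignment with a mean
  noise vector is far less likely: the contribution of the point to the mean is small by the operator norm bound, and the rest is a short
  vector that is independent of the noise of the point (\<open>decoupled_tail\<close>).  The factor \<open>exp r\<close> lost in
  Markov's inequality and the factor \<open>k\<close> lost in union bounds only change the exponent by \<open>o(r\<^sup>2)\<close>,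
  because \<open>r \<ge> 1 / \<rho>\<close> and \<open>k \<le> \<rho>\<^sup>2 r\<^sup>2\<close>.
\<close>

section \<open>Finitely supported sequences\<close>

text \<open>
  The dimension \<open>d\<close> varies along the sequence of instances, but the deterministic part of the argument does
  not depend on it.  This type is one inner product space that contains all \<open>\<real>\<^sup>d\<close>, so that the
  deterministic part can be stated for types of class \<open>real_inner\<close>.
\<close>

typedef fin_seq = "{f :: nat \<Rightarrow> real. finite {j. f j \<noteq> 0}}"
  morphisms coord Abs_fin_seq
  by (rule exI[of _ "\<lambda>_. 0"]) simp

setup_lifting type_definition_fin_seq

lemma finite_support [simp]: "finite {j. coord x j \<noteq> 0}"
  using coord[of x] by simp

instantiation fin_seq :: real_inner
begin

lift_definition zero_fin_seq :: fin_seq is "\<lambda>_. 0" by simp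

lift_definition plus_fin_seq :: "fin_seq \<Rightarrow> fin_seq \<Rightarrow> fin_seq" is "\<lambda>f g j. f j + g j"
  subgoal for f g by (rule finite_subset[of _ "{j. f j \<noteq> 0} \<union> {j. g j \<noteq> 0}"]) auto
  done

lift_definition uminus_fin_seq :: "fin_seq \<Rightarrow> fin_seq" is "\<lambda>f j. - f j" by simp

lift_definition minus_fin_seq :: "fin_seq \<Rightarrow> fin_seq \<Rightarrow> fin_seq" is "\<lambda>f g j. f j - g j"
  subgoal for f g by (rule finite_subset[of _ "{j. f j \<noteq> 0} \<union> {j. g j \<noteq> 0}"]) auto
  done

lift_definition scaleR_fin_seq :: "real \<Rightarrow> fin_seq \<Rightarrow> fin_seq" is "\<lambda>r f j. r * f j"
  subgoal for r f by (rule finite_subset[of _ "{j. f j \<noteq> 0}"]) auto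
  done

definition inner_fin_seq :: "fin_seq \<Rightarrow> fin_seq \<Rightarrow> real" where
  "inner_fin_seq x y = (\<Sum>j | coord x j \<noteq> 0. coord x j * coord y j)"

definition norm_fin_seq :: "fin_seq \<Rightarrow> real" where
  "norm_fin_seq x = sqrt (inner x x)"

definition sgn_fin_seq :: "fin_seq \<Rightarrow> fin_seq" where
  "sgn_fin_seq x = scaleR (inverse (norm x)) x"

definition dist_fin_seq :: "fin_seq \<Rightarrow> fin_seq \<Rightarrow> real" where
  "dist_fin_seq x y = norm (x - y)"

definition uniformity_fin_seq :: "(fin_seq \<times> fin_seq) filter" where
  "uniformity_fin_seq = (INF e\<in>{0 <..}. principal {(x, y). dist x y < e})"

definition open_fin_seq :: "fin_seq set \<Rightarrow> bool" where
  "open_fin_seq U \<longleftrightarrow> (\<forall>x\<in>U. \<forall>\<^sub>F (x', y) in uniformity. x' = x \<longrightarrow> y \<in> U)"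

lemma inner_fin_seq_superset:
  assumes "finite S" "\<And>j. j \<notin> S \<Longrightarrow> coord x j = 0"
  shows "inner x y = (\<Sum>j\<in>S. coord x j * coord y j)"
  unfolding inner_fin_seq_def
  by (rule sum.mono_neutral_left) (use assms in auto)

instance
proof
  fix x y z :: fin_seq and r s :: real
  let ?S = "{j. coord x j \<noteq> 0} \<union> {j. coord y j \<noteq> 0} \<union> {j. coord z j \<noteq> 0}"
  have fin: "finite ?S" by simp
  have sup: "inner u v = (\<Sum>j\<in>?S. coord u j * coord v j)"
    if "\<And>j. j \<notin> ?S \<Longrightarrow> coord u j = 0" for u v
    by (rule inner_fin_seq_superset[OF fin that])
  show "x + y + z = x + (y + z)" "x + y = y + x" "0 + x = x" "- x + x = 0" "x - y = x + - y"
    by (transfer; force simp: algebra_simps)+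
  show "r *\<^sub>R (x + y) = r *\<^sub>R x + r *\<^sub>R y" "(r + s) *\<^sub>R x = r *\<^sub>R x + s *\<^sub>R x"
    "r *\<^sub>R s *\<^sub>R x = (r * s) *\<^sub>R x" "1 *\<^sub>R x = x"
    by (transfer; simp add: algebra_simps)+
  show "sgn x = scaleR (inverse (norm x)) x" "dist x y = norm (x - y)" "norm x = sqrt (inner x x)"
    by (simp_all add: sgn_fin_seq_def dist_fin_seq_def norm_fin_seq_def)
  show "uniformity = (INF e\<in>{0 <..}. principal {(x, y). dist (x::fin_seq) y < e})"
    by (rule uniformity_fin_seq_def)
  show "open U = (\<forall>x\<in>U. \<forall>\<^sub>F (x', y) in uniformity. x' = x \<longrightarrow> y \<in> U)" for U :: "fin_seq set"
    by (rule open_fin_seq_def)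
  have xy: "inner x y = (\<Sum>j\<in>?S. coord x j * coord y j)"
    and yx: "inner y x = (\<Sum>j\<in>?S. coord y j * coord x j)"
    and xx: "inner x x = (\<Sum>j\<in>?S. coord x j * coord x j)"
    and xz: "inner x z = (\<Sum>j\<in>?S. coord x j * coord z j)"
    and yz: "inner y z = (\<Sum>j\<in>?S. coord y j * coord z j)"
    and xpy: "inner (x + y) z = (\<Sum>j\<in>?S. coord (x + y) j * coord z j)"
    and rx: "inner (r *\<^sub>R x) y = (\<Sum>j\<in>?S. coord (r *\<^sub>R x) j * coord y j)"
    by (rule sup; simp add: plus_fin_seq.rep_eq scaleR_fin_seq.rep_eq)+
  show "inner x y = inner y x"
    unfolding xy yx by (simp add: mult.commute)
  show "inner (x + y) z = inner x z + inner y z"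
    unfolding xpy xz yz by (simp add: plus_fin_seq.rep_eq algebra_simps sum.distrib)
  show "inner (r *\<^sub>R x) y = r * inner x y"
    unfolding rx xy by (simp add: scaleR_fin_seq.rep_eq sum_distrib_left mult.assoc)
  show "0 \<le> inner x x"
    unfolding xx by (simp add: sum_nonneg)
  have "inner x x = 0 \<longleftrightarrow> (\<forall>j\<in>?S. coord x j * coord x j = 0)"
    unfolding xx using fin by (simp add: sum_nonneg_eq_0_iff del: mult_eq_0_iff)
  also have "\<dots> \<longleftrightarrow> (\<forall>j. coord x j = 0)" by auto
  also have "\<dots> \<longleftrightarrow> x = 0" by (transfer; auto)
  finally show "inner x x = 0 \<longleftrightarrow> x = 0" .
qed

end

lift_definition embed :: "real vec \<Rightarrow> fin_seq" is "\<lambda>v j. if j < dim_vec v then v $ j else 0"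
  subgoal for v by (rule finite_subset[of _ "{..<dim_vec v}"]) auto
  done

lemma embed_add: "dim_vec u = dim_vec v \<Longrightarrow> embed (u + v) = embed u + embed v"
  by transfer auto

lemma embed_diff: "dim_vec u = dim_vec v \<Longrightarrow> embed (u - v) = embed u - embed v"
  by transfer auto

lemma inner_embed: "dim_vec u = dim_vec v \<Longrightarrow> inner (embed u) (embed v) = u \<bullet> v"
  by (subst inner_fin_seq_superset[of "{..<dim_vec v}"])
     (auto simp: embed.rep_eq scalar_prod_def atLeast0LessThan)

lemma norm_embed: "norm (embed v) = enorm v"
  by (simp add: norm_fin_seq_def inner_embed enorm_def)

lemma coord_sum: "coord (sum f S) j = (\<Sum>i\<in>S. coord (f i) j)"
  by (induction S rule: infinite_finite_induct) (simp_all add: plus_fin_seq.rep_eq zero_fin_seq.rep_eq)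

lemma fin_seq_eqI: "(\<And>j. coord x j = coord y j) \<Longrightarrow> x = y"
  by (simp add: coord_inject[symmetric] ext)

section \<open>Noise of bounded operator norm\<close>

text \<open>
  The norm is that of the matrix with columns \<open>w 0, \<dots>, w (n - 1)\<close>.
\<close>

definition operator_bound :: "nat \<Rightarrow> real \<Rightarrow> (nat \<Rightarrow> 'v::real_normed_vector) \<Rightarrow> bool" where
  "operator_bound n B w \<longleftrightarrow> (\<forall>u. norm (\<Sum>i<n. u i *\<^sub>R w i) \<le> B * L2_set u {..<n})"

lemma operator_boundD: "operator_bound n B w \<Longrightarrow> norm (\<Sum>i<n. u i *\<^sub>R w i) \<le> B * L2_set u {..<n}"
  unfolding operator_bound_def by (erule allE)

lemma operator_bound_nonneg:
  assumes "operator_bound n B w" "0 < n"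
  shows "0 \<le> B"
proof -
  have "0 \<le> norm (\<Sum>i<n. 1 *\<^sub>R w i)" by simp
  also have "\<dots> \<le> B * L2_set (\<lambda>_. 1) {..<n}"
    using assms(1) by (rule operator_boundD)
  also have "L2_set (\<lambda>_. 1) {..<n} = sqrt n" by (simp add: L2_set_def)
  finally show ?thesis using assms(2) by (simp add: zero_le_mult_iff)
qed

lemma operator_bound_subset:
  assumes "operator_bound n B w" "S \<subseteq> {..<n}"
  shows "norm (sum w S) \<le> B * sqrt (card S)"
proof -
  have ind: "(\<Sum>i<n. indicator S i *\<^sub>R g i) = (\<Sum>i\<in>S. g i)" for g :: "nat \<Rightarrow> 'b::real_vector"
    by (rule sum.mono_neutral_cong_right) (use assms(2) in \<open>auto simp: indicator_def\<close>)
  have "norm (\<Sum>i<n. indicator S i *\<^sub>R w i) \<le> B * L2_set (indicator S) {..<n}"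
    using assms(1) by (rule operator_boundD)
  moreover have "L2_set (indicator S) {..<n} = sqrt (card S)"
    using ind[of "\<lambda>_. 1::real"] by (simp add: L2_set_def power2_eq_square flip: indicator_inter_arith)
  ultimately show ?thesis using ind[of w] by simp
qed

text \<open>
  The transposed matrix has the same operator norm: test the bound with the coefficients
  \<open>u i = inner (w i) v\<close>, for which \<open>\<Sum>i<n. (u i)\<^sup>2\<close> is the inner product of \<open>\<Sum>i<n. u i *\<^sub>R w i\<close> with \<open>v\<close>.
\<close>

lemma operator_bound_inner:
  fixes w :: "nat \<Rightarrow> 'v::real_inner"
  assumes "operator_bound n B w"
  shows "(\<Sum>i<n. (inner (w i) v)\<^sup>2) \<le> B\<^sup>2 * (norm v)\<^sup>2"
proof -
  define u where "u = (\<lambda>i. inner (w i) v)"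
  let ?L = "L2_set u {..<n}"
  have "?L\<^sup>2 = (\<Sum>i<n. u i * inner (w i) v)"
    by (simp add: L2_set_def sum_nonneg power2_eq_square u_def)
  also have "\<dots> = inner (\<Sum>i<n. u i *\<^sub>R w i) v" by (simp add: inner_sum_left)
  also have "\<dots> \<le> norm (\<Sum>i<n. u i *\<^sub>R w i) * norm v" by (rule norm_cauchy_schwarz)
  also have "\<dots> \<le> (B * ?L) * norm v"
    using operator_boundD[OF assms] by (intro mult_right_mono) auto
  finally have *: "?L * ?L \<le> ?L * (B * norm v)" by (simp add: power2_eq_square mult_ac)
  have "?L \<le> \<bar>B * norm v\<bar>"
  proof (cases "?L = 0")
    case False
    then have "?L > 0" by (simp add: L2_set_nonneg order_less_le)
    with * have "?L \<le> B * norm v" by simp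
    then show ?thesis by simp
  qed simp
  then have "?L\<^sup>2 \<le> \<bar>B * norm v\<bar>\<^sup>2" by (intro power_mono) auto
  then show ?thesis
    by (simp add: L2_set_def sum_nonneg u_def power_mult_distrib)
qed

section \<open>Misassigned points and updated centers\<close>

text \<open>
  The point \<open>a + x\<close> with true center \<open>a\<close> lies on the wrong side of the hyperplane that bisects the estimates
  \<open>c\<close> of \<open>a\<close> and \<open>c'\<close> of \<open>b\<close>.  Hence its noise \<open>x\<close> covers half the distance from \<open>a\<close> to \<open>b\<close>, up to the errors
  of the estimates.
\<close>

lemma misassigned_noise:
  fixes a b c c' x :: "'v::real_inner"
  assumes closer: "norm (a + x - c') \<le> norm (a + x - c)"
    and c: "norm (c - a) \<le> \<eta> * norm (b - a)" and c': "norm (c' - b) \<le> \<eta> * norm (b - a)"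
    and \<eta>: "\<eta> \<le> 1"
  shows "(1 - 2 * \<eta>) * (norm (b - a))\<^sup>2 / 2 \<le> inner x (c' - c)"
proof -
  let ?D = "norm (b - a)"
  have sq: "(norm (a + x - e))\<^sup>2 = (norm (a - e))\<^sup>2 + 2 * inner x (a - e) + (norm x)\<^sup>2" for e
    by (simp add: power2_norm_eq_inner algebra_simps inner_simps inner_commute)
  have "(norm (a + x - c'))\<^sup>2 \<le> (norm (a + x - c))\<^sup>2"
    using closer by (intro power_mono) auto
  then have 1: "(norm (a - c'))\<^sup>2 - (norm (a - c))\<^sup>2 \<le> 2 * inner x (c' - c)"
    unfolding sq by (simp add: inner_simps)
  have "?D \<le> norm (a - c') + norm (c' - b)"
    using norm_triangle_ineq[of "a - c'" "c' - b"] by (simp add: norm_minus_commute)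
  then have "(1 - \<eta>) * ?D \<le> norm (a - c')" using c' by (simp add: algebra_simps)
  then have 2: "((1 - \<eta>) * ?D)\<^sup>2 \<le> (norm (a - c'))\<^sup>2"
    using \<eta> by (intro power_mono) auto
  have 3: "(norm (a - c))\<^sup>2 \<le> (\<eta> * ?D)\<^sup>2"
    using c by (intro power_mono) (auto simp: norm_minus_commute)
  have "(1 - 2 * \<eta>) * ?D\<^sup>2 = ((1 - \<eta>) * ?D)\<^sup>2 - (\<eta> * ?D)\<^sup>2"
    by (simp add: power2_eq_square algebra_simps)
  then show ?thesis using 1 2 3 by linarith
qed

lemma sum_sqrt_le:
  fixes a :: "nat \<Rightarrow> real"
  assumes "\<And>g. g < k \<Longrightarrow> 0 \<le> a g"
  shows "(\<Sum>g<k. sqrt (a g)) \<le> sqrt k * sqrt (\<Sum>g<k. a g)"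
proof -
  have "(\<Sum>g<k. sqrt (a g))\<^sup>2 \<le> (\<Sum>g<k. (sqrt (a g))\<^sup>2) * card {..<k}"
    by (rule sum_squared_le_sum_of_squares)
  also have "\<dots> = k * (\<Sum>g<k. a g)" using assms by simp
  finally show ?thesis
    by (simp add: real_le_rsqrt real_sqrt_mult[symmetric])
qed

text \<open>
  The parameter \<open>\<rho>\<close> is an inverse signal-to-noise ratio: it bounds \<open>sqrt k * B / (sqrt m * \<Delta>)\<close>.
\<close>

locale separated_clusters =
  fixes n k :: nat and z :: "nat \<Rightarrow> nat" and \<theta> w :: "nat \<Rightarrow> 'v::real_inner"
    and B \<Delta> m \<rho> :: real
  assumes label: "i < n \<Longrightarrow> z i < k"
    and separated: "g < k \<Longrightarrow> h < k \<Longrightarrow> g \<noteq> h \<Longrightarrow> \<Delta> \<le> norm (\<theta> g - \<theta> h)"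
    and \<Delta>_pos: "0 < \<Delta>"
    and noise: "operator_bound n B w"
    and cluster_size: "h < k \<Longrightarrow> m \<le> card {i. i < n \<and> z i = h}"
    and m_pos: "0 < m"
    and k_pos: "0 < k"
    and \<rho>_pos: "0 < \<rho>"
    and noise_level: "k * B\<^sup>2 \<le> \<rho>\<^sup>2 * m * \<Delta>\<^sup>2"
begin

definition y :: "nat \<Rightarrow> 'v" where "y i = \<theta> (z i) + w i"

definition T :: "nat \<Rightarrow> nat set" where "T h = {i. i < n \<and> z i = h}"

text \<open>
  The error of the center that the true labels would produce.
\<close>

definition mean_noise :: "nat \<Rightarrow> 'v" where "mean_noise h = sum w (T h) /\<^sub>R card (T h)"

definition errors :: "(nat \<Rightarrow> nat) \<Rightarrow> nat set" where "errors l = {i. i < n \<and> l i \<noteq> z i}"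

lemma T_subset: "T h \<subseteq> {..<n}" and finite_T [simp]: "finite (T h)"
  and finite_errors [simp]: "finite (errors l)"
  by (auto simp: T_def errors_def)

lemma m_le_card: "h < k \<Longrightarrow> m \<le> card (T h)"
  unfolding T_def by (rule cluster_size)

lemma card_T_pos: "h < k \<Longrightarrow> 0 < real (card (T h))"
  using m_le_card m_pos by fastforce

lemma n_pos: "0 < n"
proof -
  have "card (T 0) \<le> n" using card_mono[OF _ T_subset] by fastforce
  moreover have "0 < card (T 0)" using card_T_pos[of 0] k_pos by simp
  ultimately show ?thesis by linarith
qed

lemma B_nonneg: "0 \<le> B"
  using operator_bound_nonneg[OF noise n_pos] .

lemma B_sq_le: "B\<^sup>2 \<le> \<rho>\<^sup>2 * m * \<Delta>\<^sup>2"
proof -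
  have "B\<^sup>2 * 1 \<le> B\<^sup>2 * k" using k_pos by (intro mult_left_mono) auto
  then show ?thesis using noise_level by (simp add: mult_ac)
qed

lemma norm_mean_noise: "h < k \<Longrightarrow> norm (mean_noise h) \<le> B / sqrt (card (T h))"
proof -
  assume h: "h < k"
  have "norm (mean_noise h) \<le> B * sqrt (card (T h)) / card (T h)"
    using operator_bound_subset[OF noise T_subset, of h]
    by (simp add: mean_noise_def divide_inverse_commute mult_left_mono)
  also have "\<dots> = B / sqrt (card (T h))"
    using sqrt_divide_self_eq[of "card (T h)"] by (simp add: divide_inverse mult.assoc)
  finally show ?thesis .
qed

lemma card_mean_noise:
  assumes "h < k"
  shows "card (T h) *\<^sub>R mean_noise h = sum w (T h)"
proof -
  have "real (card (T h)) * inverse (card (T h)) = 1"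
    using card_T_pos[OF assms] by (intro right_inverse) auto
  then show ?thesis by (simp only: mean_noise_def scaleR_scaleR scaleR_one)
qed

lemma norm_mean_noise_le: "h < k \<Longrightarrow> norm (mean_noise h) \<le> \<rho> * \<Delta>"
proof -
  assume h: "h < k"
  have "(B / sqrt (card (T h)))\<^sup>2 = B\<^sup>2 / card (T h)" by (simp add: power_divide)
  also have "\<dots> \<le> B\<^sup>2 / m" using m_le_card[OF h] m_pos by (intro divide_left_mono) auto
  also have "\<dots> \<le> (\<rho> * \<Delta>)\<^sup>2"
    using B_sq_le m_pos by (simp add: field_simps power_mult_distrib)
  finally have "B / sqrt (card (T h)) \<le> \<rho> * \<Delta>"
    by (rule power2_le_imp_le) (use \<rho>_pos \<Delta>_pos in auto)
  then show ?thesis using norm_mean_noise[OF h] by linarith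
qed

text \<open>
  A misassigned point has noise of inner product at least about \<open>(norm (\<theta> h - \<theta> g))\<^sup>2 / 2\<close> with \<open>c h - c g\<close>.
  Summing over \<open>S\<close> and bounding the sum of the noise by the operator norm gives
  \<open>card S * norm (\<theta> h - \<theta> g) \<le> 4 * B * sqrt (card S)\<close>.  So the points of \<open>S\<close> displace the center of \<open>h\<close> by an
  amount that does not grow with the distance between the two clusters.
\<close>

lemma misassigned_drift:
  assumes g: "g < k" and h: "h < k" and gh: "g \<noteq> h" and S: "S \<subseteq> T g"
    and closer: "\<And>i. i \<in> S \<Longrightarrow> norm (y i - c h) \<le> norm (y i - c g)"
    and cg: "norm (c g - \<theta> g) \<le> \<eta> * \<Delta>" and ch: "norm (c h - \<theta> h) \<le> \<eta> * \<Delta>"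
    and \<eta>: "0 \<le> \<eta>" "\<eta> \<le> 1 / 8"
  shows "norm (\<Sum>i\<in>S. y i - \<theta> h) \<le> 5 * B * sqrt (card S)"
proof -
  have finS: "finite S" using S finite_T finite_subset by blast
  let ?D = "norm (\<theta> h - \<theta> g)"
  have D: "\<Delta> \<le> ?D" using separated[OF h g] gh by simp
  then have Dpos: "0 < ?D" using \<Delta>_pos by linarith
  have \<eta>D: "\<eta> * \<Delta> \<le> \<eta> * ?D" using D \<eta> by (intro mult_left_mono) auto
  have W: "norm (sum w S) \<le> B * sqrt (card S)"
    using operator_bound_subset[OF noise] S T_subset by blast
  have one: "(1 - 2 * \<eta>) * ?D\<^sup>2 / 2 \<le> inner (w i) (c h - c g)" if "i \<in> S" for i
  proof (rule misassigned_noise[where \<eta> = \<eta>])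
    show "norm (\<theta> g + w i - c h) \<le> norm (\<theta> g + w i - c g)"
      using closer[OF that] S that by (auto simp: y_def T_def)
    show "norm (c g - \<theta> g) \<le> \<eta> * ?D" "norm (c h - \<theta> h) \<le> \<eta> * ?D" "\<eta> \<le> 1"
      using cg ch \<eta>D \<eta> by auto
  qed
  have "card S * ((3 / 8) * ?D\<^sup>2) \<le> card S * ((1 - 2 * \<eta>) * ?D\<^sup>2 / 2)"
    using \<eta> mult_right_mono[of "3 / 4" "1 - 2 * \<eta>" "?D\<^sup>2"] by (intro mult_left_mono) auto
  also have "\<dots> \<le> (\<Sum>i\<in>S. inner (w i) (c h - c g))"
    using sum_bounded_below[of S, OF one] by simp
  also have "\<dots> = inner (sum w S) (c h - c g)" by (simp add: inner_sum_left)
  also have "\<dots> \<le> norm (sum w S) * norm (c h - c g)" by (rule norm_cauchy_schwarz)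
  also have "\<dots> \<le> (B * sqrt (card S)) * (5 / 4 * ?D)"
  proof (intro mult_mono W)
    have "norm (c h - c g) \<le> norm (c h - \<theta> h) + ?D + norm (\<theta> g - c g)"
      using norm_triangle_ineq[of "c h - \<theta> h" "\<theta> h - \<theta> g"] norm_triangle_ineq[of "c h - \<theta> g" "\<theta> g - c g"]
      by simp
    also have "\<dots> \<le> \<eta> * ?D + ?D + \<eta> * ?D"
      using cg ch \<eta>D by (simp add: norm_minus_commute)
    also have "\<dots> \<le> 5 / 4 * ?D" using mult_right_mono[OF \<eta>(2), of ?D] by simp
    finally show "norm (c h - c g) \<le> 5 / 4 * ?D" .
  qed (use B_nonneg in auto)
  finally have "(card S * ?D) * ((3 / 8) * ?D) \<le> (10 / 3 * (B * sqrt (card S))) * ((3 / 8) * ?D)"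
    by (simp add: power2_eq_square algebra_simps)
  then have "card S * ?D \<le> 10 / 3 * (B * sqrt (card S))"
    using Dpos mult_right_le_imp_le[of "card S * ?D" "(3 / 8) * ?D"] by simp
  then have D4: "card S * ?D \<le> 4 * (B * sqrt (card S))"
    using mult_nonneg_nonneg[OF B_nonneg, of "sqrt (card S)"] by simp
  have "(\<Sum>i\<in>S. y i - \<theta> h) = (\<Sum>i\<in>S. w i + (\<theta> g - \<theta> h))"
    using S by (intro sum.cong) (auto simp: y_def T_def)
  also have "\<dots> = sum w S + card S *\<^sub>R (\<theta> g - \<theta> h)"
    by (simp add: sum.distrib sum_constant_scaleR)
  finally have "norm (\<Sum>i\<in>S. y i - \<theta> h) \<le> norm (sum w S) + card S * ?D"
    using norm_triangle_ineq[of "sum w S" "card S *\<^sub>R (\<theta> g - \<theta> h)"] by (simp add: norm_minus_commute)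
  then show ?thesis using W D4 by simp
qed

definition missed :: "(nat \<Rightarrow> nat) \<Rightarrow> nat \<Rightarrow> nat set" where
  "missed l h = {i. i < n \<and> z i = h \<and> l i \<noteq> h}"

definition intruders :: "(nat \<Rightarrow> nat) \<Rightarrow> nat \<Rightarrow> nat set" where
  "intruders l h = {i. i < n \<and> l i = h \<and> z i \<noteq> h}"

lemma sum_card_missed: "(\<Sum>h<k. card (missed l h)) = card (errors l)"
proof -
  have "errors l = (\<Union>h<k. missed l h)" using label by (auto simp: errors_def missed_def)
  then show ?thesis
    by (simp add: card_UN_disjoint missed_def disjoint_iff)
qed

lemma sum_card_intruders:
  assumes "\<And>i. i < n \<Longrightarrow> l i < k"
  shows "(\<Sum>h<k. card (intruders l h)) = card (errors l)"
proof -
  have "errors l = (\<Union>h<k. intruders l h)" using assms by (auto simp: errors_def intruders_def)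
  then show ?thesis
    by (simp add: card_UN_disjoint intruders_def disjoint_iff)
qed

text \<open>
  Compared with the mean of the true cluster, the new mean is displaced by the missed points, which take
  away noise only, and by the intruders.  Grouping the intruders by their true clusters and using the
  Cauchy-Schwarz inequality over the \<open>k\<close> groups produces the factor \<open>sqrt k\<close>.
\<close>

lemma new_center:
  assumes l: "\<And>i. i < n \<Longrightarrow> l i < k" and h: "h < k"
    and few: "card (errors l) \<le> m / 2"
    and drift: "\<And>g. g < k \<Longrightarrow> g \<noteq> h \<Longrightarrow>
      norm (\<Sum>i\<in>{i. i < n \<and> z i = g \<and> l i = h}. y i - \<theta> h) \<le>
        5 * B * sqrt (card {i. i < n \<and> z i = g \<and> l i = h})"
    and c: "c = (\<Sum>i | i < n \<and> l i = h. y i) /\<^sub>R card {i. i < n \<and> l i = h}"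
  shows "{i. i < n \<and> l i = h} \<noteq> {}"
    and "norm (c - \<theta> h - mean_noise h) \<le>
      12 * B * sqrt k / m * (sqrt (card (missed l h)) + sqrt (card (intruders l h)))"
proof -
  let ?S = "{i. i < n \<and> l i = h}" and ?M = "missed l h" and ?I = "intruders l h" and ?f = "mean_noise h"
  let ?K = "T h \<inter> ?S"
  have fin [simp]: "finite ?S" "finite ?M" "finite ?I" by (auto simp: missed_def intruders_def)
  have T_split: "T h = ?K \<union> ?M" and T_disj: "?K \<inter> ?M = {}"
    and S_split: "?S = ?K \<union> ?I" and S_disj: "?K \<inter> ?I = {}"
    by (auto simp: T_def missed_def intruders_def)
  have cT: "real (card (T h)) = card ?K + card ?M"
    by (subst T_split, subst card_Un_disjoint) (use T_disj in auto)
  have cS: "real (card ?S) = card ?K + card ?I"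
    by (subst S_split, subst card_Un_disjoint) (use S_disj in auto)
  have "card ?M \<le> card (errors l)" "card ?I \<le> card (errors l)"
    by (rule card_mono; auto simp: missed_def intruders_def errors_def)+
  then have M_le: "real (card ?M) \<le> m / 2" and I_le: "real (card ?I) \<le> m / 2"
    using few by linarith+
  have mT: "m \<le> card (T h)" by (rule m_le_card[OF h])
  have S_ge: "m / 2 \<le> card ?S" using cT cS M_le mT by linarith
  then have S_pos: "0 < real (card ?S)" using m_pos by linarith
  then show "?S \<noteq> {}" by (auto simp: card_gt_0_iff)
  have "(\<Sum>i\<in>T h. w i - ?f) = 0"
    using card_mean_noise[OF h] by (simp add: sum_subtractf sum_constant_scaleR)
  moreover have "(\<Sum>i\<in>T h. w i - ?f) = (\<Sum>i\<in>?K. w i - ?f) + (\<Sum>i\<in>?M. w i - ?f)"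
    using sum.union_disjoint[of ?K ?M "\<lambda>i. w i - ?f", OF _ fin(2) T_disj]
    unfolding T_split[symmetric] by simp
  ultimately have K: "(\<Sum>i\<in>?K. w i - ?f) = - (\<Sum>i\<in>?M. w i - ?f)"
    by (simp only: eq_neg_iff_add_eq_0)
  have "card ?S *\<^sub>R (c - \<theta> h - ?f) = (\<Sum>i\<in>?S. y i - \<theta> h - ?f)"
  proof -
    have "real (card ?S) * inverse (card ?S) = 1"
      by (intro right_inverse) (use S_pos in linarith)
    then have "card ?S *\<^sub>R c = (\<Sum>i\<in>?S. y i)"
      by (simp only: c scaleR_scaleR scaleR_one)
    then show ?thesis by (simp add: sum_subtractf sum_constant_scaleR scaleR_diff_right)
  qed
  also have "\<dots> = (\<Sum>i\<in>?K. y i - \<theta> h - ?f) + (\<Sum>i\<in>?I. y i - \<theta> h - ?f)"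
    using sum.union_disjoint[of ?K ?I "\<lambda>i. y i - \<theta> h - ?f", OF _ fin(3) S_disj]
    unfolding S_split[symmetric] by simp
  also have "(\<Sum>i\<in>?K. y i - \<theta> h - ?f) = (\<Sum>i\<in>?K. w i - ?f)"
    by (intro sum.cong) (auto simp: y_def T_def)
  also have "(\<Sum>i\<in>?I. y i - \<theta> h - ?f) = (\<Sum>i\<in>?I. y i - \<theta> h) - card ?I *\<^sub>R ?f"
    by (simp add: sum_subtractf sum_constant_scaleR)
  finally have decomp: "card ?S *\<^sub>R (c - \<theta> h - ?f) =
      - sum w ?M + card ?M *\<^sub>R ?f + (\<Sum>i\<in>?I. y i - \<theta> h) - card ?I *\<^sub>R ?f"
    unfolding K by (simp add: sum_subtractf sum_constant_scaleR)
  have f: "a * norm ?f \<le> B * sqrt a" if "0 \<le> a" "a \<le> card (T h)" for a :: real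
  proof -
    have "a * norm ?f \<le> a * (B / sqrt (card (T h)))"
      using norm_mean_noise[OF h] that by (intro mult_left_mono)
    also have "\<dots> = B * sqrt a * (sqrt a / sqrt (card (T h)))"
      using that by simp
    also have "\<dots> \<le> B * sqrt a * 1"
    proof (rule mult_left_mono)
      show "sqrt a / sqrt (card (T h)) \<le> 1"
        using that card_T_pos[OF h] by (simp del: of_nat_0_less_iff)
    qed (use that B_nonneg in simp)
    finally show ?thesis by simp
  qed
  have I_sum: "norm (\<Sum>i\<in>?I. y i - \<theta> h) \<le> 5 * B * (sqrt k * sqrt (card ?I))"
  proof -
    let ?G = "\<lambda>g. {i. i < n \<and> z i = g \<and> l i = h} - T h"
    have I_eq: "?I = (\<Union>g<k. ?G g)" using label by (auto simp: intruders_def T_def)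
    have disj: "\<forall>g\<in>{..<k}. \<forall>g'\<in>{..<k}. g \<noteq> g' \<longrightarrow> ?G g \<inter> ?G g' = {}" by auto
    have cI: "real (card ?I) = (\<Sum>g<k. real (card (?G g)))"
      unfolding I_eq using disj by (subst card_UN_disjoint) auto
    have "(\<Sum>i\<in>?I. y i - \<theta> h) = (\<Sum>g<k. \<Sum>i\<in>?G g. y i - \<theta> h)"
      unfolding I_eq using disj by (intro sum.UNION_disjoint) auto
    then have "norm (\<Sum>i\<in>?I. y i - \<theta> h) \<le> (\<Sum>g<k. norm (\<Sum>i\<in>?G g. y i - \<theta> h))"
      by (simp add: norm_sum)
    also have "\<dots> \<le> (\<Sum>g<k. 5 * B * sqrt (card (?G g)))"
    proof (rule sum_mono)
      fix g assume g: "g \<in> {..<k}"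
      show "norm (\<Sum>i\<in>?G g. y i - \<theta> h) \<le> 5 * B * sqrt (card (?G g))"
      proof (cases "g = h")
        case True
        then have "?G g = {}" by (auto simp: T_def)
        then show ?thesis by (simp only: sum.empty card.empty) simp
      next
        case False
        then have "?G g = {i. i < n \<and> z i = g \<and> l i = h}" by (auto simp: T_def)
        then show ?thesis using drift[of g] g False by simp
      qed
    qed
    also have "\<dots> = 5 * B * (\<Sum>g<k. sqrt (card (?G g)))" by (simp add: sum_distrib_left)
    also have "\<dots> \<le> 5 * B * (sqrt k * sqrt (\<Sum>g<k. real (card (?G g))))"
      using B_nonneg by (intro mult_left_mono sum_sqrt_le) auto
    finally show ?thesis unfolding cI .
  qed
  have "norm (card ?S *\<^sub>R (c - \<theta> h - ?f)) \<le>
      norm (sum w ?M) + card ?M * norm ?f + norm (\<Sum>i\<in>?I. y i - \<theta> h) + card ?I * norm ?f"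
  proof -
    have "norm (- a + b + c - d) \<le> norm a + norm b + norm c + norm d" for a b c d :: 'v
      using norm_triangle_ineq4[of "- a + b + c" d] norm_triangle_ineq[of "- a + b" c]
        norm_triangle_ineq[of "- a" b] by simp
    from this[of "sum w ?M" "card ?M *\<^sub>R ?f" "\<Sum>i\<in>?I. y i - \<theta> h" "card ?I *\<^sub>R ?f"]
    show ?thesis unfolding decomp by simp
  qed
  also have "\<dots> \<le> B * sqrt (card ?M) + B * sqrt (card ?M) + 5 * B * (sqrt k * sqrt (card ?I)) + B * sqrt (card ?I)"
  proof -
    have "norm (sum w ?M) \<le> B * sqrt (card ?M)"
      by (rule operator_bound_subset[OF noise]) (auto simp: missed_def)
    moreover have "card ?M * norm ?f \<le> B * sqrt (card ?M)" "card ?I * norm ?f \<le> B * sqrt (card ?I)"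
      using M_le I_le mT m_pos by (intro f; simp)+
    ultimately show ?thesis using I_sum by linarith
  qed
  also have "\<dots> = B * (2 * sqrt (card ?M) + 5 * (sqrt k * sqrt (card ?I)) + sqrt (card ?I))"
    by (simp add: algebra_simps)
  \<comment> \<open>The sizes are balanced only crudely: \<open>2 \<le> 6 * sqrt k\<close> and \<open>5 * sqrt k + 1 \<le> 6 * sqrt k\<close>.\<close>
  also have "\<dots> \<le> B * (6 * sqrt k * (sqrt (card ?M) + sqrt (card ?I)))"
  proof (intro mult_left_mono B_nonneg)
    have s: "1 \<le> sqrt k" using k_pos by simp
    have "1 * sqrt (card ?M) \<le> sqrt k * sqrt (card ?M)" "1 * sqrt (card ?I) \<le> sqrt k * sqrt (card ?I)"
      using s by (intro mult_right_mono; simp)+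
    moreover have "0 \<le> sqrt k * sqrt (card ?M)" by simp
    ultimately have "2 * sqrt (card ?M) \<le> 6 * (sqrt k * sqrt (card ?M))"
      "sqrt (card ?I) \<le> sqrt k * sqrt (card ?I)" by linarith+
    then show "2 * sqrt (card ?M) + 5 * (sqrt k * sqrt (card ?I)) + sqrt (card ?I)
        \<le> 6 * sqrt k * (sqrt (card ?M) + sqrt (card ?I))" by (simp add: algebra_simps)
  qed
  finally have S_norm: "card ?S * norm (c - \<theta> h - ?f) \<le> B * (6 * sqrt k * (sqrt (card ?M) + sqrt (card ?I)))"
    by simp
  have "m / 2 * norm (c - \<theta> h - ?f) \<le> card ?S * norm (c - \<theta> h - ?f)"
    using S_ge by (intro mult_right_mono) auto
  with S_norm have "m / 2 * norm (c - \<theta> h - ?f) \<le> B * (6 * sqrt k * (sqrt (card ?M) + sqrt (card ?I)))"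
    by linarith
  then show "norm (c - \<theta> h - ?f) \<le> 12 * B * sqrt k / m * (sqrt (card ?M) + sqrt (card ?I))"
    using m_pos by (simp add: field_simps)
qed

end

section \<open>Contraction of the number of errors\<close>

context separated_clusters
begin

text \<open>
  The points that may be misassigned however good the centers are: either the noise reaches almost halfway
  to another center, or it is aligned with the mean noise of some cluster.
\<close>

definition bad :: "real \<Rightarrow> real \<Rightarrow> nat set" where
  "bad \<eta> \<xi> = {i. i < n \<and>
     ((\<exists>h<k. h \<noteq> z i \<and>
         (1 - 2 * \<eta> - \<xi>) * (norm (\<theta> h - \<theta> (z i)))\<^sup>2 / 2 \<le> inner (w i) (\<theta> h - \<theta> (z i))) \<or>
      (\<exists>h<k. \<xi> * \<Delta>\<^sup>2 / 8 \<le> \<bar>inner (w i) (mean_noise h)\<bar>))}"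

definition nearest :: "(nat \<Rightarrow> 'v) \<Rightarrow> (nat \<Rightarrow> nat) \<Rightarrow> bool" where
  "nearest c l \<longleftrightarrow> (\<forall>i<n. l i < k \<and> (\<forall>h<k. norm (y i - c (l i)) \<le> norm (y i - c h)))"

lemma finite_bad [simp]: "finite (bad \<eta> \<xi>)"
  by (simp add: bad_def)

text \<open>
  Chebyshev's inequality for the uniform distribution on the indices.
\<close>

lemma card_large_inner:
  assumes "0 < t"
  shows "real (card {i. i < n \<and> t \<le> \<bar>inner (w i) v\<bar>}) \<le> B\<^sup>2 * (norm v)\<^sup>2 / t\<^sup>2"
proof -
  let ?L = "{i. i < n \<and> t \<le> \<bar>inner (w i) v\<bar>}"
  have "real (card ?L) * t\<^sup>2 \<le> (\<Sum>i\<in>?L. (inner (w i) v)\<^sup>2)"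
  proof (rule sum_bounded_below)
    fix i assume "i \<in> ?L"
    then have "t\<^sup>2 \<le> \<bar>inner (w i) v\<bar>\<^sup>2" using assms by (intro power_mono) auto
    then show "t\<^sup>2 \<le> (inner (w i) v)\<^sup>2" by simp
  qed
  also have "\<dots> \<le> (\<Sum>i<n. (inner (w i) v)\<^sup>2)"
    by (rule sum_mono2) auto
  also have "\<dots> \<le> B\<^sup>2 * (norm v)\<^sup>2" by (rule operator_bound_inner[OF noise])
  finally show ?thesis using assms by (simp add: field_simps)
qed

text \<open>
  The vector \<open>f h\<close> is the part of the error of the center of \<open>h\<close> whose effect is already accounted for by the
  bad points.  Only the rest of the error can cause further misassignments.
\<close>

lemma errors_subset:
  assumes near: "nearest c l"
    and c: "\<And>h. h < k \<Longrightarrow> norm (c h - \<theta> h) \<le> \<eta> * \<Delta>"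
    and f: "\<And>i h. i < n \<Longrightarrow> i \<notin> bad \<eta> \<xi> \<Longrightarrow> h < k \<Longrightarrow> \<bar>inner (w i) (f h)\<bar> < \<xi> * \<Delta>\<^sup>2 / 8"
    and \<eta>: "0 \<le> \<eta>" "\<eta> \<le> 1" and \<xi>: "0 < \<xi>"
  shows "errors l \<subseteq> bad \<eta> \<xi> \<union> (\<Union>h<k. {i. i < n \<and> \<xi> * \<Delta>\<^sup>2 / 8 \<le> \<bar>inner (w i) (c h - \<theta> h - f h)\<bar>})"
proof
  fix i assume i: "i \<in> errors l"
  let ?g = "z i" and ?h = "l i"
  let ?D = "norm (\<theta> ?h - \<theta> ?g)" and ?t = "\<xi> * \<Delta>\<^sup>2 / 8"
  let ?r = "\<lambda>h. c h - \<theta> h - f h"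
  have i_n: "i < n" and gh: "?h \<noteq> ?g" using i by (auto simp: errors_def)
  have g: "?g < k" and h: "?h < k" using label[OF i_n] near i_n by (auto simp: nearest_def)
  have D: "\<Delta> \<le> ?D" using separated[OF h g gh] .
  have \<eta>D: "\<eta> * \<Delta> \<le> \<eta> * ?D" using D \<eta> by (intro mult_left_mono) auto
  have main: "(1 - 2 * \<eta>) * ?D\<^sup>2 / 2 \<le> inner (w i) (c ?h - c ?g)"
  proof (rule misassigned_noise[where \<eta> = \<eta>])
    show "norm (\<theta> ?g + w i - c ?h) \<le> norm (\<theta> ?g + w i - c ?g)"
      using near i_n g unfolding nearest_def y_def by blast
    show "norm (c ?g - \<theta> ?g) \<le> \<eta> * ?D" "norm (c ?h - \<theta> ?h) \<le> \<eta> * ?D"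
      using c[OF g] c[OF h] \<eta>D by auto
  qed (rule \<eta>)
  \<comment> \<open>If \<open>i\<close> were not in the right-hand side, the last four terms would sum to less than \<open>\<xi> * \<Delta>\<^sup>2 / 2\<close>.\<close>
  have split: "inner (w i) (c ?h - c ?g) = inner (w i) (\<theta> ?h - \<theta> ?g)
      + inner (w i) (f ?h) - inner (w i) (f ?g) + inner (w i) (?r ?h) - inner (w i) (?r ?g)"
    by (simp add: inner_simps)
  show "i \<in> bad \<eta> \<xi> \<union> (\<Union>h<k. {i. i < n \<and> ?t \<le> \<bar>inner (w i) (?r h)\<bar>})"
  proof (rule ccontr)
    assume not: "\<not> ?thesis"
    then have nb: "i \<notin> bad \<eta> \<xi>" by blast
    have r: "\<bar>inner (w i) (?r h')\<bar> < ?t" if "h' < k" for h'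
      using not i_n that by (auto simp: not_le)
    have "inner (w i) (\<theta> ?h - \<theta> ?g) < (1 - 2 * \<eta> - \<xi>) * ?D\<^sup>2 / 2"
      using nb i_n gh h by (auto simp: bad_def not_le)
    moreover have "\<xi> * \<Delta>\<^sup>2 \<le> \<xi> * ?D\<^sup>2"
      using \<xi> D \<Delta>_pos by (intro mult_left_mono power_mono) auto
    moreover have "(1 - 2 * \<eta> - \<xi>) * ?D\<^sup>2 / 2 = (1 - 2 * \<eta>) * ?D\<^sup>2 / 2 - \<xi> * ?D\<^sup>2 / 2"
      by (simp add: algebra_simps diff_divide_distrib)
    moreover have "inner (w i) (f ?h) < ?t" "- inner (w i) (f ?g) < ?t"
      "inner (w i) (?r ?h) < ?t" "- inner (w i) (?r ?g) < ?t"
      using f[OF i_n nb h] f[OF i_n nb g] r[OF h] r[OF g] by linarith+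
    ultimately show False using main split by linarith
  qed
qed

lemma card_errors_le:
  assumes "nearest c l"
    and "\<And>h. h < k \<Longrightarrow> norm (c h - \<theta> h) \<le> \<eta> * \<Delta>"
    and "\<And>i h. i < n \<Longrightarrow> i \<notin> bad \<eta> \<xi> \<Longrightarrow> h < k \<Longrightarrow> \<bar>inner (w i) (f h)\<bar> < \<xi> * \<Delta>\<^sup>2 / 8"
    and "0 \<le> \<eta>" "\<eta> \<le> 1" and \<xi>: "0 < \<xi>"
  shows "real (card (errors l)) \<le>
    card (bad \<eta> \<xi>) + 64 * B\<^sup>2 / (\<xi>\<^sup>2 * \<Delta> ^ 4) * (\<Sum>h<k. (norm (c h - \<theta> h - f h))\<^sup>2)"
proof -
  let ?t = "\<xi> * \<Delta>\<^sup>2 / 8"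
  let ?L = "\<lambda>h. {i. i < n \<and> ?t \<le> \<bar>inner (w i) (c h - \<theta> h - f h)\<bar>}"
  have t: "0 < ?t" using \<xi> \<Delta>_pos by simp
  have "card (errors l) \<le> card (bad \<eta> \<xi> \<union> (\<Union>h<k. ?L h))"
    by (rule card_mono[OF _ errors_subset[OF assms]]) auto
  also have "\<dots> \<le> card (bad \<eta> \<xi>) + card (\<Union>h<k. ?L h)" by (rule card_Un_le)
  also have "\<dots> \<le> card (bad \<eta> \<xi>) + (\<Sum>h<k. card (?L h))"
    by (intro add_left_mono card_UN_le) simp
  finally have "real (card (errors l)) \<le> real (card (bad \<eta> \<xi>) + (\<Sum>h<k. card (?L h)))"
    by (rule of_nat_mono)
  also have "\<dots> = card (bad \<eta> \<xi>) + (\<Sum>h<k. real (card (?L h)))" by simp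
  also have "\<dots> \<le> card (bad \<eta> \<xi>) + (\<Sum>h<k. B\<^sup>2 * (norm (c h - \<theta> h - f h))\<^sup>2 / ?t\<^sup>2)"
    by (intro add_left_mono sum_mono card_large_inner t)
  also have "(\<Sum>h<k. B\<^sup>2 * (norm (c h - \<theta> h - f h))\<^sup>2 / ?t\<^sup>2) =
      64 * B\<^sup>2 / (\<xi>\<^sup>2 * \<Delta> ^ 4) * (\<Sum>h<k. (norm (c h - \<theta> h - f h))\<^sup>2)"
    unfolding sum_distrib_left by (intro sum.cong) (auto simp: power_divide power_mult_distrib)
  finally show ?thesis .
qed

text \<open>
  The initial centers have no known relation to cluster means, so their whole error counts as
  remainder.  The resulting number of errors is a small multiple of the cluster size, which is what the
  later iterations need as a start.
\<close>

lemma first_iteration: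
  assumes near: "nearest c l"
    and c: "\<And>h. h < k \<Longrightarrow> norm (c h - \<theta> h) \<le> \<eta> * \<Delta>"
    and \<eta>: "0 \<le> \<eta>" "\<eta> \<le> 1" "256 * \<eta>\<^sup>2 * \<rho>\<^sup>2 \<le> \<xi>\<^sup>2" and \<xi>: "0 < \<xi>"
  shows "real (card (errors l)) \<le> card (bad \<eta> \<xi>) + m / 4"
proof -
  have "real (card (errors l)) \<le>
      card (bad \<eta> \<xi>) + 64 * B\<^sup>2 / (\<xi>\<^sup>2 * \<Delta> ^ 4) * (\<Sum>h<k. (norm (c h - \<theta> h - 0))\<^sup>2)"
    using card_errors_le[OF near c, of \<xi> "\<lambda>_. 0"] \<eta> \<xi> \<Delta>_pos by simp
  moreover have "64 * B\<^sup>2 / (\<xi>\<^sup>2 * \<Delta> ^ 4) * (\<Sum>h<k. (norm (c h - \<theta> h - 0))\<^sup>2)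
      \<le> 64 * B\<^sup>2 / (\<xi>\<^sup>2 * \<Delta> ^ 4) * (\<Sum>h<k. (\<eta> * \<Delta>)\<^sup>2)"
    using c by (intro mult_left_mono sum_mono power_mono) auto
  moreover have "\<dots> = 64 * \<eta>\<^sup>2 / (\<xi>\<^sup>2 * \<Delta>\<^sup>2) * (k * B\<^sup>2)"
    using \<Delta>_pos \<xi> by (simp add: field_simps power_mult_distrib)
  moreover have "\<dots> \<le> 64 * \<eta>\<^sup>2 / (\<xi>\<^sup>2 * \<Delta>\<^sup>2) * (\<rho>\<^sup>2 * m * \<Delta>\<^sup>2)"
    by (intro mult_left_mono noise_level) auto
  moreover have "\<dots> = (256 * \<eta>\<^sup>2 * \<rho>\<^sup>2) * (m / 4) / \<xi>\<^sup>2"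
    using \<Delta>_pos by simp
  moreover have "\<dots> \<le> \<xi>\<^sup>2 * (m / 4) / \<xi>\<^sup>2"
    using \<eta>(3) m_pos by (intro divide_right_mono mult_right_mono) auto
  ultimately show ?thesis using \<xi> by simp
qed

lemma center_update:
  assumes near: "nearest c l"
    and c: "\<And>h. h < k \<Longrightarrow> norm (c h - \<theta> h) \<le> \<eta> * \<Delta>"
    and \<eta>: "0 \<le> \<eta>" "\<eta> \<le> 1 / 8"
    and few: "card (errors l) \<le> m / 2"
    and c': "\<And>h. h < k \<Longrightarrow> {i. i < n \<and> l i = h} \<noteq> {} \<Longrightarrow>
      c' h = (\<Sum>i | i < n \<and> l i = h. y i) /\<^sub>R card {i. i < n \<and> l i = h}"
    and h: "h < k"
  shows "norm (c' h - \<theta> h - mean_noise h) \<le>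
      12 * B * sqrt k / m * (sqrt (card (missed l h)) + sqrt (card (intruders l h)))"
proof -
  have l: "l i < k" if "i < n" for i using near that by (simp add: nearest_def)
  have drift: "norm (\<Sum>i\<in>{i. i < n \<and> z i = g \<and> l i = h}. y i - \<theta> h) \<le>
        5 * B * sqrt (card {i. i < n \<and> z i = g \<and> l i = h})" if g: "g < k" "g \<noteq> h" for g
  proof (rule misassigned_drift[OF g(1) h g(2) _ _ c[OF g(1)] c[OF h] \<eta>])
    show "{i. i < n \<and> z i = g \<and> l i = h} \<subseteq> T g" by (auto simp: T_def)
    show "norm (y i - c h) \<le> norm (y i - c g)" if "i \<in> {i. i < n \<and> z i = g \<and> l i = h}" for i
      using that near g unfolding nearest_def by blast
  qed
  note new = new_center[OF l h few drift]
  show ?thesis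
    using new(2)[OF _ _ _ c'[OF h new(1)]] by blast
qed

lemma sum_center_update_le:
  assumes l: "\<And>i. i < n \<Longrightarrow> l i < k"
    and r: "\<And>h. h < k \<Longrightarrow> norm (r h) \<le>
      12 * B * sqrt k / m * (sqrt (card (missed l h)) + sqrt (card (intruders l h)))"
  shows "(\<Sum>h<k. (norm (r h))\<^sup>2) \<le> 576 * B\<^sup>2 * k / m\<^sup>2 * card (errors l)"
proof -
  have sq: "(sqrt a + sqrt b)\<^sup>2 \<le> 2 * (a + b)" if "0 \<le> a" "0 \<le> b" for a b :: real
    using that sum_squares_bound[of "sqrt a" "sqrt b"] by (simp add: power2_sum)
  have "(\<Sum>h<k. (norm (r h))\<^sup>2) \<le>
      (\<Sum>h<k. 144 * B\<^sup>2 * k / m\<^sup>2 * (2 * (real (card (missed l h)) + card (intruders l h))))"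
  proof (rule sum_mono)
    fix h assume h: "h \<in> {..<k}"
    have "(norm (r h))\<^sup>2 \<le> (12 * B * sqrt k / m * (sqrt (card (missed l h)) + sqrt (card (intruders l h))))\<^sup>2"
      using r h by (intro power_mono) auto
    also have "\<dots> = 144 * B\<^sup>2 * k / m\<^sup>2 * (sqrt (card (missed l h)) + sqrt (card (intruders l h)))\<^sup>2"
      by (simp add: power_mult_distrib power_divide)
    also have "\<dots> \<le> 144 * B\<^sup>2 * k / m\<^sup>2 * (2 * (real (card (missed l h)) + card (intruders l h)))"
      by (intro mult_left_mono sq) auto
    finally show "(norm (r h))\<^sup>2 \<le> 144 * B\<^sup>2 * k / m\<^sup>2 * (2 * (real (card (missed l h)) + card (intruders l h)))" .
  qed
  also have "\<dots> = 288 * B\<^sup>2 * k / m\<^sup>2 * ((\<Sum>h<k. real (card (missed l h))) + (\<Sum>h<k. real (card (intruders l h))))"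
    unfolding sum.distrib[symmetric] sum_distrib_left by (intro sum.cong) auto
  also have "(\<Sum>h<k. real (card (missed l h))) = card (errors l)"
    by (simp flip: sum_card_missed)
  also have "(\<Sum>h<k. real (card (intruders l h))) = card (errors l)"
    by (simp flip: sum_card_intruders[OF l])
  finally show ?thesis by simp
qed

text \<open>
  The remainder contributes \<open>17 * \<rho> * \<Delta>\<close>, as \<open>12 * sqrt 2 \<le> 17\<close>, and the mean noise one more \<open>\<rho> * \<Delta>\<close>.
\<close>

lemma next_centers:
  assumes near: "nearest c l"
    and c: "\<And>h. h < k \<Longrightarrow> norm (c h - \<theta> h) \<le> \<eta> * \<Delta>"
    and \<eta>: "0 \<le> \<eta>" "\<eta> \<le> 1 / 8"
    and few: "card (errors l) \<le> m / 2"
    and c': "\<And>h. h < k \<Longrightarrow> {i. i < n \<and> l i = h} \<noteq> {} \<Longrightarrow>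
      c' h = (\<Sum>i | i < n \<and> l i = h. y i) /\<^sub>R card {i. i < n \<and> l i = h}"
    and h: "h < k"
  shows "norm (c' h - \<theta> h) \<le> 18 * \<rho> * \<Delta>"
proof -
  have half: "sqrt (card A) \<le> sqrt (m / 2)" if "A \<subseteq> errors l" for A
    using few card_mono[OF finite_errors that] by simp
  have "norm (c' h - \<theta> h - mean_noise h) \<le>
      12 * B * sqrt k / m * (sqrt (card (missed l h)) + sqrt (card (intruders l h)))"
    by (rule center_update[OF near c \<eta> few c' h])
  also have "\<dots> \<le> 12 * B * sqrt k / m * (sqrt (m / 2) + sqrt (m / 2))"
    using B_nonneg m_pos
    by (intro mult_left_mono add_mono half) (auto simp: missed_def intruders_def errors_def)
  finally have "(norm (c' h - \<theta> h - mean_noise h))\<^sup>2 \<le> (12 * B * sqrt k / m * (2 * sqrt (m / 2)))\<^sup>2"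
    by (intro power_mono) auto
  also have "\<dots> = 288 / m * (k * B\<^sup>2)"
    using m_pos by (simp add: power_mult_distrib power_divide) (simp add: power2_eq_square)
  also have "\<dots> \<le> 288 / m * (\<rho>\<^sup>2 * m * \<Delta>\<^sup>2)"
    using m_pos by (intro mult_left_mono noise_level) auto
  also have "\<dots> \<le> (17 * \<rho> * \<Delta>)\<^sup>2"
    using m_pos by (simp add: power_mult_distrib)
  finally have "norm (c' h - \<theta> h - mean_noise h) \<le> 17 * \<rho> * \<Delta>"
    by (rule power2_le_imp_le) (use \<rho>_pos \<Delta>_pos in simp)
  then show ?thesis
    using norm_mean_noise_le[OF h] norm_triangle_ineq[of "c' h - \<theta> h - mean_noise h" "mean_noise h"] by simp
qed

text \<open>
  The centers are now cluster means.  Up to the mean noise, which is taken care of by the bad points,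
  their squared errors are proportional to the previous number of errors, so this number contracts.  The
  constant is \<open>110592 = 64 * 576 * 3\<close>, from \<open>card_errors_le\<close>, \<open>sum_center_update_le\<close> and the factor \<open>1 / 3\<close>.
\<close>

lemma later_iteration:
  assumes near: "nearest c l" and near': "nearest c' l'"
    and c: "\<And>h. h < k \<Longrightarrow> norm (c h - \<theta> h) \<le> \<eta> * \<Delta>"
    and \<eta>: "18 * \<rho> \<le> \<eta>" "\<eta> \<le> 1 / 8"
    and few: "card (errors l) \<le> m / 2"
    and c': "\<And>h. h < k \<Longrightarrow> {i. i < n \<and> l i = h} \<noteq> {} \<Longrightarrow>
      c' h = (\<Sum>i | i < n \<and> l i = h. y i) /\<^sub>R card {i. i < n \<and> l i = h}"
    and \<xi>: "0 < \<xi>" "110592 * \<rho> ^ 4 \<le> \<xi>\<^sup>2"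
  shows "real (card (errors l')) \<le> card (bad \<eta> \<xi>) + card (errors l) / 3"
proof -
  have \<eta>0: "0 \<le> \<eta>" using \<eta> \<rho>_pos by simp
  have l: "l i < k" if "i < n" for i using near that by (simp add: nearest_def)
  let ?N = "real (card (errors l))" and ?q = "64 * B\<^sup>2 / (\<xi>\<^sup>2 * \<Delta> ^ 4)"
  have c'_le: "norm (c' h - \<theta> h) \<le> \<eta> * \<Delta>" if "h < k" for h
  proof -
    have "norm (c' h - \<theta> h) \<le> 18 * \<rho> * \<Delta>" by (rule next_centers[OF near c \<eta>0 \<eta>(2) few c' that])
    also have "\<dots> \<le> \<eta> * \<Delta>" using \<eta> \<Delta>_pos by simp
    finally show ?thesis .
  qed
  have "real (card (errors l')) \<le> card (bad \<eta> \<xi>) + ?q * (\<Sum>h<k. (norm (c' h - \<theta> h - mean_noise h))\<^sup>2)"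
    using \<eta>0 \<eta> \<xi> by (intro card_errors_le[OF near' c'_le]) (auto simp: bad_def not_le)
  moreover have "?q * (\<Sum>h<k. (norm (c' h - \<theta> h - mean_noise h))\<^sup>2) \<le> ?q * (576 * B\<^sup>2 * k / m\<^sup>2 * ?N)"
    by (intro mult_left_mono sum_center_update_le[OF l] center_update[OF near c \<eta>0 \<eta>(2) few c']) auto
  moreover have "\<dots> = 36864 / (\<xi>\<^sup>2 * \<Delta> ^ 4 * m\<^sup>2) * ((k * B\<^sup>2) * B\<^sup>2) * ?N" by simp
  moreover have "\<dots> \<le> 36864 / (\<xi>\<^sup>2 * \<Delta> ^ 4 * m\<^sup>2) * ((\<rho>\<^sup>2 * m * \<Delta>\<^sup>2) * (\<rho>\<^sup>2 * m * \<Delta>\<^sup>2)) * ?N"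
    using m_pos by (intro mult_right_mono mult_left_mono mult_mono noise_level B_sq_le) auto
  moreover have "\<dots> = 110592 * \<rho> ^ 4 / \<xi>\<^sup>2 * (?N / 3)"
    using m_pos \<Delta>_pos by (simp add: field_simps power2_eq_square power4_eq_xxxx)
  moreover have "\<dots> \<le> \<xi>\<^sup>2 / \<xi>\<^sup>2 * (?N / 3)"
    using \<xi> by (intro mult_right_mono divide_right_mono) auto
  ultimately have "real (card (errors l')) \<le> card (bad \<eta> \<xi>) + \<xi>\<^sup>2 / \<xi>\<^sup>2 * (?N / 3)"
    by linarith
  then show ?thesis using \<xi> by simp
qed

text \<open>
  The factor \<open>3 / 2\<close> is the geometric series \<open>1 + 1 / 3 + 1 / 9 + \<dots>\<close>.  The bound on the number of errors is
  carried through the induction together with the accuracy of the centers and the fact that there are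
  at most \<open>m / 2\<close> errors, so that no cluster loses more than half of its points.
\<close>

lemma lloyd_errors:
  assumes near: "\<And>s. nearest (c s) (l (Suc s))"
    and means: "\<And>s h. h < k \<Longrightarrow> {i. i < n \<and> l (Suc s) i = h} \<noteq> {} \<Longrightarrow>
      c (Suc s) h = (\<Sum>i | i < n \<and> l (Suc s) i = h. y i) /\<^sub>R card {i. i < n \<and> l (Suc s) i = h}"
    and init: "\<And>h. h < k \<Longrightarrow> norm (c 0 h - \<theta> h) \<le> \<eta> * \<Delta>"
    and \<eta>: "18 * \<rho> \<le> \<eta>" "\<eta> \<le> 1 / 8" "256 * \<eta>\<^sup>2 * \<rho>\<^sup>2 \<le> \<xi>\<^sup>2"
    and \<xi>: "0 < \<xi>" "110592 * \<rho> ^ 4 \<le> \<xi>\<^sup>2"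
    and few_bad: "real (card (bad \<eta> \<xi>)) \<le> m / 4"
  shows "real (card (errors (l (Suc s)))) \<le> 3 / 2 * card (bad \<eta> \<xi>) + n / 3 ^ s"
proof -
  have \<eta>0: "0 \<le> \<eta>" using \<eta> \<rho>_pos by simp
  have "(\<forall>h<k. norm (c s h - \<theta> h) \<le> \<eta> * \<Delta>) \<and> real (card (errors (l (Suc s)))) \<le> m / 2 \<and>
    real (card (errors (l (Suc s)))) \<le> 3 / 2 * card (bad \<eta> \<xi>) + n / 3 ^ s"
  proof (induction s)
    case 0
    have "card (errors (l 1)) \<le> n"
      using card_mono[of "{..<n}" "errors (l 1)"] by (auto simp: errors_def)
    then have "real (card (errors (l 1))) \<le> real n" by simp
    moreover have "real (card (errors (l 1))) \<le> card (bad \<eta> \<xi>) + m / 4"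
      using first_iteration[OF near init \<eta>0 _ \<eta>(3) \<xi>(1)] \<eta> by simp
    ultimately show ?case using few_bad init by simp
  next
    case (Suc s)
    have c: "norm (c s h - \<theta> h) \<le> \<eta> * \<Delta>" if "h < k" for h using Suc that by blast
    have few: "real (card (errors (l (Suc s)))) \<le> m / 2" using Suc by blast
    have "norm (c (Suc s) h - \<theta> h) \<le> \<eta> * \<Delta>" if "h < k" for h
    proof -
      have "norm (c (Suc s) h - \<theta> h) \<le> 18 * \<rho> * \<Delta>"
        by (rule next_centers[OF near c \<eta>0 \<eta>(2) few means that])
      also have "\<dots> \<le> \<eta> * \<Delta>" using \<eta> \<Delta>_pos by simp
      finally show ?thesis .
    qed
    moreover have "real (card (errors (l (Suc (Suc s))))) \<le> card (bad \<eta> \<xi>) + card (errors (l (Suc s))) / 3"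
      by (rule later_iteration[OF near near c \<eta>(1,2) few means \<xi>])
    ultimately show ?case using Suc few_bad m_pos by auto
  qed
  then show ?thesis by blast
qed

text \<open>
  After this many iterations the initial errors contribute less than 1 to the bound.  The number of errors
  is an integer, so this contribution matters only if there is a bad point, and can then be absorbed.
\<close>

lemma lloyd_errors_after_log:
  assumes lloyd: "\<And>s. real (card (errors (l (Suc s)))) \<le> 3 / 2 * card (bad \<eta> \<xi>) + n / 3 ^ s"
    and n: "2 \<le> n"
  shows "card (errors (l (nat \<lceil>4 * ln n\<rceil>))) \<le> 3 * card (bad \<eta> \<xi>)"
proof -
  let ?s = "nat \<lceil>4 * ln n\<rceil>"
  let ?E = "card (errors (l ?s))" and ?b = "card (bad \<eta> \<xi>)"
  have "0 < ln (real n)" using n by simp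
  then have s: "4 * ln n \<le> ?s" "0 < ?s" by (auto simp: of_nat_ceiling)
  then obtain t where t: "?s = Suc t" by (cases ?s) auto
  have "real n ^ 4 = exp (4 * ln n)"
    using n exp_of_nat_mult[of 4 "ln (real n)"] by simp
  also have "\<dots> \<le> exp (real (Suc t) * 1)" using s t by simp
  also have "\<dots> = exp 1 ^ Suc t" by (simp only: exp_of_nat_mult)
  also have "\<dots> \<le> 3 ^ Suc t" using exp_le by (intro power_mono) auto
  finally have n4: "real n ^ 4 \<le> 3 * 3 ^ t" by simp
  have "2 ^ 3 * real n \<le> real n ^ 3 * real n" using n by (intro mult_right_mono power_mono) auto
  also have "\<dots> = real n ^ 4" by (simp add: power3_eq_cube power4_eq_xxxx)
  finally have "8 * real n \<le> 3 * 3 ^ t" using n4 by simp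
  moreover have "0 < (3::real) ^ t" by simp
  ultimately have "real n < 3 ^ t" by linarith
  then have "n / 3 ^ t < (1::real)" by (simp add: divide_less_eq)
  then have lt: "real ?E < 3 / 2 * ?b + 1" using lloyd[of t] unfolding t by linarith
  show "?E \<le> 3 * ?b"
  proof (cases "?b = 0")
    case True
    then have "real ?E < 1" using lt by simp
    then show ?thesis by simp
  next
    case False
    then have "1 \<le> ?b" by linarith
    then have "1 \<le> real ?b" by linarith
    then have "real ?E \<le> 3 * real ?b" using lt by linarith
    then show ?thesis by linarith
  qed
qed

end

section \<open>Orthogonal projections and spectral initialization\<close>

text \<open>
  A zero row turns the \<open>k\<close> equations in \<open>k + 1\<close> unknowns into a square system with determinant 0.
\<close>

lemma underdetermined_system:
  fixes a :: "nat \<Rightarrow> nat \<Rightarrow> real"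
  shows "\<exists>\<beta>. (\<exists>j\<le>k. \<beta> j \<noteq> 0) \<and> (\<forall>g<k. (\<Sum>j\<le>k. \<beta> j * a g j) = 0)"
proof -
  define A where "A = mat (Suc k) (Suc k) (\<lambda>(g, j). if g < k then a g j else 0)"
  have A: "A \<in> carrier_mat (Suc k) (Suc k)" by (simp add: A_def)
  let ?row = "\<lambda>g. vec (Suc k) (a g)"
  have "A = mat\<^sub>r (Suc k) (Suc k) (\<lambda>g. if g = k then 0\<^sub>v (Suc k) else ?row g)"
    by (rule eq_matI) (auto simp: A_def)
  moreover have "det \<dots> = 0" by (rule det_row_0) auto
  ultimately have "det A = 0" by simp
  then obtain v where v: "v \<in> carrier_vec (Suc k)" "v \<noteq> 0\<^sub>v (Suc k)" "A *\<^sub>v v = 0\<^sub>v (Suc k)"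
    using det_0_iff_vec_prod_zero_field[OF A] by blast
  show ?thesis
  proof (intro exI[of _ "\<lambda>j. v $ j"] conjI allI impI)
    show "\<exists>j\<le>k. v $ j \<noteq> 0"
    proof (rule ccontr)
      assume "\<not> ?thesis"
      then have "v = 0\<^sub>v (Suc k)" using v(1) by (intro eq_vecI) (auto simp: less_Suc_eq_le)
      with v(2) show False by simp
    qed
    fix g assume g: "g < k"
    have "(A *\<^sub>v v) $ g = (\<Sum>j\<le>k. v $ j * a g j)"
      using v(1) g by (auto simp: A_def scalar_prod_def atLeast0LessThan lessThan_Suc_atMost mult.commute intro!: sum.cong)
    then show "(\<Sum>j\<le>k. v $ j * a g j) = 0" using v(3) g by simp
  qed
qed

definition orthonormal_on :: "'i set \<Rightarrow> ('i \<Rightarrow> 'v::real_inner) \<Rightarrow> bool" where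
  "orthonormal_on J u \<longleftrightarrow> (\<forall>i\<in>J. \<forall>j\<in>J. inner (u i) (u j) = of_bool (i = j))"

lemma orthonormal_on_subset: "orthonormal_on J u \<Longrightarrow> K \<subseteq> J \<Longrightarrow> orthonormal_on K u"
  unfolding orthonormal_on_def by blast

lemma norm_orthonormal: "orthonormal_on J u \<Longrightarrow> j \<in> J \<Longrightarrow> norm (u j) = 1"
  by (simp add: orthonormal_on_def norm_eq_sqrt_inner)

lemma inner_orthonormal_sum:
  assumes "orthonormal_on J u" "finite J" "j \<in> J"
  shows "inner (u j) (\<Sum>i\<in>J. c i *\<^sub>R u i) = c j"
proof -
  have "inner (u j) (\<Sum>i\<in>J. c i *\<^sub>R u i) = (\<Sum>i\<in>J. if i = j then c i else 0)"
    unfolding inner_sum_right using assms by (intro sum.cong) (auto simp: orthonormal_on_def)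
  then show ?thesis using assms by simp
qed

lemma norm_orthonormal_sum:
  assumes "orthonormal_on J u" "finite J"
  shows "(norm (\<Sum>i\<in>J. c i *\<^sub>R u i))\<^sup>2 = (\<Sum>i\<in>J. (c i)\<^sup>2)"
proof -
  have "(norm (\<Sum>i\<in>J. c i *\<^sub>R u i))\<^sup>2 = (\<Sum>j\<in>J. c j * inner (u j) (\<Sum>i\<in>J. c i *\<^sub>R u i))"
    unfolding power2_norm_eq_inner by (subst inner_sum_left) simp
  then show ?thesis
    using assms by (simp add: inner_orthonormal_sum power2_eq_square cong: sum.cong)
qed

definition proj :: "'i set \<Rightarrow> ('i \<Rightarrow> 'v::real_inner) \<Rightarrow> 'v \<Rightarrow> 'v" where
  "proj J u x = (\<Sum>j\<in>J. inner (u j) x *\<^sub>R u j)"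

lemma proj_sum: "proj J u (sum f S) = (\<Sum>i\<in>S. proj J u (f i))"
  unfolding proj_def inner_sum_right scaleR_sum_left by (rule sum.swap)

lemma proj_add: "proj J u (x + x') = proj J u x + proj J u x'"
  by (simp add: proj_def inner_add_right scaleR_add_left sum.distrib)

lemma proj_scaleR: "proj J u (a *\<^sub>R x) = a *\<^sub>R proj J u x"
  by (simp add: proj_def scaleR_sum_right)

lemma norm_proj:
  assumes "orthonormal_on J u" "finite J"
  shows "(norm (proj J u x))\<^sup>2 = (\<Sum>j\<in>J. (inner (u j) x)\<^sup>2)"
  unfolding proj_def by (rule norm_orthonormal_sum[OF assms])

lemma pythagoras_proj:
  assumes "orthonormal_on J u" "finite J"
  shows "(norm (x - proj J u x))\<^sup>2 + (norm (proj J u x))\<^sup>2 = (norm x)\<^sup>2"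
proof -
  have "inner x (proj J u x) = (\<Sum>j\<in>J. (inner (u j) x)\<^sup>2)"
    by (simp add: proj_def inner_sum_right power2_eq_square inner_commute)
  then show ?thesis
    using norm_proj[OF assms, of x]
    by (simp add: power2_norm_eq_inner inner_diff_left inner_diff_right inner_commute)
qed

lemma bessel:
  assumes "orthonormal_on J u" "finite J"
  shows "(\<Sum>j\<in>J. (inner (u j) x)\<^sup>2) \<le> (norm x)\<^sup>2"
  using pythagoras_proj[OF assms, of x] norm_proj[OF assms, of x] zero_le_power2[of "norm (x - proj J u x)"]
  by linarith

lemma norm_proj_le:
  assumes "orthonormal_on J u" "finite J"
  shows "norm (x - proj J u x) \<le> norm x"
  by (rule power2_le_imp_le) (use pythagoras_proj[OF assms, of x] zero_le_power2[of "norm (proj J u x)"] in linarith, simp)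

text \<open>
  Coefficient vectors indexed by the data points as elements of an inner product space, so that left
  and right singular vectors are orthonormal in the same sense.
\<close>

definition row_seq :: "nat \<Rightarrow> (nat \<Rightarrow> real) \<Rightarrow> fin_seq" where
  "row_seq n a = embed (vec n a)"

lemma inner_row_seq: "inner (row_seq n a) (row_seq n b) = (\<Sum>i<n. a i * b i)"
  by (simp add: row_seq_def inner_embed scalar_prod_def atLeast0LessThan)

lemma norm_row_seq: "norm (row_seq n a) = L2_set a {..<n}"
  by (simp add: norm_eq_sqrt_inner inner_row_seq L2_set_def power2_eq_square)

lemma row_seq_sum: "row_seq n (\<lambda>i. \<Sum>j\<in>J. c j * f j i) = (\<Sum>j\<in>J. c j *\<^sub>R row_seq n (f j))"
  by (rule fin_seq_eqI) (auto simp: coord_sum scaleR_fin_seq.rep_eq row_seq_def embed.rep_eq)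

lemma norm_diff_sq_le: "(norm (a - b))\<^sup>2 \<le> 2 * (norm a)\<^sup>2 + 2 * (norm b)\<^sup>2" for a b :: "'v::real_inner"
proof -
  have "(norm (a - b))\<^sup>2 \<le> (norm a + norm b)\<^sup>2" by (intro power_mono norm_triangle_ineq4) simp
  also have "\<dots> \<le> 2 * (norm a)\<^sup>2 + 2 * (norm b)\<^sup>2"
    using sum_squares_bound[of "norm a" "norm b"] by (simp add: power2_sum)
  finally show ?thesis .
qed

text \<open>
  A singular value decomposition with \<open>r\<close> singular values, whose first \<open>q\<close> left singular vectors span the
  range of the projection.  Both \<open>q\<close> and \<open>r\<close> are minima (of \<open>k\<close> and \<open>d\<close>, and of \<open>d\<close> and \<open>n\<close>), which is why
  \<open>q\<close> need not be \<open>k\<close> and orthonormality is required for both index sets.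
\<close>

locale noisy_svd = separated_clusters +
  fixes r q :: nat and s :: "nat \<Rightarrow> real" and V :: "nat \<Rightarrow> nat \<Rightarrow> real" and u :: "nat \<Rightarrow> 'a"
  assumes decreasing: "i \<le> j \<Longrightarrow> j < r \<Longrightarrow> s j \<le> s i"
    and nonneg: "j < r \<Longrightarrow> 0 \<le> s j"
    and right_orthonormal: "orthonormal_on {..<r} (\<lambda>j. row_seq n (V j))"
    and left_orthonormal: "orthonormal_on {..<r} u" "orthonormal_on {..<q} u"
    and rank: "q \<le> k" "q < r \<Longrightarrow> q = k"
    and decomposition: "i < n \<Longrightarrow> y i = (\<Sum>j<r. (s j * V j i) *\<^sub>R u j)"
begin

lemma combination:
  "(\<Sum>i<n. a i *\<^sub>R y i) = (\<Sum>j<r. (s j * inner (row_seq n (V j)) (row_seq n a)) *\<^sub>R u j)"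
proof -
  have "(\<Sum>i<n. a i *\<^sub>R y i) = (\<Sum>i<n. \<Sum>j<r. (a i * (s j * V j i)) *\<^sub>R u j)"
    by (intro sum.cong) (auto simp: decomposition scaleR_sum_right)
  also have "\<dots> = (\<Sum>j<r. \<Sum>i<n. (a i * (s j * V j i)) *\<^sub>R u j)" by (rule sum.swap)
  also have "\<dots> = (\<Sum>j<r. (s j * inner (row_seq n (V j)) (row_seq n a)) *\<^sub>R u j)"
    by (intro sum.cong) (simp_all add: inner_row_seq scaleR_sum_left sum_distrib_left mult_ac)
  finally show ?thesis .
qed

text \<open>
  Choose a nonzero combination \<open>a\<close> of the first \<open>k + 1\<close> right singular vectors whose entries sum to 0 over
  each of the \<open>k\<close> clusters.  It annihilates the signal, so the data matrix acts on it like the noise matrix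
  and stretches it by at most \<open>B\<close>; but it stretches every such combination by at least \<open>s k\<close>.
\<close>

lemma singular_value_le:
  assumes "k < r"
  shows "s k \<le> B"
proof -
  obtain \<beta> where \<beta>: "\<exists>j\<le>k. \<beta> j \<noteq> 0" "\<And>g. g < k \<Longrightarrow> (\<Sum>j\<le>k. \<beta> j * (\<Sum>i\<in>T g. V j i)) = 0"
    using underdetermined_system[of k "\<lambda>g j. \<Sum>i\<in>T g. V j i"] by blast
  define a where "a = (\<lambda>i. \<Sum>j\<le>k. \<beta> j * V j i)"
  let ?b = "\<Sum>j\<le>k. (\<beta> j)\<^sup>2"
  have sub: "{..k} \<subseteq> {..<r}" using assms by auto
  note on = orthonormal_on_subset[OF right_orthonormal sub] orthonormal_on_subset[OF left_orthonormal(1) sub]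
  have row_a: "row_seq n a = (\<Sum>j\<in>{..k}. \<beta> j *\<^sub>R row_seq n (V j))"
    unfolding a_def by (rule row_seq_sum)
  have a_sq: "(norm (row_seq n a))\<^sup>2 = ?b"
    unfolding row_a by (rule norm_orthonormal_sum[OF on(1)]) simp
  have coeff: "inner (row_seq n (V j)) (row_seq n a) = (if j \<le> k then \<beta> j else 0)" if "j < r" for j
  proof (cases "j \<le> k")
    case True
    then show ?thesis unfolding row_a using inner_orthonormal_sum[OF on(1)] by simp
  next
    case False
    then have "inner (row_seq n (V j)) (row_seq n (V i)) = 0" if "i \<le> k" for i
      using right_orthonormal \<open>j < r\<close> assms that by (auto simp: orthonormal_on_def)
    then show ?thesis using False unfolding row_a by (simp add: inner_sum_right)
  qed
  have "(\<Sum>i<n. a i *\<^sub>R y i) = (\<Sum>j<r. (if j \<le> k then (s j * \<beta> j) *\<^sub>R u j else 0))"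
    unfolding combination by (intro sum.cong) (auto simp: coeff)
  also have "\<dots> = (\<Sum>j\<in>{..k}. (s j * \<beta> j) *\<^sub>R u j)"
    using sub by (intro sum.mono_neutral_cong_right) auto
  finally have "(norm (\<Sum>i<n. a i *\<^sub>R y i))\<^sup>2 = (\<Sum>j\<le>k. (s j * \<beta> j)\<^sup>2)"
    by (simp add: norm_orthonormal_sum[OF on(2)])
  moreover have "(\<Sum>j\<le>k. (s k)\<^sup>2 * (\<beta> j)\<^sup>2) \<le> (\<Sum>j\<le>k. (s j * \<beta> j)\<^sup>2)"
    unfolding power_mult_distrib using assms decreasing nonneg
    by (intro sum_mono mult_right_mono power_mono) auto
  ultimately have lower: "(s k)\<^sup>2 * ?b \<le> (norm (\<Sum>i<n. a i *\<^sub>R y i))\<^sup>2"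
    by (simp add: sum_distrib_left)
  have "(\<Sum>i<n. a i *\<^sub>R \<theta> (z i)) = (\<Sum>g<k. \<Sum>i\<in>T g. a i *\<^sub>R \<theta> (z i))"
  proof -
    have "{..<n} = (\<Union>g<k. T g)" using label by (auto simp: T_def)
    then show ?thesis by (simp add: sum.UNION_disjoint T_def disjoint_iff)
  qed
  also have "\<dots> = (\<Sum>g<k. (\<Sum>i\<in>T g. a i) *\<^sub>R \<theta> g)"
    unfolding scaleR_sum_left by (intro sum.cong) (auto simp: T_def)
  also have "\<dots> = 0"
  proof (rule sum.neutral, intro ballI)
    fix g assume "g \<in> {..<k}"
    moreover have "(\<Sum>i\<in>T g. a i) = (\<Sum>j\<le>k. \<beta> j * (\<Sum>i\<in>T g. V j i))"
      unfolding a_def sum_distrib_left by (rule sum.swap)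
    ultimately show "(\<Sum>i\<in>T g. a i) *\<^sub>R \<theta> g = 0" using \<beta>(2) by simp
  qed
  finally have "(\<Sum>i<n. a i *\<^sub>R y i) = (\<Sum>i<n. a i *\<^sub>R w i)"
    by (simp add: y_def scaleR_add_right sum.distrib)
  then have "norm (\<Sum>i<n. a i *\<^sub>R y i) \<le> B * norm (row_seq n a)"
    using operator_boundD[OF noise] by (simp add: norm_row_seq)
  then have "(norm (\<Sum>i<n. a i *\<^sub>R y i))\<^sup>2 \<le> (B * norm (row_seq n a))\<^sup>2"
    by (intro power_mono) auto
  with lower have "(s k)\<^sup>2 * ?b \<le> B\<^sup>2 * ?b" by (simp add: power_mult_distrib a_sq)
  moreover have "0 < ?b"
  proof -
    obtain j where "j \<le> k" "\<beta> j \<noteq> 0" using \<beta>(1) by blast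
    then show ?thesis by (intro sum_pos2[of _ j]) auto
  qed
  ultimately have "(s k)\<^sup>2 \<le> B\<^sup>2" by simp
  then show ?thesis using B_nonneg by (rule power2_le_imp_le)
qed

abbreviation P :: "'a \<Rightarrow> 'a" where "P \<equiv> proj {..<q} u"

text \<open>
  The residual of the projection is the part of the decomposition that belongs to the indices
  \<open>k, \<dots>, r - 1\<close>, all of which have singular values at most \<open>B\<close>.
\<close>

lemma residual_operator_bound: "operator_bound n B (\<lambda>i. y i - P (y i))"
  unfolding operator_bound_def
proof
  fix a :: "nat \<Rightarrow> real"
  let ?c = "\<lambda>j. s j * inner (row_seq n (V j)) (row_seq n a)"
  let ?x = "\<Sum>i<n. a i *\<^sub>R y i"
  have "(\<Sum>i<n. a i *\<^sub>R (y i - P (y i))) = ?x - P ?x"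
    by (simp add: proj_sum proj_scaleR scaleR_diff_right sum_subtractf)
  also have "P ?x = (\<Sum>j<min q r. ?c j *\<^sub>R u j)"
  proof -
    have "inner (u i) ?x = (if i < r then ?c i else 0)" if "i < q" for i
    proof (cases "i < r")
      case True
      then show ?thesis unfolding combination using inner_orthonormal_sum[OF left_orthonormal(1)] by simp
    next
      case False
      then have "inner (u i) (u j) = 0" if "j < r" for j
        using left_orthonormal(2) \<open>i < q\<close> that by (auto simp: orthonormal_on_def)
      then show ?thesis using False unfolding combination by (simp add: inner_sum_right)
    qed
    then have "P ?x = (\<Sum>i<q. (if i < r then ?c i *\<^sub>R u i else 0))"
      unfolding proj_def by (intro sum.cong) auto
    also have "\<dots> = (\<Sum>i<min q r. ?c i *\<^sub>R u i)"
      by (intro sum.mono_neutral_cong_right) auto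
    finally show ?thesis .
  qed
  also have "?x - (\<Sum>j<min q r. ?c j *\<^sub>R u j) = (\<Sum>j\<in>{q..<r}. ?c j *\<^sub>R u j)"
  proof -
    have eq: "{..<r} = {..<min q r} \<union> {q..<r}" by auto
    have "(\<Sum>j<r. ?c j *\<^sub>R u j) = (\<Sum>j<min q r. ?c j *\<^sub>R u j) + (\<Sum>j\<in>{q..<r}. ?c j *\<^sub>R u j)"
      unfolding eq by (rule sum.union_disjoint) auto
    then show ?thesis unfolding combination by simp
  qed
  finally have "(norm (\<Sum>i<n. a i *\<^sub>R (y i - P (y i))))\<^sup>2 = (\<Sum>j\<in>{q..<r}. (?c j)\<^sup>2)"
    by (simp only:) (rule norm_orthonormal_sum[OF orthonormal_on_subset[OF left_orthonormal(1)]]; auto)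
  also have "\<dots> \<le> (\<Sum>j\<in>{q..<r}. B\<^sup>2 * (inner (row_seq n (V j)) (row_seq n a))\<^sup>2)"
    unfolding power_mult_distrib
  proof (intro sum_mono mult_right_mono power_mono)
    fix j assume j: "j \<in> {q..<r}"
    then have "q = k" "k < r" using rank(2) by auto
    then show "s j \<le> B" using singular_value_le decreasing[of k j] j by auto
  qed (use nonneg in auto)
  also have "\<dots> \<le> B\<^sup>2 * (norm (row_seq n a))\<^sup>2"
    unfolding sum_distrib_left[symmetric]
    by (intro mult_left_mono bessel orthonormal_on_subset[OF right_orthonormal]) auto
  also have "\<dots> = (B * L2_set a {..<n})\<^sup>2" by (simp add: norm_row_seq power_mult_distrib)
  finally show "norm (\<Sum>i<n. a i *\<^sub>R (y i - P (y i))) \<le> B * L2_set a {..<n}"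
    by (rule power2_le_imp_le) (simp add: B_nonneg)
qed

text \<open>
  A matrix of rank \<open>k\<close> has squared Frobenius norm at most \<open>k\<close> times its squared operator norm.
\<close>

lemma projected_noise: "(\<Sum>i<n. (norm (P (w i)))\<^sup>2) \<le> k * B\<^sup>2"
proof -
  have "(\<Sum>i<n. (norm (P (w i)))\<^sup>2) = (\<Sum>j<q. \<Sum>i<n. (inner (w i) (u j))\<^sup>2)"
    using norm_proj[OF left_orthonormal(2)] by (simp add: sum.swap[of _ "{..<q}"] inner_commute)
  also have "\<dots> \<le> (\<Sum>j<q. B\<^sup>2)"
    using operator_bound_inner[OF noise] norm_orthonormal[OF left_orthonormal(2)]
    by (intro sum_mono) (metis mult.right_neutral one_power2)
  also have "\<dots> \<le> k * B\<^sup>2" using rank(1) by (simp add: mult_right_mono)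
  finally show ?thesis .
qed

text \<open>
  Summed over its cluster, the signal is the difference of data and noise.  The residual of the data is
  small because the projection is adapted to the data, that of the noise because projections contract.
\<close>

lemma projected_center:
  assumes g: "g < k"
  shows "card (T g) * (norm (\<theta> g - P (\<theta> g)))\<^sup>2 \<le> 4 * B\<^sup>2"
proof -
  let ?N = "real (card (T g))" and ?x = "\<theta> g - P (\<theta> g)"
  have "?N *\<^sub>R ?x = (\<Sum>i\<in>T g. (y i - P (y i)) - (w i - P (w i)))"
    unfolding sum_constant_scaleR[symmetric]
    by (intro sum.cong) (auto simp: y_def T_def proj_add)
  also have "\<dots> = (\<Sum>i\<in>T g. y i - P (y i)) - (sum w (T g) - P (sum w (T g)))"
    by (simp add: sum_subtractf proj_sum)
  finally have "?N * norm ?x = norm ((\<Sum>i\<in>T g. y i - P (y i)) - (sum w (T g) - P (sum w (T g))))"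
    by (metis abs_of_nat norm_scaleR)
  also have "\<dots> \<le> norm (\<Sum>i\<in>T g. y i - P (y i)) + norm (sum w (T g) - P (sum w (T g)))"
    by (rule norm_triangle_ineq4)
  also have "\<dots> \<le> B * sqrt ?N + B * sqrt ?N"
    using operator_bound_subset[OF residual_operator_bound T_subset, of g]
      operator_bound_subset[OF noise T_subset, of g]
      norm_proj_le[OF left_orthonormal(2), of "sum w (T g)"] by simp
  finally have "(?N * norm ?x)\<^sup>2 \<le> (2 * B * sqrt ?N)\<^sup>2" by (intro power_mono) auto
  then have "?N * (?N * (norm ?x)\<^sup>2) \<le> ?N * (4 * B\<^sup>2)"
    by (simp add: power_mult_distrib power2_eq_square mult_ac)
  then show ?thesis using card_T_pos[OF g] by (simp del: of_nat_0_less_iff)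
qed

lemma sum_clusters: "(\<Sum>i<n. f (z i)) = (\<Sum>g<k. card (T g) * f g)" for f :: "nat \<Rightarrow> real"
proof -
  have "{..<n} = (\<Union>g<k. T g)" using label by (auto simp: T_def)
  then have "(\<Sum>i<n. f (z i)) = (\<Sum>g<k. \<Sum>i\<in>T g. f (z i))"
    by (simp add: sum.UNION_disjoint T_def disjoint_iff)
  also have "\<dots> = (\<Sum>g<k. card (T g) * f g)"
    by (intro sum.cong) (auto simp: T_def)
  finally show ?thesis .
qed

lemma denoising: "(\<Sum>i<n. (norm (P (y i) - \<theta> (z i)))\<^sup>2) \<le> 10 * k * B\<^sup>2"
proof -
  have "(\<Sum>i<n. (norm (P (y i) - \<theta> (z i)))\<^sup>2) \<le>
      (\<Sum>i<n. 2 * (norm (P (w i)))\<^sup>2 + 2 * (norm (\<theta> (z i) - P (\<theta> (z i))))\<^sup>2)"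
  proof (rule sum_mono)
    fix i
    have "P (y i) - \<theta> (z i) = P (w i) - (\<theta> (z i) - P (\<theta> (z i)))" by (simp add: y_def proj_add)
    then show "(norm (P (y i) - \<theta> (z i)))\<^sup>2 \<le> 2 * (norm (P (w i)))\<^sup>2 + 2 * (norm (\<theta> (z i) - P (\<theta> (z i))))\<^sup>2"
      by (simp only: norm_diff_sq_le)
  qed
  also have "\<dots> = 2 * (\<Sum>i<n. (norm (P (w i)))\<^sup>2) + 2 * (\<Sum>i<n. (norm (\<theta> (z i) - P (\<theta> (z i))))\<^sup>2)"
    by (simp add: sum.distrib sum_distrib_left)
  also have "(\<Sum>i<n. (norm (\<theta> (z i) - P (\<theta> (z i))))\<^sup>2) = (\<Sum>g<k. card (T g) * (norm (\<theta> g - P (\<theta> g)))\<^sup>2)"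
    by (rule sum_clusters)
  also have "\<dots> \<le> (\<Sum>g<k. 4 * B\<^sup>2)" by (intro sum_mono projected_center) simp
  finally show ?thesis using projected_noise by simp
qed

text \<open>
  The true centers are one candidate for the k-means problem, so the total squared distance of the true
  centers, counted once for each data point, from the returned centers is of order \<open>k * B\<^sup>2\<close>.  Every
  cluster has at least \<open>m\<close> points, hence its own share is at most \<open>(K * \<rho> * \<Delta>)\<^sup>2 * m\<close>.  As \<open>K * \<rho> < 1 / 2\<close>,
  one returned center cannot serve two clusters, and the correspondence is a permutation.
\<close>

lemma spectral_centers_close:
  assumes C: "0 \<le> C"
    and approx: "(\<Sum>i<n. MIN h\<in>{..<k}. (norm (P (y i) - \<mu> h))\<^sup>2) \<le>
      C * (\<Sum>i<n. MIN h\<in>{..<k}. (norm (P (y i) - \<theta> h))\<^sup>2)"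
    and K: "20 * (1 + C) \<le> K\<^sup>2" "0 \<le> K" "K * \<rho> < 1 / 2"
  obtains \<pi> where "\<pi> permutes {..<k}" "\<And>h. h < k \<Longrightarrow> norm (\<mu> (\<pi> h) - \<theta> h) \<le> K * \<rho> * \<Delta>"
proof -
  let ?F = "\<Sum>i<n. (norm (P (y i) - \<theta> (z i)))\<^sup>2"
  let ?d = "\<lambda>g. MIN h\<in>{..<k}. (norm (\<mu> h - \<theta> g))\<^sup>2"
  have ne: "{..<k} \<noteq> {}" using k_pos by blast
  have "(\<Sum>i<n. MIN h\<in>{..<k}. (norm (P (y i) - \<theta> h))\<^sup>2) \<le> ?F"
    using label by (intro sum_mono Min_le) auto
  then have cost: "(\<Sum>i<n. MIN h\<in>{..<k}. (norm (P (y i) - \<mu> h))\<^sup>2) \<le> C * ?F"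
    using approx C by (meson mult_left_mono order_trans)
  have "(\<Sum>i<n. ?d (z i)) \<le> (\<Sum>i<n. 2 * (norm (P (y i) - \<theta> (z i)))\<^sup>2 + 2 * (MIN h\<in>{..<k}. (norm (P (y i) - \<mu> h))\<^sup>2))"
  proof (rule sum_mono)
    fix i
    have "(MIN h\<in>{..<k}. (norm (P (y i) - \<mu> h))\<^sup>2) \<in> (\<lambda>h. (norm (P (y i) - \<mu> h))\<^sup>2) ` {..<k}"
      using ne by (intro Min_in) auto
    then obtain h where h: "h < k" "(MIN h\<in>{..<k}. (norm (P (y i) - \<mu> h))\<^sup>2) = (norm (P (y i) - \<mu> h))\<^sup>2" by auto
    have "?d (z i) \<le> (norm (\<mu> h - \<theta> (z i)))\<^sup>2" using h(1) by (intro Min_le) auto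
    also have "\<dots> = (norm ((P (y i) - \<theta> (z i)) - (P (y i) - \<mu> h)))\<^sup>2" by simp
    also have "\<dots> \<le> 2 * (norm (P (y i) - \<theta> (z i)))\<^sup>2 + 2 * (norm (P (y i) - \<mu> h))\<^sup>2"
      by (rule norm_diff_sq_le)
    finally show "?d (z i) \<le> 2 * (norm (P (y i) - \<theta> (z i)))\<^sup>2 + 2 * (MIN h\<in>{..<k}. (norm (P (y i) - \<mu> h))\<^sup>2)"
      unfolding h(2) .
  qed
  also have "\<dots> = 2 * ?F + 2 * (\<Sum>i<n. MIN h\<in>{..<k}. (norm (P (y i) - \<mu> h))\<^sup>2)"
    by (simp add: sum.distrib sum_distrib_left)
  also have "\<dots> \<le> 2 * (1 + C) * ?F" using cost by (simp add: algebra_simps)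
  also have "\<dots> \<le> 2 * (1 + C) * (10 * k * B\<^sup>2)"
    using C denoising by (intro mult_left_mono) auto
  finally have total: "(\<Sum>g<k. card (T g) * ?d g) \<le> 20 * (1 + C) * (k * B\<^sup>2)"
    using sum_clusters[of ?d] by (simp add: algebra_simps)
  have d_nonneg: "0 \<le> ?d g" for g using ne by (subst Min_ge_iff) auto
  have close: "\<exists>h<k. norm (\<mu> h - \<theta> g) \<le> K * \<rho> * \<Delta>" if g: "g < k" for g
  proof -
    have "m * ?d g \<le> card (T g) * ?d g" using m_le_card[OF g] d_nonneg by (intro mult_right_mono)
    also have "\<dots> \<le> (\<Sum>g<k. card (T g) * ?d g)"
      using g d_nonneg by (intro member_le_sum) auto
    also note total
    also have "20 * (1 + C) * (k * B\<^sup>2) \<le> K\<^sup>2 * (\<rho>\<^sup>2 * m * \<Delta>\<^sup>2)"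
      using K C by (intro mult_mono noise_level) auto
    finally have "m * ?d g \<le> m * (K * \<rho> * \<Delta>)\<^sup>2" by (simp add: power_mult_distrib mult_ac)
    then have d: "?d g \<le> (K * \<rho> * \<Delta>)\<^sup>2" using m_pos by simp
    have "?d g \<in> (\<lambda>h. (norm (\<mu> h - \<theta> g))\<^sup>2) ` {..<k}" using ne by (intro Min_in) auto
    then obtain h where "h < k" "?d g = (norm (\<mu> h - \<theta> g))\<^sup>2" by auto
    moreover from this have "norm (\<mu> h - \<theta> g) \<le> K * \<rho> * \<Delta>"
      using d K \<rho>_pos \<Delta>_pos by (intro power2_le_imp_le[of "norm (\<mu> h - \<theta> g)"]) auto
    ultimately show ?thesis by blast
  qed
  then obtain j where j: "\<And>g. g < k \<Longrightarrow> j g < k \<and> norm (\<mu> (j g) - \<theta> g) \<le> K * \<rho> * \<Delta>" by metis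
  define \<pi> where "\<pi> = (\<lambda>g. if g < k then j g else g)"
  have "inj_on \<pi> {..<k}"
  proof (rule inj_onI, rule ccontr)
    fix g h assume gh: "g \<in> {..<k}" "h \<in> {..<k}" "\<pi> g = \<pi> h" "g \<noteq> h"
    then have eq: "j g = j h" by (simp add: \<pi>_def)
    have "norm (\<theta> g - \<theta> h) \<le> norm (\<mu> (j h) - \<theta> h) + norm (\<mu> (j g) - \<theta> g)"
      using norm_triangle_ineq4[of "\<mu> (j h) - \<theta> h" "\<mu> (j g) - \<theta> g"] eq by simp
    also have "\<dots> \<le> K * \<rho> * \<Delta> + K * \<rho> * \<Delta>"
      using j[of g] j[of h] gh by (intro add_mono) auto
    also have "\<dots> = 2 * (K * \<rho>) * \<Delta>" by simp
    also have "\<dots> < 1 * \<Delta>" using K \<Delta>_pos by (intro mult_strict_right_mono) auto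
    finally show False using separated[of g h] gh by auto
  qed
  moreover have "\<pi> ` {..<k} \<subseteq> {..<k}" using j by (auto simp: \<pi>_def)
  ultimately have "bij_betw \<pi> {..<k} {..<k}" by (simp add: bij_betw_def endo_inj_surj)
  then have "\<pi> permutes {..<k}" by (rule bij_imp_permutes) (simp add: \<pi>_def)
  moreover have "norm (\<mu> (\<pi> h) - \<theta> h) \<le> K * \<rho> * \<Delta>" if "h < k" for h
    using j that by (simp add: \<pi>_def)
  ultimately show thesis by (rule that)
qed

end

section \<open>A lattice net\<close>

lemma sum_half_power_int: "(\<Sum>q\<in>{- int m..int m}. (1 / 2 :: real) ^ nat \<bar>q\<bar>) = 3 - 2 * (1 / 2) ^ m"
proof (induction m)
  case (Suc m)
  have "{- int (Suc m)..int (Suc m)} = insert (- int (Suc m)) (insert (int (Suc m)) {- int m..int m})"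
    by auto
  moreover have "nat (int m + 1) = Suc m" "nat (1 + int m) = Suc m" by simp_all
  ultimately show ?case using Suc by simp
qed simp

lemma abs_le_square_int: "\<bar>q\<bar> \<le> q\<^sup>2" for q :: int
  by (cases "q = 0") (use self_le_power[of "\<bar>q\<bar>" 2] in auto)

lemma sum_gaussian_int_le: "(\<Sum>q\<in>{- int m..int m}. exp (- (real_of_int q)\<^sup>2)) \<le> exp 2"
proof -
  have "exp (- (real_of_int q)\<^sup>2) \<le> (1 / 2) ^ nat \<bar>q\<bar>" for q
  proof -
    have "exp (- (real_of_int q)\<^sup>2) \<le> exp (real (nat \<bar>q\<bar>) * - 1)"
      using abs_le_square_int[of q] by (simp flip: of_int_power of_int_abs)
    also have "\<dots> = exp (- 1) ^ nat \<bar>q\<bar>" by (simp only: exp_of_nat_mult)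
    also have "\<dots> \<le> (1 / 2) ^ nat \<bar>q\<bar>"
      using exp_ge_add_one_self[of 1] by (intro power_mono) (simp_all add: exp_minus field_simps)
    finally show ?thesis .
  qed
  then have "(\<Sum>q\<in>{- int m..int m}. exp (- (real_of_int q)\<^sup>2)) \<le> (\<Sum>q\<in>{- int m..int m}. (1 / 2) ^ nat \<bar>q\<bar>)"
    by (intro sum_mono)
  also have "\<dots> \<le> 3" unfolding sum_half_power_int by simp
  also have "\<dots> \<le> exp 2" using exp_ge_add_one_self[of 2] by simp
  finally show ?thesis .
qed

text \<open>
  The box excludes no lattice point of the ball; it makes the set visibly finite.
\<close>

definition int_ball :: "nat \<Rightarrow> (nat \<Rightarrow> int) set" where
  "int_ball N = {f \<in> PiE {..<N} (\<lambda>_. {- int (4 * N)..int (4 * N)}). (\<Sum>i<N. (f i)\<^sup>2) \<le> 4 * int N}"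

text \<open>
  Lattice points of mesh \<open>1 / sqrt N\<close> in the ball of radius 2.
\<close>

definition lattice_net :: "nat \<Rightarrow> (nat \<Rightarrow> real) set" where
  "lattice_net N = (\<lambda>f i. real_of_int (f i) / sqrt N) ` int_ball N"

lemma finite_int_ball [simp]: "finite (int_ball N)"
  unfolding int_ball_def by (intro finite_Collect_conjI disjI1) (simp add: finite_PiE)

lemma finite_net [simp]: "finite (lattice_net N)"
  by (simp add: lattice_net_def)

text \<open>
  Counting with exponential weights: every point of the ball has weight at least 1 under
  \<open>exp (4 * N - (\<Sum>i<N. (f i)\<^sup>2))\<close>, and the sum of the weights over the box factorizes into one-dimensional sums.
\<close>

lemma card_net: "real (card (lattice_net N)) \<le> exp (6 * real N)"
proof -
  let ?box = "PiE {..<N} (\<lambda>_. {- int (4 * N)..int (4 * N)})"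
  have "real (card (lattice_net N)) \<le> real (card (int_ball N))"
    by (simp add: lattice_net_def card_image_le)
  also have "\<dots> = (\<Sum>f\<in>int_ball N. 1)" by simp
  also have "\<dots> \<le> (\<Sum>f\<in>int_ball N. exp (4 * real N) * (\<Prod>i<N. exp (- (real_of_int (f i))\<^sup>2)))"
  proof (rule sum_mono)
    fix f assume "f \<in> int_ball N"
    then have "real_of_int (\<Sum>i<N. (f i)\<^sup>2) \<le> real_of_int (4 * int N)"
      unfolding int_ball_def by (subst of_int_le_iff) simp
    then have "1 \<le> exp (4 * real N - (\<Sum>i<N. (real_of_int (f i))\<^sup>2))" by simp
    also have "\<dots> = exp (4 * real N) * (\<Prod>i<N. exp (- (real_of_int (f i))\<^sup>2))"
      by (simp add: exp_sum[symmetric] sum_negf flip: exp_add)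
    finally show "1 \<le> exp (4 * real N) * (\<Prod>i<N. exp (- (real_of_int (f i))\<^sup>2))" .
  qed
  also have "\<dots> \<le> (\<Sum>f\<in>?box. exp (4 * real N) * (\<Prod>i<N. exp (- (real_of_int (f i))\<^sup>2)))"
  proof (rule sum_mono2)
    show "finite ?box" by (intro finite_PiE) simp_all
    show "int_ball N \<subseteq> ?box" unfolding int_ball_def by blast
    show "0 \<le> exp (4 * real N) * (\<Prod>i<N. exp (- (real_of_int (f i))\<^sup>2))" for f
      by (intro mult_nonneg_nonneg prod_nonneg ballI exp_ge_zero)
  qed
  also have "\<dots> = exp (4 * real N) * (\<Prod>i<N. \<Sum>q\<in>{- int (4 * N)..int (4 * N)}. exp (- (real_of_int q)\<^sup>2))"
    by (simp only: prod_sum_PiE[OF finite_lessThan finite_atLeastAtMost_int] sum_distrib_left)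
  also have "\<dots> \<le> exp (4 * real N) * (\<Prod>i<N. exp 2)"
    by (intro mult_left_mono prod_mono conjI sum_gaussian_int_le sum_nonneg exp_ge_zero)
  also have "\<dots> = exp (6 * real N)"
  proof -
    have "exp 2 ^ N = exp (real N * 2)" by (rule exp_of_nat_mult[symmetric])
    then have "exp (4 * real N) * exp 2 ^ N = exp (4 * real N + real N * 2)" by (simp only: exp_add)
    then show ?thesis by simp
  qed
  finally show ?thesis .
qed

lemma net_sum_sq:
  assumes "a \<in> lattice_net N"
  shows "(\<Sum>i<N. (a i)\<^sup>2) \<le> 4"
proof -
  obtain f where f: "f \<in> int_ball N" "a = (\<lambda>i. real_of_int (f i) / sqrt N)"
    using assms by (auto simp: lattice_net_def)
  have "real_of_int (\<Sum>i<N. (f i)\<^sup>2) \<le> real_of_int (4 * int N)"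
    using f(1) unfolding int_ball_def by (subst of_int_le_iff) simp
  then have "(\<Sum>i<N. (real_of_int (f i))\<^sup>2) / real N \<le> 4 * real N / real N"
    by (intro divide_right_mono) simp_all
  also have "\<dots> \<le> 4" by simp
  finally show ?thesis by (simp add: f(2) power_divide sum_divide_distrib)
qed

text \<open>
  Round each coordinate of \<open>sqrt N * v / norm v\<close> to an integer away from 0.  This cannot decrease the inner
  product with \<open>v\<close>, and it keeps the point in the ball because \<open>(\<bar>x\<bar> + 1)\<^sup>2 \<le> 2 * x\<^sup>2 + 2\<close>.  So the net recovers
  Euclidean norms without an approximation factor.
\<close>

lemma net_dual:
  obtains a where "a \<in> lattice_net N" "L2_set v {..<N} \<le> (\<Sum>i<N. a i * v i)"
proof (cases "L2_set v {..<N} = 0")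
  case True
  have "(\<lambda>i\<in>{..<N}. 0) \<in> int_ball N" by (auto simp: int_ball_def)
  then have "(\<lambda>i. real_of_int ((\<lambda>i\<in>{..<N}. 0) i) / sqrt N) \<in> lattice_net N" unfolding lattice_net_def by (rule imageI)
  then show thesis by (rule that) (simp add: True)
next
  case False
  let ?L = "L2_set v {..<N}"
  have L: "0 < ?L" using False by (simp add: L2_set_nonneg order_less_le)
  then have N: "0 < N" by (cases N) (auto simp: L2_set_def)
  have L2: "?L\<^sup>2 = (\<Sum>i<N. (v i)\<^sup>2)" by (simp add: L2_set_def sum_nonneg)
  define x where "x = (\<lambda>i. sqrt N * v i / ?L)"
  define f where "f = (\<lambda>i\<in>{..<N}. if 0 \<le> v i then \<lceil>x i\<rceil> else \<lfloor>x i\<rfloor>)"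
  have x2: "(\<Sum>i<N. (x i)\<^sup>2) = N"
  proof -
    have "(\<Sum>i<N. (x i)\<^sup>2) = (\<Sum>i<N. N / ?L\<^sup>2 * (v i)\<^sup>2)"
      by (intro sum.cong) (simp_all add: x_def power_divide power_mult_distrib)
    also have "\<dots> = N / ?L\<^sup>2 * ?L\<^sup>2" by (simp only: L2 sum_distrib_left)
    finally show ?thesis using L by simp
  qed
  have f_sq: "(real_of_int (f i))\<^sup>2 \<le> 2 * (x i)\<^sup>2 + 2" if "i < N" for i
  proof -
    have "\<bar>real_of_int (f i) - x i\<bar> \<le> 1"
    proof -
      have "\<bar>real_of_int \<lceil>x i\<rceil> - x i\<bar> \<le> 1" "\<bar>real_of_int \<lfloor>x i\<rfloor> - x i\<bar> \<le> 1" by linarith+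
      then show ?thesis using that by (simp add: f_def)
    qed
    then have "(real_of_int (f i) - x i)\<^sup>2 \<le> 1" by (simp add: abs_square_le_1)
    moreover have "0 \<le> (real_of_int (f i) - 2 * x i)\<^sup>2" by simp
    moreover have "(real_of_int (f i))\<^sup>2 = 2 * (real_of_int (f i) - x i)\<^sup>2 + 2 * (x i)\<^sup>2 - (real_of_int (f i) - 2 * x i)\<^sup>2"
      by (simp add: power2_eq_square algebra_simps)
    ultimately show ?thesis by linarith
  qed
  have "real_of_int (\<Sum>i<N. (f i)\<^sup>2) \<le> (\<Sum>i<N. 2 * (x i)\<^sup>2 + 2)"
    unfolding of_int_sum using f_sq by (intro sum_mono) simp
  also have "\<dots> = real_of_int (4 * int N)" by (simp add: sum.distrib x2 flip: sum_distrib_left)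
  finally have sum_sq: "(\<Sum>i<N. (f i)\<^sup>2) \<le> 4 * int N" by (simp only: of_int_le_iff)
  have "\<bar>f i\<bar> \<le> 4 * int N" if "i < N" for i
  proof -
    have "\<bar>f i\<bar> \<le> (f i)\<^sup>2"
      by (rule abs_le_square_int)
    also have "\<dots> \<le> (\<Sum>i<N. (f i)\<^sup>2)" using that by (intro member_le_sum) auto
    finally show ?thesis using sum_sq by linarith
  qed
  then have "f i \<in> {- int (4 * N)..int (4 * N)}" if "i < N" for i
    using that by (simp add: abs_le_iff minus_le_iff)
  then have "f \<in> PiE {..<N} (\<lambda>_. {- int (4 * N)..int (4 * N)})"
    by (intro PiE_I) (simp_all add: f_def)
  then have "f \<in> int_ball N" using sum_sq by (simp add: int_ball_def)
  then have "(\<lambda>i. real_of_int (f i) / sqrt N) \<in> lattice_net N" unfolding lattice_net_def by (rule imageI)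
  moreover have "?L \<le> (\<Sum>i<N. real_of_int (f i) / sqrt N * v i)"
  proof -
    have "?L = ?L\<^sup>2 / ?L" using L by (simp add: power2_eq_square)
    also have "\<dots> = (\<Sum>i<N. (v i)\<^sup>2) / ?L" by (simp only: L2)
    also have "\<dots> = (\<Sum>i<N. x i / sqrt N * v i)"
      using N by (simp add: x_def sum_divide_distrib power2_eq_square)
    also have "\<dots> \<le> (\<Sum>i<N. real_of_int (f i) / sqrt N * v i)"
    proof (rule sum_mono)
      fix i assume "i \<in> {..<N}"
      then have "x i * v i \<le> real_of_int (f i) * v i"
        using mult_right_mono[of "x i" "real_of_int \<lceil>x i\<rceil>" "v i"]
          mult_right_mono_neg[of "real_of_int \<lfloor>x i\<rfloor>" "x i" "v i"]
        by (cases "0 \<le> v i") (simp_all add: f_def)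
      then show "x i / sqrt N * v i \<le> real_of_int (f i) / sqrt N * v i"
        using N by (simp add: divide_right_mono)
    qed
    finally show ?thesis .
  qed
  ultimately show thesis by (rule that)
qed

section \<open>Sub-Gaussian concentration\<close>

lemma prod_mono_ennreal:
  fixes f g :: "'i \<Rightarrow> ennreal"
  assumes "\<And>i. i \<in> I \<Longrightarrow> f i \<le> g i"
  shows "prod f I \<le> prod g I"
  using assms by (induction I rule: infinite_finite_induct) (auto intro: mult_mono)

context sub_gaussian_mixture
begin

lemma measurable_noise [measurable (raw)]: "i < n \<Longrightarrow> j < d \<Longrightarrow> (\<lambda>\<omega>. w i \<omega> $ j) \<in> borel_measurable M"
  using noise_integrable by (rule borel_measurable_integrable)

lemma mgf_single:
  assumes i: "i < n"
  shows "(\<integral>\<^sup>+\<omega>. ennreal (exp (\<Sum>j<d. b j * w i \<omega> $ j)) \<partial>M) \<le> ennreal (exp (\<sigma>\<^sup>2 * (\<Sum>j<d. (b j)\<^sup>2) / 2))"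
proof -
  have eq: "(\<Sum>j<d. b j * w i \<omega> $ j) = vec d b \<bullet> w i \<omega>" if "\<omega> \<in> space M" for \<omega>
    using noise_carrier[OF i that] by (simp add: scalar_prod_def atLeast0LessThan)
  have "(\<integral>\<^sup>+\<omega>. ennreal (exp (\<Sum>j<d. b j * w i \<omega> $ j)) \<partial>M) = (\<integral>\<^sup>+\<omega>. ennreal (exp (vec d b \<bullet> w i \<omega>)) \<partial>M)"
    by (intro nn_integral_cong) (simp add: eq)
  also have "\<dots> = ennreal (expectation (\<lambda>\<omega>. exp (vec d b \<bullet> w i \<omega>)))"
    by (intro nn_integral_eq_integral mgf_integrable i) auto
  also have "\<dots> \<le> ennreal (exp (\<sigma>\<^sup>2 * (enorm (vec d b))\<^sup>2 / 2))"
    by (intro ennreal_leI mgf_bound i) auto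
  also have "(enorm (vec d b))\<^sup>2 = (\<Sum>j<d. (b j)\<^sup>2)"
    by (simp add: enorm_def scalar_prod_def atLeast0LessThan sum_nonneg power2_eq_square)
  finally show ?thesis .
qed

lemma mgf_combination:
  "(\<integral>\<^sup>+\<omega>. ennreal (exp (\<Sum>i<n. \<Sum>j<d. b i j * w i \<omega> $ j)) \<partial>M) \<le>
    ennreal (exp (\<sigma>\<^sup>2 * (\<Sum>i<n. \<Sum>j<d. (b i j)\<^sup>2) / 2))"
proof -
  let ?X = "\<lambda>i \<omega>. ennreal (exp (\<Sum>j<d. b i j * w i \<omega> $ j))"
  have "indep_vars (\<lambda>_. borel) (\<lambda>i \<omega>. ennreal (exp (\<Sum>j<d. b i j * (\<lambda>j\<in>{..<d}. w i \<omega> $ j) j))) {..<n}"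
    by (rule indep_vars_compose2[OF noise_indep, where Y = "\<lambda>i f. ennreal (exp (\<Sum>j<d. b i j * f j))"]) measurable
  moreover have "(\<Sum>j<d. b i j * (\<lambda>j\<in>{..<d}. w i \<omega> $ j) j) = (\<Sum>j<d. b i j * w i \<omega> $ j)" for i \<omega>
    by (intro sum.cong) auto
  ultimately have ind: "indep_vars (\<lambda>_. borel) ?X {..<n}"
    by (simp only:)
  have "(\<integral>\<^sup>+\<omega>. ennreal (exp (\<Sum>i<n. \<Sum>j<d. b i j * w i \<omega> $ j)) \<partial>M) = (\<integral>\<^sup>+\<omega>. (\<Prod>i<n. ?X i \<omega>) \<partial>M)"
    by (subst prod_ennreal) (simp_all add: exp_sum prod_nonneg)
  also have "\<dots> = (\<Prod>i<n. \<integral>\<^sup>+\<omega>. ?X i \<omega> \<partial>M)"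
    by (rule indep_vars_nn_integral[OF _ ind]) auto
  also have "\<dots> \<le> (\<Prod>i<n. ennreal (exp (\<sigma>\<^sup>2 * (\<Sum>j<d. (b i j)\<^sup>2) / 2)))"
    by (intro prod_mono_ennreal mgf_single) auto
  also have "\<dots> = ennreal (exp (\<sigma>\<^sup>2 * (\<Sum>i<n. \<Sum>j<d. (b i j)\<^sup>2) / 2))"
    by (simp add: prod_ennreal sum_distrib_left sum_divide_distrib flip: exp_sum)
  finally show ?thesis .
qed

lemma measurable_combination [measurable]:
  "(\<lambda>\<omega>. \<Sum>i<n. \<Sum>j<d. b i j * w i \<omega> $ j) \<in> borel_measurable M"
  by (intro borel_measurable_sum borel_measurable_times borel_measurable_const measurable_noise) auto

text \<open>
  Chernoff's bound with the optimal parameter \<open>t / (\<sigma>\<^sup>2 * V)\<close>.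
\<close>

lemma tail_combination:
  assumes V: "(\<Sum>i<n. \<Sum>j<d. (b i j)\<^sup>2) \<le> V" "0 < V" and t: "0 < t"
  shows "emeasure M {\<omega> \<in> space M. t \<le> (\<Sum>i<n. \<Sum>j<d. b i j * w i \<omega> $ j)} \<le> ennreal (exp (- (t\<^sup>2 / (2 * \<sigma>\<^sup>2 * V))))"
proof -
  define s where "s = t / (\<sigma>\<^sup>2 * V)"
  have s: "0 < s" using t V sigma_pos by (simp add: s_def)
  let ?S = "\<lambda>\<omega>. \<Sum>i<n. \<Sum>j<d. b i j * w i \<omega> $ j"
  have "emeasure M {\<omega> \<in> space M. t \<le> ?S \<omega>} \<le>
      ennreal (exp (- s * t)) * (\<integral>\<^sup>+\<omega>. ennreal (exp (s * ?S \<omega>)) * indicator (space M) \<omega> \<partial>M)"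
    by (rule Chernoff_ineq_nn_integral_ge[OF s]) measurable
  also have "(\<integral>\<^sup>+\<omega>. ennreal (exp (s * ?S \<omega>)) * indicator (space M) \<omega> \<partial>M) =
      (\<integral>\<^sup>+\<omega>. ennreal (exp (\<Sum>i<n. \<Sum>j<d. (s * b i j) * w i \<omega> $ j)) \<partial>M)"
    by (intro nn_integral_cong) (simp add: sum_distrib_left mult.assoc)
  also have "\<dots> \<le> ennreal (exp (\<sigma>\<^sup>2 * (\<Sum>i<n. \<Sum>j<d. (s * b i j)\<^sup>2) / 2))"
    by (rule mgf_combination)
  also have "\<dots> \<le> ennreal (exp (\<sigma>\<^sup>2 * (s\<^sup>2 * V) / 2))"
    using V by (simp add: power_mult_distrib mult_left_mono flip: sum_distrib_left)
  finally have "emeasure M {\<omega> \<in> space M. t \<le> ?S \<omega>} \<le>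
      ennreal (exp (- s * t)) * ennreal (exp (\<sigma>\<^sup>2 * (s\<^sup>2 * V) / 2))"
    by (simp add: mult_left_mono)
  also have "\<dots> = ennreal (exp (- s * t + \<sigma>\<^sup>2 * (s\<^sup>2 * V) / 2))"
    by (simp only: exp_add ennreal_mult[OF exp_ge_zero exp_ge_zero])
  also have "- s * t + \<sigma>\<^sup>2 * (s\<^sup>2 * V) / 2 = - (t\<^sup>2 / (2 * \<sigma>\<^sup>2 * V))"
    using V sigma_pos by (simp add: s_def field_simps power2_eq_square)
  finally show ?thesis .
qed

lemma tail_single:
  assumes i: "i < n" and V: "(\<Sum>j<d. (v j)\<^sup>2) \<le> V" "0 < V" and t: "0 < t"
  shows "emeasure M {\<omega> \<in> space M. t \<le> (\<Sum>j<d. v j * w i \<omega> $ j)} \<le> ennreal (exp (- (t\<^sup>2 / (2 * \<sigma>\<^sup>2 * V))))"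
proof -
  let ?b = "\<lambda>i' j. if i' = i then v j else 0"
  have "(\<Sum>i'<n. \<Sum>j<d. ?b i' j * w i' \<omega> $ j) = (\<Sum>i'<n. if i' = i then (\<Sum>j<d. v j * w i \<omega> $ j) else 0)" for \<omega>
    by (intro sum.cong) auto
  then have 1: "(\<Sum>i'<n. \<Sum>j<d. ?b i' j * w i' \<omega> $ j) = (\<Sum>j<d. v j * w i \<omega> $ j)" for \<omega>
    using i by simp
  have "(\<Sum>i'<n. \<Sum>j<d. (?b i' j)\<^sup>2) = (\<Sum>i'<n. if i' = i then (\<Sum>j<d. (v j)\<^sup>2) else 0)"
    by (intro sum.cong) auto
  then have "(\<Sum>i'<n. \<Sum>j<d. (?b i' j)\<^sup>2) \<le> V" using i V by simp
  from tail_combination[OF this V(2) t] show ?thesis unfolding 1 .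
qed

end

text \<open>
  The operator norm is a maximum of a bilinear form, and both of its arguments can be moved to nets.
\<close>

lemma operator_bound_net:
  fixes w :: "nat \<Rightarrow> real vec"
  assumes w: "\<And>i. i < n \<Longrightarrow> w i \<in> carrier_vec d" and B: "0 \<le> B"
    and bounded: "\<And>a u. a \<in> lattice_net d \<Longrightarrow> u \<in> lattice_net n \<Longrightarrow> (\<Sum>i<n. \<Sum>j<d. u i * a j * w i $ j) \<le> B"
  shows "operator_bound n B (\<lambda>i. embed (w i))"
  unfolding operator_bound_def
proof
  fix u :: "nat \<Rightarrow> real"
  let ?v = "\<lambda>j. \<Sum>i<n. u i * w i $ j"
  have dim: "dim_vec (w i) = d" if "i < n" for i using w[OF that] by simp
  have "(\<Sum>i<n. u i *\<^sub>R embed (w i)) = row_seq d ?v"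
    by (intro fin_seq_eqI)
      (simp add: coord_sum scaleR_fin_seq.rep_eq row_seq_def embed.rep_eq dim)
  then have "norm (\<Sum>i<n. u i *\<^sub>R embed (w i)) = L2_set ?v {..<d}" by (simp add: norm_row_seq)
  also obtain a where a: "a \<in> lattice_net d" "L2_set ?v {..<d} \<le> (\<Sum>j<d. a j * ?v j)" by (rule net_dual)
  let ?x = "\<lambda>i. \<Sum>j<d. a j * w i $ j"
  note a(2)
  also have "(\<Sum>j<d. a j * ?v j) = (\<Sum>j<d. \<Sum>i<n. u i * (a j * w i $ j))"
    by (simp add: sum_distrib_left mult_ac)
  also have "\<dots> = (\<Sum>i<n. u i * ?x i)"
    by (subst sum.swap) (simp add: sum_distrib_left)
  also have "\<dots> \<le> L2_set u {..<n} * L2_set ?x {..<n}"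
    by (rule order_trans[OF sum_mono L2_set_mult_ineq]) (simp flip: abs_mult)
  also have "\<dots> \<le> L2_set u {..<n} * B"
  proof (rule mult_left_mono)
    obtain u' where u': "u' \<in> lattice_net n" "L2_set ?x {..<n} \<le> (\<Sum>i<n. u' i * ?x i)" by (rule net_dual)
    note u'(2)
    also have "(\<Sum>i<n. u' i * ?x i) = (\<Sum>i<n. \<Sum>j<d. u' i * a j * w i $ j)"
      by (simp add: sum_distrib_left mult.assoc)
    also have "\<dots> \<le> B" by (rule bounded[OF a(1) u'(1)])
    finally show "L2_set ?x {..<n} \<le> B" .
  qed simp
  finally show "norm (\<Sum>i<n. u i *\<^sub>R embed (w i)) \<le> B * L2_set u {..<n}" by (simp add: mult.commute)
qed

context sub_gaussian_mixture
begin

text \<open>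
  Here \<open>224 = 32 * 7\<close>: on net points the bilinear form has tails \<open>exp (- t\<^sup>2 / (32 * \<sigma>\<^sup>2))\<close>, and the union bound
  over both nets costs \<open>exp (6 * (n + d))\<close> of the resulting \<open>exp (- 7 * (n + d))\<close>.
\<close>

definition noise_norm :: real where
  "noise_norm = sqrt (224 * \<sigma>\<^sup>2 * (real n + real d))"

definition tame_noise :: "'a set" where
  "tame_noise = {\<omega> \<in> space M. \<forall>a\<in>lattice_net d. \<forall>u\<in>lattice_net n. (\<Sum>i<n. \<Sum>j<d. u i * a j * w i \<omega> $ j) < noise_norm}"

lemma tame_noise_sets: "tame_noise \<in> sets M"
proof -
  have "tame_noise = {\<omega> \<in> space M. \<forall>p\<in>lattice_net d \<times> lattice_net n. (\<Sum>i<n. \<Sum>j<d. snd p i * fst p j * w i \<omega> $ j) < noise_norm}"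
    by (auto simp: tame_noise_def)
  also have "\<dots> \<in> sets M"
    by (intro sets.sets_Collect_finite_All borel_measurable_less measurable_combination) auto
  finally show ?thesis .
qed

lemma tame_noise_operator_bound:
  assumes "\<omega> \<in> tame_noise"
  shows "operator_bound n noise_norm (\<lambda>i. embed (w i \<omega>))"
proof (rule operator_bound_net)
  show "w i \<omega> \<in> carrier_vec d" if "i < n" for i
    using noise_carrier[OF that] assms by (auto simp: tame_noise_def)
  show "0 \<le> noise_norm" by (simp add: noise_norm_def)
  show "(\<Sum>i<n. \<Sum>j<d. u i * a j * w i \<omega> $ j) \<le> noise_norm" if "a \<in> lattice_net d" "u \<in> lattice_net n" for a u
    using assms that by (fastforce simp: tame_noise_def intro: less_imp_le)
qed

lemma tame_noise_prob:
  assumes n: "0 < n"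
  shows "emeasure M (space M - tame_noise) \<le> ennreal (exp (- real n))"
proof -
  let ?S = "\<lambda>p \<omega>. \<Sum>i<n. \<Sum>j<d. snd p i * fst p j * w i \<omega> $ j"
  let ?E = "\<lambda>p. {\<omega> \<in> space M. noise_norm \<le> ?S p \<omega>}"
  have B: "0 < noise_norm" using n sigma_pos by (simp add: noise_norm_def)
  have "emeasure M (space M - tame_noise) = emeasure M (\<Union>p\<in>lattice_net d \<times> lattice_net n. ?E p)"
    by (rule arg_cong[of _ _ "emeasure M"]) (force simp: tame_noise_def not_less)
  also have "\<dots> \<le> (\<Sum>p\<in>lattice_net d \<times> lattice_net n. emeasure M (?E p))"
    by (intro emeasure_subadditive_finite) auto
  also have "\<dots> \<le> (\<Sum>p\<in>lattice_net d \<times> lattice_net n. ennreal (exp (- (7 * (real n + real d)))))"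
  proof (rule sum_mono)
    fix p assume p: "p \<in> lattice_net d \<times> lattice_net n"
    have "(\<Sum>i<n. \<Sum>j<d. (snd p i * fst p j)\<^sup>2) = (\<Sum>i<n. (snd p i)\<^sup>2) * (\<Sum>j<d. (fst p j)\<^sup>2)"
      by (simp add: power_mult_distrib sum_product)
    also have "\<dots> \<le> 4 * 4"
      using p by (intro mult_mono net_sum_sq sum_nonneg) auto
    finally have "(\<Sum>i<n. \<Sum>j<d. (snd p i * fst p j)\<^sup>2) \<le> 16" by simp
    then have "emeasure M (?E p) \<le> ennreal (exp (- (noise_norm\<^sup>2 / (2 * \<sigma>\<^sup>2 * 16))))"
      by (rule tail_combination) (use B in auto)
    also have "noise_norm\<^sup>2 / (2 * \<sigma>\<^sup>2 * 16) = 7 * (real n + real d)"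
      using sigma_pos by (simp add: noise_norm_def)
    finally show "emeasure M (?E p) \<le> ennreal (exp (- (7 * (real n + real d))))" .
  qed
  also have "\<dots> = ennreal (real (card (lattice_net d)) * real (card (lattice_net n)) * exp (- (7 * (real n + real d))))"
    by (simp add: card_cartesian_product ennreal_of_nat_eq_real_of_nat ennreal_mult)
  also have "\<dots> \<le> ennreal (exp (6 * real d) * exp (6 * real n) * exp (- (7 * (real n + real d))))"
    by (intro ennreal_leI mult_right_mono mult_mono card_net) auto
  also have "\<dots> = ennreal (exp (6 * real d + 6 * real n + - (7 * (real n + real d))))"
    by (simp only: exp_add)
  also have "\<dots> \<le> ennreal (exp (- real n))" by (intro ennreal_leI) simp
  finally show ?thesis .
qed

text \<open>
  The vector formed from \<open>A\<close> depends only on noise vectors other than \<open>w i\<close>, hence is independent of \<open>w i\<close>.  For any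
  fixed value of it with squared norm at most \<open>K\<close> the tail bound for \<open>w i\<close> applies; Fubini's theorem for
  the joint distribution removes the conditioning.
\<close>

lemma decoupled_tail:
  assumes i: "i < n" and A: "A \<subseteq> {..<n} - {i}" and t: "0 < t" and K: "0 < K"
  shows "emeasure M {\<omega> \<in> space M. (\<Sum>j<d. ((\<Sum>i'\<in>A. w i' \<omega> $ j) / c)\<^sup>2) \<le> K \<and>
            t \<le> (\<Sum>j<d. (\<Sum>i'\<in>A. w i' \<omega> $ j) / c * w i \<omega> $ j)}
         \<le> ennreal (exp (- (t\<^sup>2 / (2 * \<sigma>\<^sup>2 * K))))"
proof -
  let ?C = "\<lambda>_::nat. \<Pi>\<^sub>M j\<in>{..<d}. (borel :: real measure)"
  let ?W = "\<lambda>i \<omega>. \<lambda>j\<in>{..<d}. w i \<omega> $ j"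
  let ?X = "\<lambda>\<omega>. restrict (\<lambda>i. ?W i \<omega>) A" and ?Y = "\<lambda>\<omega>. restrict (\<lambda>i. ?W i \<omega>) {i}"
  let ?N1 = "PiM A ?C" and ?N2 = "PiM {i} ?C"
  have ind: "indep_var ?N1 ?X ?N2 ?Y"
    by (rule indep_var_restrict[OF noise_indep]) (use i A in auto)
  then have X [measurable]: "?X \<in> measurable M ?N1" and Y [measurable]: "?Y \<in> measurable M ?N2"
    and distr: "distr M ?N1 ?X \<Otimes>\<^sub>M distr M ?N2 ?Y = distr M (?N1 \<Otimes>\<^sub>M ?N2) (\<lambda>\<omega>. (?X \<omega>, ?Y \<omega>))"
    unfolding indep_var_distribution_eq by auto
  let ?v = "\<lambda>f j. (\<Sum>i'\<in>A. f i' j) / c"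
  let ?R = "{p \<in> space (?N1 \<Otimes>\<^sub>M ?N2). (\<Sum>j<d. (?v (fst p) j)\<^sup>2) \<le> K \<and> t \<le> (\<Sum>j<d. ?v (fst p) j * snd p i j)}"
  have m1: "(\<lambda>p. fst p i' j) \<in> borel_measurable (?N1 \<Otimes>\<^sub>M ?N2)" if "i' \<in> A" "j < d" for i' j
  proof -
    have "(\<lambda>f. f i') \<in> measurable ?N1 (?C i')" using that by (intro measurable_component_singleton)
    moreover have "(\<lambda>g. g j) \<in> borel_measurable (?C i')" using that by (intro measurable_component_singleton) auto
    ultimately have "(\<lambda>f. f i' j) \<in> borel_measurable ?N1" by (rule measurable_compose)
    then show ?thesis by (rule measurable_compose[OF measurable_fst])
  qed
  have m2: "(\<lambda>p. snd p i j) \<in> borel_measurable (?N1 \<Otimes>\<^sub>M ?N2)" if "j < d" for j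
  proof -
    have "(\<lambda>f. f i) \<in> measurable ?N2 (?C i)" by (intro measurable_component_singleton) auto
    moreover have "(\<lambda>g. g j) \<in> borel_measurable (?C i)" using that by (intro measurable_component_singleton) auto
    ultimately have "(\<lambda>f. f i j) \<in> borel_measurable ?N2" by (rule measurable_compose)
    then show ?thesis by (rule measurable_compose[OF measurable_snd])
  qed
  have mv: "(\<lambda>p. ?v (fst p) j) \<in> borel_measurable (?N1 \<Otimes>\<^sub>M ?N2)" if "j < d" for j
    using that by (intro borel_measurable_divide borel_measurable_sum m1 borel_measurable_const)
  have R: "?R \<in> sets (?N1 \<Otimes>\<^sub>M ?N2)"
    by (intro sets.sets_Collect_conj borel_measurable_le borel_measurable_sum borel_measurable_power
        borel_measurable_times mv m2 borel_measurable_const) auto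
  have fin: "finite A" using A finite_subset by blast
  have vX: "?v (?X \<omega>) j = (\<Sum>i'\<in>A. w i' \<omega> $ j) / c" if "j < d" for \<omega> j
    using that by (intro arg_cong2[of _ _ _ _ "(/)"] sum.cong) auto
  have YX: "?Y \<omega> i j = w i \<omega> $ j" if "j < d" for \<omega> j using that by simp
  let ?E = "{\<omega> \<in> space M. (\<Sum>j<d. ((\<Sum>i'\<in>A. w i' \<omega> $ j) / c)\<^sup>2) \<le> K \<and>
            t \<le> (\<Sum>j<d. (\<Sum>i'\<in>A. w i' \<omega> $ j) / c * w i \<omega> $ j)}"
  have E: "?E = (\<lambda>\<omega>. (?X \<omega>, ?Y \<omega>)) -` ?R \<inter> space M"
  proof (rule Set.set_eqI)
    fix \<omega>
    have "(?X \<omega>, ?Y \<omega>) \<in> space (?N1 \<Otimes>\<^sub>M ?N2)" if "\<omega> \<in> space M"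
      using measurable_space[OF X that] measurable_space[OF Y that] by (simp add: space_pair_measure)
    moreover have "(\<Sum>j<d. (?v (fst (?X \<omega>, ?Y \<omega>)) j)\<^sup>2) = (\<Sum>j<d. ((\<Sum>i'\<in>A. w i' \<omega> $ j) / c)\<^sup>2)"
      unfolding fst_conv by (intro sum.cong refl arg_cong[of _ _ "\<lambda>x. x\<^sup>2"] vX) auto
    moreover have "(\<Sum>j<d. ?v (fst (?X \<omega>, ?Y \<omega>)) j * snd (?X \<omega>, ?Y \<omega>) i j) = (\<Sum>j<d. (\<Sum>i'\<in>A. w i' \<omega> $ j) / c * w i \<omega> $ j)"
      unfolding fst_conv snd_conv by (intro sum.cong refl arg_cong2[of _ _ _ _ "(*)"] vX YX) auto
    ultimately show "\<omega> \<in> ?E \<longleftrightarrow> \<omega> \<in> (\<lambda>\<omega>. (?X \<omega>, ?Y \<omega>)) -` ?R \<inter> space M" by auto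
  qed
  have "emeasure M ?E = emeasure (distr M (?N1 \<Otimes>\<^sub>M ?N2) (\<lambda>\<omega>. (?X \<omega>, ?Y \<omega>))) ?R"
    unfolding E by (rule emeasure_distr[OF measurable_Pair[OF X Y] R, symmetric])
  also have "\<dots> = emeasure (distr M ?N1 ?X \<Otimes>\<^sub>M distr M ?N2 ?Y) ?R" by (simp only: distr)
  also have "\<dots> = (\<integral>\<^sup>+f. emeasure (distr M ?N2 ?Y) (Pair f -` ?R) \<partial>distr M ?N1 ?X)"
  proof -
    interpret Y: prob_space "distr M ?N2 ?Y" by (rule prob_space_distr) (rule Y)
    have "?R \<in> sets (distr M ?N1 ?X \<Otimes>\<^sub>M distr M ?N2 ?Y)"
      using R by (simp cong: sets_pair_measure_cong)
    then show ?thesis by (rule Y.emeasure_pair_measure_alt)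
  qed
  also have "\<dots> \<le> (\<integral>\<^sup>+f. ennreal (exp (- (t\<^sup>2 / (2 * \<sigma>\<^sup>2 * K)))) \<partial>distr M ?N1 ?X)"
  proof (rule nn_integral_mono)
    fix f assume "f \<in> space (distr M ?N1 ?X)"
    have "emeasure (distr M ?N2 ?Y) (Pair f -` ?R) = emeasure M (?Y -` (Pair f -` ?R) \<inter> space M)"
      using sets_Pair1[OF R] by (intro emeasure_distr Y) auto
    also have "\<dots> \<le> ennreal (exp (- (t\<^sup>2 / (2 * \<sigma>\<^sup>2 * K))))"
    proof (cases "(\<Sum>j<d. (?v f j)\<^sup>2) \<le> K")
      case True
      have "emeasure M (?Y -` (Pair f -` ?R) \<inter> space M) \<le> emeasure M {\<omega> \<in> space M. t \<le> (\<Sum>j<d. ?v f j * w i \<omega> $ j)}"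
      proof (rule emeasure_mono)
        have "(\<Sum>j<d. ?v f j * ?Y \<omega> i j) = (\<Sum>j<d. ?v f j * w i \<omega> $ j)" for \<omega>
          by (intro sum.cong) auto
        then show "?Y -` (Pair f -` ?R) \<inter> space M \<subseteq> {\<omega> \<in> space M. t \<le> (\<Sum>j<d. ?v f j * w i \<omega> $ j)}"
          by auto
        have "(\<lambda>\<omega>. \<Sum>j<d. ?v f j * w i \<omega> $ j) \<in> borel_measurable M"
          using i by (intro borel_measurable_sum borel_measurable_times measurable_noise) auto
        then show "{\<omega> \<in> space M. t \<le> (\<Sum>j<d. ?v f j * w i \<omega> $ j)} \<in> sets M"
          by (intro borel_measurable_le) auto
      qed
      also have "\<dots> \<le> ennreal (exp (- (t\<^sup>2 / (2 * \<sigma>\<^sup>2 * K))))" by (rule tail_single[OF i True K t])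
      finally show ?thesis .
    next
      case False
      then have "?Y -` (Pair f -` ?R) \<inter> space M = {}" by auto
      then show ?thesis by (simp only: emeasure_empty) simp
    qed
    finally show "emeasure (distr M ?N2 ?Y) (Pair f -` ?R) \<le> ennreal (exp (- (t\<^sup>2 / (2 * \<sigma>\<^sup>2 * K))))" .
  qed
  also have "\<dots> = ennreal (exp (- (t\<^sup>2 / (2 * \<sigma>\<^sup>2 * K))))"
    using prob_space.emeasure_space_1[OF prob_space_distr[OF X]] by simp
  finally show ?thesis .
qed

end

section \<open>Spectral clustering followed by Lloyd's algorithm\<close>

lemma row_seq_vec_index: "v \<in> carrier_vec d \<Longrightarrow> embed v = row_seq d (\<lambda>j. v $ j)"
  by (auto simp: row_seq_def intro!: arg_cong[of _ _ embed] eq_vecI)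

lemma data_matrix_carrier: "data_matrix n d y \<in> carrier_mat d n"
  using mat_of_cols_carrier(1)[of d "map y [0..<n]"] by (simp add: data_matrix_def)

lemma data_matrix_index:
  "a < d \<Longrightarrow> i < n \<Longrightarrow> data_matrix n d y $$ (a, i) = y i $ a"
  by (simp add: data_matrix_def mat_of_cols_index)

context
  fixes n d :: nat and y :: "nat \<Rightarrow> real vec" and U D V :: "real mat"
  assumes svd: "is_svd (data_matrix n d y) U D V"
    and y: "\<And>i. i < n \<Longrightarrow> y i \<in> carrier_vec d"
begin

lemma svd_carrier: "U \<in> carrier_mat d d" "D \<in> carrier_mat d n" "V \<in> carrier_mat n n"
  using svd data_matrix_carrier[of n d y] by (auto simp: is_svd_def)

lemma svd_left_orthonormal: "orthonormal_on {..<d} (\<lambda>j. embed (col U j))"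
  unfolding orthonormal_on_def
proof (intro ballI)
  fix i j assume ij: "i \<in> {..<d}" "j \<in> {..<d}"
  have "inner (embed (col U i)) (embed (col U j)) = (U\<^sup>T * U) $$ (i, j)"
    using svd_carrier(1) ij by (simp add: inner_embed)
  also have "U\<^sup>T * U = 1\<^sub>m d" using svd data_matrix_carrier[of n d y] by (auto simp: is_svd_def)
  finally show "inner (embed (col U i)) (embed (col U j)) = of_bool (i = j)" using ij by simp
qed

lemma svd_right_orthonormal: "orthonormal_on {..<n} (\<lambda>j. row_seq n (\<lambda>i. V $$ (i, j)))"
  unfolding orthonormal_on_def
proof (intro ballI)
  fix i j assume ij: "i \<in> {..<n}" "j \<in> {..<n}"
  have "inner (row_seq n (\<lambda>a. V $$ (a, i))) (row_seq n (\<lambda>a. V $$ (a, j))) = (V\<^sup>T * V) $$ (i, j)"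
    using svd_carrier(3) ij by (simp add: inner_row_seq scalar_prod_def atLeast0LessThan)
  also have "V\<^sup>T * V = 1\<^sub>m n" using svd data_matrix_carrier[of n d y] by (auto simp: is_svd_def)
  finally show "inner (row_seq n (\<lambda>a. V $$ (a, i))) (row_seq n (\<lambda>a. V $$ (a, j))) = of_bool (i = j)"
    using ij by simp
qed

lemma svd_expansion:
  assumes i: "i < n"
  shows "embed (y i) = (\<Sum>j<min d n. (D $$ (j, j) * V $$ (i, j)) *\<^sub>R embed (col U j))"
proof (rule fin_seq_eqI)
  fix a
  note c = svd_carrier
  show "coord (embed (y i)) a = coord (\<Sum>j<min d n. (D $$ (j, j) * V $$ (i, j)) *\<^sub>R embed (col U j)) a"
  proof (cases "a < d")
    case True
    have UD: "(U * D) $$ (a, j) = (if j < d then U $$ (a, j) * D $$ (j, j) else 0)" if j: "j < n" for j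
    proof -
      have off: "D $$ (b, j) = 0" if "b < d" "b \<noteq> j" for b
        using svd c(2) that j unfolding is_svd_def diagonal_mat_def by auto
      have "(U * D) $$ (a, j) = (\<Sum>b<d. U $$ (a, b) * D $$ (b, j))"
        using c True j by (simp add: scalar_prod_def atLeast0LessThan)
      also have "\<dots> = (\<Sum>b<d. if b = j then U $$ (a, j) * D $$ (j, j) else 0)"
        using off by (intro sum.cong) auto
      finally show ?thesis by simp
    qed
    have "coord (embed (y i)) a = data_matrix n d y $$ (a, i)"
      using True i y[OF i] by (simp add: data_matrix_index embed.rep_eq)
    also have "data_matrix n d y = U * D * V\<^sup>T" using svd by (simp add: is_svd_def)
    finally have entry: "coord (embed (y i)) a = (U * D * V\<^sup>T) $$ (a, i)" .
    have "(X * V\<^sup>T) $$ (a, i) = (\<Sum>j<n. X $$ (a, j) * V $$ (i, j))" if "X \<in> carrier_mat d n" for X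
      using c that True i by (simp add: scalar_prod_def atLeast0LessThan)
    from this[of "U * D"] have "(U * D * V\<^sup>T) $$ (a, i) = (\<Sum>j<n. (U * D) $$ (a, j) * V $$ (i, j))"
      using mult_carrier_mat[OF c(1,2)] .
    also have "\<dots> = (\<Sum>j<n. if j < d then D $$ (j, j) * V $$ (i, j) * U $$ (a, j) else 0)"
      by (intro sum.cong) (simp_all add: UD)
    also have "\<dots> = (\<Sum>j<min d n. D $$ (j, j) * V $$ (i, j) * U $$ (a, j))"
      by (intro sum.mono_neutral_cong_right) auto
    also have "\<dots> = coord (\<Sum>j<min d n. (D $$ (j, j) * V $$ (i, j)) *\<^sub>R embed (col U j)) a"
      using c True by (simp add: coord_sum scaleR_fin_seq.rep_eq embed.rep_eq)
    finally show ?thesis using entry by simp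
  next
    case False
    then show ?thesis
      using y[OF i] c by (simp add: coord_sum scaleR_fin_seq.rep_eq embed.rep_eq)
  qed
qed

lemma svd_singular_values:
  "j < min d n \<Longrightarrow> 0 \<le> D $$ (j, j)"
  "i \<le> j \<Longrightarrow> j < min d n \<Longrightarrow> D $$ (j, j) \<le> D $$ (i, i)"
  using svd data_matrix_carrier[of n d y] by (auto simp: is_svd_def)

lemma embed_projection:
  assumes x: "x \<in> carrier_vec d"
  shows "embed ((first_cols k U * (first_cols k U)\<^sup>T) *\<^sub>v x) =
    proj {..<min k d} (\<lambda>j. embed (col U j)) (embed x)"
proof (rule fin_seq_eqI)
  fix a
  let ?F = "first_cols k U" and ?q = "min k d"
  note c = svd_carrier(1)
  have F: "?F \<in> carrier_mat d ?q" using c by (auto simp: first_cols_def min.commute)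
  have F_idx: "?F $$ (b, j) = U $$ (b, j)" if "b < d" "j < ?q" for b j
    using c that by (simp add: first_cols_def mat_of_cols_index)
  show "coord (embed ((?F * ?F\<^sup>T) *\<^sub>v x)) a = coord (proj {..<?q} (\<lambda>j. embed (col U j)) (embed x)) a"
  proof (cases "a < d")
    case True
    have "(?F * ?F\<^sup>T) *\<^sub>v x = ?F *\<^sub>v (?F\<^sup>T *\<^sub>v x)"
      using F x by (intro assoc_mult_mat_vec[of _ d ?q _ d]) auto
    then have "coord (embed ((?F * ?F\<^sup>T) *\<^sub>v x)) a = (?F *\<^sub>v (?F\<^sup>T *\<^sub>v x)) $ a"
      using F True by (simp add: embed.rep_eq)
    also have "\<dots> = (\<Sum>j<?q. ?F $$ (a, j) * (?F\<^sup>T *\<^sub>v x) $ j)"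
      using F True by (simp add: scalar_prod_def atLeast0LessThan)
    also have "\<dots> = (\<Sum>j<?q. (col U j \<bullet> x) * U $$ (a, j))"
    proof (rule sum.cong)
      fix j assume j: "j \<in> {..<?q}"
      have "(?F\<^sup>T *\<^sub>v x) $ j = (\<Sum>b<d. ?F $$ (b, j) * x $ b)"
        using F x j by (simp add: scalar_prod_def atLeast0LessThan)
      also have "\<dots> = col U j \<bullet> x"
        using x j c by (auto simp: scalar_prod_def atLeast0LessThan F_idx intro!: sum.cong)
      finally show "?F $$ (a, j) * (?F\<^sup>T *\<^sub>v x) $ j = (col U j \<bullet> x) * U $$ (a, j)"
        using F_idx[OF True] j by simp
    qed simp
    also have "\<dots> = coord (proj {..<?q} (\<lambda>j. embed (col U j)) (embed x)) a"
      using c True x by (simp add: proj_def coord_sum scaleR_fin_seq.rep_eq embed.rep_eq inner_embed)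
    finally show ?thesis .
  next
    case False
    then show ?thesis
      using F c by (simp add: proj_def coord_sum scaleR_fin_seq.rep_eq embed.rep_eq)
  qed
qed

end

lemma kmeans_cost_nonneg: "0 < k \<Longrightarrow> 0 \<le> kmeans_cost n k x \<mu>"
  unfolding kmeans_cost_def by (intro sum_nonneg) (subst Min_ge_iff, auto)

text \<open>
  The absolute value makes the bound increasing in the infimum for every real \<open>C\<close>.
\<close>

lemma kmeans_approx_le:
  assumes approx: "kmeans_approx C n d k x \<mu>" and k: "0 < k"
    and \<nu>: "\<And>h. h < k \<Longrightarrow> \<nu> h \<in> carrier_vec d"
  shows "kmeans_cost n k x \<mu> \<le> \<bar>C\<bar> * kmeans_cost n k x \<nu>"
proof -
  let ?S = "{\<nu>. \<forall>h<k. \<nu> h \<in> carrier_vec d}"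
  let ?I = "INF \<nu>\<in>?S. kmeans_cost n k x \<nu>"
  have mem: "\<nu> \<in> ?S" using \<nu> by simp
  have "bdd_below (kmeans_cost n k x ` ?S)"
    using kmeans_cost_nonneg[OF k] by (intro bdd_belowI[of _ 0]) auto
  then have le: "?I \<le> kmeans_cost n k x \<nu>" using mem by (rule cINF_lower)
  have "0 \<le> ?I" using mem by (intro cINF_greatest) (auto intro: kmeans_cost_nonneg[OF k])
  have "kmeans_cost n k x \<mu> \<le> C * ?I" using approx by (simp add: kmeans_approx_def)
  also have "\<dots> \<le> \<bar>C\<bar> * ?I" using \<open>0 \<le> ?I\<close> by (intro mult_right_mono) auto
  also have "\<dots> \<le> \<bar>C\<bar> * kmeans_cost n k x \<nu>" using le by (intro mult_left_mono) auto
  finally show ?thesis .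
qed

lemma kmeans_cost_embed:
  assumes "\<And>i. i < n \<Longrightarrow> dim_vec (x i) = d" "\<And>h. h < k \<Longrightarrow> dim_vec (\<mu> h) = d"
  shows "kmeans_cost n k x \<mu> = (\<Sum>i<n. MIN h\<in>{..<k}. (norm (embed (x i) - embed (\<mu> h)))\<^sup>2)"
  unfolding kmeans_cost_def
  using assms by (intro sum.cong refl arg_cong[of _ _ Min] image_cong) (simp flip: embed_diff add: norm_embed)

lemma misclust_loss_le:
  assumes \<pi>: "\<pi> permutes {..<k}"
  shows "misclust_loss n k zh z \<le> card {i. i < n \<and> \<pi> (zh i) \<noteq> z i} / n"
proof -
  let ?f = "\<lambda>\<pi>. 1 / real n * (\<Sum>i<n. of_bool (\<pi> (zh i) \<noteq> z i))"
  have "misclust_loss n k zh z \<le> ?f \<pi>"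
    unfolding misclust_loss_def
  proof (rule cINF_lower)
    show "bdd_below (?f ` {\<pi>. \<pi> permutes {..<k}})"
      by (intro bdd_belowI[of _ 0]) (auto intro!: divide_nonneg_nonneg sum_nonneg)
  qed (use \<pi> in simp)
  also have "(\<Sum>i<n. of_bool (\<pi> (zh i) \<noteq> z i)) = real (card {i. i < n \<and> \<pi> (zh i) \<noteq> z i})"
    by (simp add: sum_of_bool_eq[of "{..<n}"] Int_def conj_commute)
  finally show ?thesis by simp
qed

lemma embed_sample_mean:
  assumes "\<And>i. i \<in> S \<Longrightarrow> y i \<in> carrier_vec d"
  shows "embed (sample_mean d S y) = (\<Sum>i\<in>S. embed (y i)) /\<^sub>R card S"
proof (rule fin_seq_eqI)
  fix a
  have dim: "dim_vec (y i) = d" if "i \<in> S" for i using assms[OF that] by simp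
  show "coord (embed (sample_mean d S y)) a = coord ((\<Sum>i\<in>S. embed (y i)) /\<^sub>R card S) a"
    by (simp add: coord_sum scaleR_fin_seq.rep_eq embed.rep_eq sample_mean_def dim divide_inverse mult.commute)
qed

text \<open>
  The initial centers match the true ones up to a permutation.  Permuting the labels of all iterates
  accordingly yields again a run of Lloyd's algorithm, now with centers near the true ones, and the loss
  does not distinguish the two runs.
\<close>

theorem spectral_lloyd_deterministic:
  fixes \<theta> :: "nat \<Rightarrow> real vec" and w :: "nat \<Rightarrow> real vec"
  assumes clusters: "separated_clusters n k z (\<lambda>h. embed (\<theta> h)) (\<lambda>i. embed (w i)) B \<Delta> m \<rho>"
    and \<theta>: "\<And>h. h < k \<Longrightarrow> \<theta> h \<in> carrier_vec d"
    and w: "\<And>i. i < n \<Longrightarrow> w i \<in> carrier_vec d"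
    and algo: "spectral_lloyd_output C n d k (\<lambda>i. \<theta> (z i) + w i) (nat \<lceil>4 * ln n\<rceil>) zh"
    and n: "2 \<le> n"
    and K: "18 \<le> K" "20 * (1 + \<bar>C\<bar>) \<le> K\<^sup>2" "K * \<rho> \<le> 1 / 8"
    and \<xi>: "0 < \<xi>" "256 * (K * \<rho>)\<^sup>2 * \<rho>\<^sup>2 \<le> \<xi>\<^sup>2" "110592 * \<rho> ^ 4 \<le> \<xi>\<^sup>2"
    and few: "real (card (separated_clusters.bad n k z (\<lambda>h. embed (\<theta> h)) (\<lambda>i. embed (w i)) \<Delta> (K * \<rho>) \<xi>)) \<le> m / 4"
  shows "misclust_loss n k zh z \<le>
    3 * card (separated_clusters.bad n k z (\<lambda>h. embed (\<theta> h)) (\<lambda>i. embed (w i)) \<Delta> (K * \<rho>) \<xi>) / n"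
proof -
  let ?y = "\<lambda>i. \<theta> (z i) + w i"
  interpret sc: separated_clusters n k z "\<lambda>h. embed (\<theta> h)" "\<lambda>i. embed (w i)" B \<Delta> m \<rho>
    by (rule clusters)
  have y: "?y i \<in> carrier_vec d" if "i < n" for i
    using \<theta>[OF sc.label[OF that]] w[OF that] by simp
  have sc_y: "sc.y i = embed (?y i)" if "i < n" for i
    using \<theta>[OF sc.label[OF that]] w[OF that] by (simp add: sc.y_def embed_add)
  obtain c l where centers: "spectral_centers C n d k ?y (c 0)" and lloyd: "lloyd_iterates n d k ?y c l"
    and zh: "zh = l (nat \<lceil>4 * ln n\<rceil>)"
    using algo by (auto simp: spectral_lloyd_output_def)
  obtain U D V where svd: "is_svd (data_matrix n d ?y) U D V"
    and approx: "kmeans_approx C n d k (\<lambda>i. (first_cols k U * (first_cols k U)\<^sup>T) *\<^sub>v ?y i) (c 0)"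
    using centers by (auto simp: spectral_centers_def)
  note svd = svd y
  let ?u = "\<lambda>j. embed (col U j)"
  interpret noisy_svd n k z "\<lambda>h. embed (\<theta> h)" "\<lambda>i. embed (w i)" B \<Delta> m \<rho>
    "min d n" "min k d" "\<lambda>j. D $$ (j, j)" "\<lambda>j i. V $$ (i, j)" ?u
  proof unfold_locales
    show "orthonormal_on {..<min d n} (\<lambda>j. row_seq n (\<lambda>i. V $$ (i, j)))"
      by (rule orthonormal_on_subset[OF svd_right_orthonormal[OF svd]]) auto
    show "orthonormal_on {..<min d n} ?u" "orthonormal_on {..<min k d} ?u"
      by (rule orthonormal_on_subset[OF svd_left_orthonormal[OF svd]]; auto)+
    show "sc.y i = (\<Sum>j<min d n. (D $$ (j, j) * V $$ (i, j)) *\<^sub>R ?u j)" if "i < n" for i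
      using svd_expansion[OF svd that] sc_y[OF that] by simp
  qed (use svd_singular_values[OF svd] in auto)
  have c_carrier: "c s h \<in> carrier_vec d" if "h < k" for s h
  proof (cases s)
    case 0
    then show ?thesis using approx that by (simp add: kmeans_approx_def)
  next
    case (Suc s')
    then show ?thesis using lloyd that by (auto simp: lloyd_iterates_def Let_def)
  qed
  obtain \<pi> where \<pi>: "\<pi> permutes {..<k}" and init: "\<And>h. h < k \<Longrightarrow> norm (embed (c 0 (\<pi> h)) - embed (\<theta> h)) \<le> K * \<rho> * \<Delta>"
  proof (rule spectral_centers_close[of "\<bar>C\<bar>" "\<lambda>h. embed (c 0 h)" K])
    let ?x = "\<lambda>i. (first_cols k U * (first_cols k U)\<^sup>T) *\<^sub>v ?y i"
    have dim: "dim_row (first_cols k U) = d" using svd_carrier(1)[OF svd] by (simp add: first_cols_def)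
    have x: "embed (?x i) = P (sc.y i)" if "i < n" for i
      using embed_projection[OF svd y[OF that]] sc_y[OF that] by simp
    have cost: "kmeans_cost n k ?x \<mu> = (\<Sum>i<n. MIN h\<in>{..<k}. (norm (P (sc.y i) - embed (\<mu> h)))\<^sup>2)"
      if "\<And>h. h < k \<Longrightarrow> \<mu> h \<in> carrier_vec d" for \<mu>
      using that by (subst kmeans_cost_embed[of _ _ d]) (auto simp: dim x intro!: sum.cong)
    show "(\<Sum>i<n. MIN h\<in>{..<k}. (norm (P (sc.y i) - embed (c 0 h)))\<^sup>2) \<le>
        \<bar>C\<bar> * (\<Sum>i<n. MIN h\<in>{..<k}. (norm (P (sc.y i) - embed (\<theta> h)))\<^sup>2)"
      using kmeans_approx_le[OF approx sc.k_pos \<theta>] cost[OF \<theta>] cost[of "c 0", OF c_carrier] by simp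
  qed (use K in auto)
  let ?i = "inv_into UNIV \<pi>"
  have \<pi>i: "\<pi> (?i h) = h" "?i (\<pi> h) = h" for h using permutes_inverses[OF \<pi>] by auto
  have \<pi>_lt: "\<pi> h < k" if "h < k" for h using permutes_in_image[OF \<pi>] that by auto
  have i_perm: "?i permutes {..<k}" by (rule permutes_inv[OF \<pi>])
  have i_lt: "?i h < k" if "h < k" for h using permutes_in_image[OF i_perm] that by auto
  define c' where "c' = (\<lambda>s h. embed (c s (\<pi> h)))"
  define l' where "l' = (\<lambda>s i. ?i (l s i))"
  have near: "sc.nearest (c' s) (l' (Suc s))" for s
    unfolding sc.nearest_def
  proof (intro allI impI conjI)
    fix i assume i: "i < n"
    have arg: "is_arg_min (\<lambda>h. (enorm (?y i - c s h))\<^sup>2) (\<lambda>h. h < k) (l (Suc s) i)"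
      using lloyd i by (simp add: lloyd_iterates_def)
    then have lt: "l (Suc s) i < k" by (simp add: is_arg_min_def)
    then show "l' (Suc s) i < k" by (simp add: l'_def i_lt)
    fix h assume h: "h < k"
    have "(enorm (?y i - c s (l (Suc s) i)))\<^sup>2 \<le> (enorm (?y i - c s (\<pi> h)))\<^sup>2"
      using arg \<pi>_lt[OF h] unfolding is_arg_min_linorder by blast
    then have "norm (embed (?y i - c s (l (Suc s) i))) \<le> norm (embed (?y i - c s (\<pi> h)))"
      by (simp add: norm_embed[symmetric])
    moreover have "embed (?y i - c s g) = sc.y i - embed (c s g)" if "g < k" for g
      unfolding sc_y[OF i]
      by (rule embed_diff) (simp only: carrier_vecD[OF y[OF i]] carrier_vecD[OF c_carrier[OF that]])
    ultimately show "norm (sc.y i - c' s (l' (Suc s) i)) \<le> norm (sc.y i - c' s h)"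
      using lt \<pi>_lt[OF h] by (simp add: c'_def l'_def \<pi>i)
  qed
  have means: "c' (Suc s) h = (\<Sum>i | i < n \<and> l' (Suc s) i = h. sc.y i) /\<^sub>R card {i. i < n \<and> l' (Suc s) i = h}"
    if h: "h < k" and ne: "{i. i < n \<and> l' (Suc s) i = h} \<noteq> {}" for s h
  proof -
    have S: "{i. i < n \<and> l' (Suc s) i = h} = {i. i < n \<and> l (Suc s) i = \<pi> h}" (is "_ = ?S")
      unfolding l'_def using \<pi>i by metis
    have "c (Suc s) (\<pi> h) = sample_mean d ?S ?y"
      using lloyd \<pi>_lt[OF h] ne unfolding S lloyd_iterates_def Let_def by blast
    then have "c' (Suc s) h = (\<Sum>i\<in>?S. embed (?y i)) /\<^sub>R card ?S"
      unfolding c'_def by (simp only:) (rule embed_sample_mean, use y in auto)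
    also have "(\<Sum>i\<in>?S. embed (?y i)) = (\<Sum>i\<in>?S. sc.y i)" by (intro sum.cong) (auto simp: sc_y)
    finally show ?thesis unfolding S .
  qed
  have init': "norm (c' 0 h - embed (\<theta> h)) \<le> K * \<rho> * \<Delta>" if "h < k" for h
    unfolding c'_def by (rule init[OF that])
  have K\<rho>: "18 * \<rho> \<le> K * \<rho>" using K(1) sc.\<rho>_pos by simp
  have "real (card (sc.errors (l' (Suc s)))) \<le> 3 / 2 * card (sc.bad (K * \<rho>) \<xi>) + n / 3 ^ s" for s
    by (rule sc.lloyd_errors[where c = c' and l = l', OF near means init' K\<rho> K(3) \<xi>(2,1,3) few])
  then have "card (sc.errors (l' (nat \<lceil>4 * ln n\<rceil>))) \<le> 3 * card (sc.bad (K * \<rho>) \<xi>)"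
    using n by (rule sc.lloyd_errors_after_log)
  moreover have "sc.errors (l' (nat \<lceil>4 * ln n\<rceil>)) = {i. i < n \<and> ?i (zh i) \<noteq> z i}"
    by (simp add: sc.errors_def l'_def zh)
  ultimately have "real (card {i. i < n \<and> ?i (zh i) \<noteq> z i}) \<le> 3 * card (sc.bad (K * \<rho>) \<xi>)" by simp
  then have "card {i. i < n \<and> ?i (zh i) \<noteq> z i} / n \<le> 3 * card (sc.bad (K * \<rho>) \<xi>) / n"
    by (intro divide_right_mono) auto
  with misclust_loss_le[OF i_perm, of n zh z] show ?thesis by linarith
qed

section \<open>Unlucky points\<close>

context sub_gaussian_mixture
begin

definition cluster :: "nat \<Rightarrow> nat set" where
  "cluster h = {i. i < n \<and> z i = h}"

text \<open>
  The contribution of the other points to the mean noise of a cluster.  It is divided by the full size of the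
  cluster, so that it differs from the mean noise exactly by the contribution of the point \<open>i\<close>.
\<close>

definition other_mean :: "nat \<Rightarrow> nat \<Rightarrow> 'a \<Rightarrow> nat \<Rightarrow> real" where
  "other_mean i h \<omega> j = (\<Sum>i'\<in>cluster h - {i}. w i' \<omega> $ j) / card (cluster h)"

definition towards :: "real \<Rightarrow> nat \<Rightarrow> nat \<Rightarrow> 'a set" where
  "towards \<gamma> i h = {\<omega> \<in> space M. \<gamma> * (enorm (\<theta> h - \<theta> (z i)))\<^sup>2 / 2 \<le> (\<Sum>j<d. (\<theta> h - \<theta> (z i)) $ j * w i \<omega> $ j)}"

definition aligned :: "real \<Rightarrow> real \<Rightarrow> nat \<Rightarrow> nat \<Rightarrow> 'a set" where
  "aligned \<kappa> t i h = {\<omega> \<in> space M. (\<Sum>j<d. (other_mean i h \<omega> j)\<^sup>2) \<le> \<kappa> \<and> t \<le> \<bar>\<Sum>j<d. other_mean i h \<omega> j * w i \<omega> $ j\<bar>}"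

text \<open>
  A measurable event for each point that covers badness on \<open>tame_noise\<close>.  In place of the mean noise it uses
  \<open>other_mean\<close>, which is independent of the noise of the point, and it requires this vector to be short,
  which is automatic on \<open>tame_noise\<close> and makes the tail bound unconditional.
\<close>

definition unlucky :: "real \<Rightarrow> real \<Rightarrow> real \<Rightarrow> nat \<Rightarrow> 'a set" where
  "unlucky \<gamma> \<kappa> t i = (\<Union>h\<in>{h. h < k \<and> h \<noteq> z i}. towards \<gamma> i h) \<union> (\<Union>h<k. aligned \<kappa> t i h)"

lemma enorm_sq: "v \<in> carrier_vec d \<Longrightarrow> (enorm v)\<^sup>2 = (\<Sum>j<d. (v $ j)\<^sup>2)"
  by (simp add: enorm_def scalar_prod_def atLeast0LessThan sum_nonneg power2_eq_square)

lemma towards_sets: "i < n \<Longrightarrow> towards \<gamma> i h \<in> sets M"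
  unfolding towards_def
  by (intro borel_measurable_le borel_measurable_const borel_measurable_sum borel_measurable_times measurable_noise) auto

lemma measurable_other_mean: "j < d \<Longrightarrow> (\<lambda>\<omega>. other_mean i h \<omega> j) \<in> borel_measurable M"
  unfolding other_mean_def
  by (intro borel_measurable_divide borel_measurable_sum borel_measurable_const measurable_noise) (auto simp: cluster_def)

lemma aligned_sets: "i < n \<Longrightarrow> aligned \<kappa> t i h \<in> sets M"
  unfolding aligned_def
  by (intro sets.sets_Collect_conj borel_measurable_le borel_measurable_const borel_measurable_abs borel_measurable_sum
      borel_measurable_times borel_measurable_power measurable_other_mean measurable_noise) auto

lemma unlucky_sets: "i < n \<Longrightarrow> unlucky \<gamma> \<kappa> t i \<in> sets M"
  unfolding unlucky_def by (intro sets.Un sets.finite_UN towards_sets aligned_sets) auto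

lemma emeasure_towards:
  assumes i: "i < n" and h: "h < k" and D: "0 < D" "D \<le> enorm (\<theta> h - \<theta> (z i))" and \<gamma>: "0 < \<gamma>"
  shows "emeasure M (towards \<gamma> i h) \<le> ennreal (exp (- (\<gamma>\<^sup>2 * D\<^sup>2 / (8 * \<sigma>\<^sup>2))))"
proof -
  let ?\<delta> = "\<theta> h - \<theta> (z i)" and ?N = "enorm (\<theta> h - \<theta> (z i))"
  have \<delta>: "?\<delta> \<in> carrier_vec d" using centers[OF h] centers[OF labels[OF i]] by simp
  have N: "0 < ?N" using D by linarith
  have "emeasure M (towards \<gamma> i h) \<le> ennreal (exp (- ((\<gamma> * ?N\<^sup>2 / 2)\<^sup>2 / (2 * \<sigma>\<^sup>2 * ?N\<^sup>2))))"
    unfolding towards_def by (rule tail_single[OF i]) (use N \<gamma> in \<open>simp_all add: enorm_sq[OF \<delta>, symmetric]\<close>)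
  also have "(\<gamma> * ?N\<^sup>2 / 2)\<^sup>2 / (2 * \<sigma>\<^sup>2 * ?N\<^sup>2) = \<gamma>\<^sup>2 * ?N\<^sup>2 / (8 * \<sigma>\<^sup>2)"
    using N by (simp add: power_mult_distrib power_divide) (simp add: power2_eq_square power4_eq_xxxx mult_ac)
  also have "ennreal (exp (- (\<gamma>\<^sup>2 * ?N\<^sup>2 / (8 * \<sigma>\<^sup>2)))) \<le> ennreal (exp (- (\<gamma>\<^sup>2 * D\<^sup>2 / (8 * \<sigma>\<^sup>2))))"
    using D by (intro ennreal_leI) (simp add: divide_right_mono mult_left_mono power_mono)
  finally show ?thesis .
qed

lemma emeasure_aligned:
  assumes i: "i < n" and \<kappa>: "0 < \<kappa>" and t: "0 < t"
  shows "emeasure M (aligned \<kappa> t i h) \<le> ennreal (2 * exp (- (t\<^sup>2 / (2 * \<sigma>\<^sup>2 * \<kappa>))))"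
proof -
  let ?c = "real (card (cluster h))"
  let ?v = "\<lambda>c \<omega> j. (\<Sum>i'\<in>cluster h - {i}. w i' \<omega> $ j) / c"
  let ?E = "\<lambda>c. {\<omega> \<in> space M. (\<Sum>j<d. (?v c \<omega> j)\<^sup>2) \<le> \<kappa> \<and> t \<le> (\<Sum>j<d. ?v c \<omega> j * w i \<omega> $ j)}"
  have sub: "cluster h - {i} \<subseteq> {..<n} - {i}" by (auto simp: cluster_def)
  have E_sets: "?E c \<in> sets M" for c
    using i by (intro sets.sets_Collect_conj borel_measurable_le borel_measurable_const borel_measurable_sum
      borel_measurable_times borel_measurable_power borel_measurable_divide measurable_noise) (auto simp: cluster_def)
  have "aligned \<kappa> t i h \<subseteq> ?E ?c \<union> ?E (- ?c)"
    by (auto simp: aligned_def other_mean_def abs_le_iff le_minus_iff abs_if sum_negf split: if_splits)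
  then have "emeasure M (aligned \<kappa> t i h) \<le> emeasure M (?E ?c \<union> ?E (- ?c))"
    by (rule emeasure_mono) (intro sets.Un E_sets)
  also have "\<dots> \<le> emeasure M (?E ?c) + emeasure M (?E (- ?c))"
    by (intro emeasure_subadditive E_sets)
  also have "\<dots> \<le> ennreal (exp (- (t\<^sup>2 / (2 * \<sigma>\<^sup>2 * \<kappa>)))) + ennreal (exp (- (t\<^sup>2 / (2 * \<sigma>\<^sup>2 * \<kappa>))))"
    by (intro add_mono decoupled_tail[OF i sub t \<kappa>])
  also have "\<dots> = ennreal (2 * exp (- (t\<^sup>2 / (2 * \<sigma>\<^sup>2 * \<kappa>))))"
    by (simp flip: ennreal_plus)
  finally show ?thesis .
qed

lemma separation_le:
  assumes "g < k" "h < k" "g \<noteq> h"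
  shows "separation k \<theta> \<le> enorm (\<theta> g - \<theta> h)"
proof -
  let ?S = "{enorm (\<theta> g - \<theta> h) | g h. g < k \<and> h < k \<and> g \<noteq> h}"
  have "?S \<subseteq> (\<lambda>(g, h). enorm (\<theta> g - \<theta> h)) ` ({..<k} \<times> {..<k})" by auto
  then have "finite ?S" by (rule finite_subset) simp
  then show ?thesis unfolding separation_def using assms by (intro Min_le) blast+
qed

lemma prob_unlucky:
  assumes i: "i < n" and D: "0 < separation k \<theta>" and \<gamma>: "0 < \<gamma>" "\<gamma> \<le> 1" and \<rho>: "0 < \<rho>" and \<xi>: "0 < \<xi>" "64 * \<rho>\<^sup>2 \<le> \<xi>\<^sup>2"
  shows "prob (unlucky \<gamma> ((\<rho> * separation k \<theta>)\<^sup>2) (\<xi> * (separation k \<theta>)\<^sup>2 / 16) i)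
    \<le> 3 * k * exp (- (\<gamma>\<^sup>2 * (separation k \<theta>)\<^sup>2 / (8 * \<sigma>\<^sup>2)))"
proof -
  let ?D = "separation k \<theta>"
  let ?\<kappa> = "(\<rho> * ?D)\<^sup>2" and ?t = "\<xi> * ?D\<^sup>2 / 16"
  let ?e = "exp (- (\<gamma>\<^sup>2 * ?D\<^sup>2 / (8 * \<sigma>\<^sup>2)))"
  let ?H = "{h. h < k \<and> h \<noteq> z i}"
  have "?t\<^sup>2 / (2 * \<sigma>\<^sup>2 * ?\<kappa>) = (\<xi>\<^sup>2 / (64 * \<rho>\<^sup>2)) * (?D\<^sup>2 / (8 * \<sigma>\<^sup>2))"
    using D \<rho> by (simp add: power_mult_distrib power_divide) (simp add: power2_eq_square power4_eq_xxxx mult_ac)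
  also have "\<gamma>\<^sup>2 * (?D\<^sup>2 / (8 * \<sigma>\<^sup>2)) \<le> (\<xi>\<^sup>2 / (64 * \<rho>\<^sup>2)) * (?D\<^sup>2 / (8 * \<sigma>\<^sup>2))"
  proof (rule mult_right_mono)
    have "\<gamma>\<^sup>2 \<le> 1" using \<gamma> by (simp add: power_le_one)
    also have "1 \<le> \<xi>\<^sup>2 / (64 * \<rho>\<^sup>2)" using \<xi> \<rho> by (simp add: le_divide_eq)
    finally show "\<gamma>\<^sup>2 \<le> \<xi>\<^sup>2 / (64 * \<rho>\<^sup>2)" .
  qed simp
  finally have exp_le: "exp (- (?t\<^sup>2 / (2 * \<sigma>\<^sup>2 * ?\<kappa>))) \<le> ?e"
    by simp
  have al: "emeasure M (aligned ?\<kappa> ?t i h) \<le> ennreal (2 * ?e)" for h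
  proof -
    have "emeasure M (aligned ?\<kappa> ?t i h) \<le> ennreal (2 * exp (- (?t\<^sup>2 / (2 * \<sigma>\<^sup>2 * ?\<kappa>))))"
      by (rule emeasure_aligned) (use i D \<rho> \<xi> in auto)
    also have "\<dots> \<le> ennreal (2 * ?e)" using exp_le by (intro ennreal_leI) simp
    finally show ?thesis .
  qed
  have "emeasure M (unlucky \<gamma> ?\<kappa> ?t i) \<le>
      emeasure M (\<Union>h\<in>?H. towards \<gamma> i h) + emeasure M (\<Union>h<k. aligned ?\<kappa> ?t i h)"
    unfolding unlucky_def using i by (intro emeasure_subadditive sets.finite_UN towards_sets aligned_sets) auto
  also have "\<dots> \<le> (\<Sum>h\<in>?H. emeasure M (towards \<gamma> i h)) + (\<Sum>h<k. emeasure M (aligned ?\<kappa> ?t i h))"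
    using i by (intro add_mono emeasure_subadditive_finite) (auto intro: towards_sets aligned_sets)
  also have "\<dots> \<le> (\<Sum>h\<in>?H. ennreal ?e) + (\<Sum>h<k. ennreal (2 * ?e))"
  proof (intro add_mono sum_mono al)
    fix h assume h: "h \<in> ?H"
    have "?D \<le> enorm (\<theta> h - \<theta> (z i))" using h labels[OF i] by (intro separation_le) auto
    then show "emeasure M (towards \<gamma> i h) \<le> ennreal ?e"
      using emeasure_towards[OF i _ D _ \<gamma>(1)] h by simp
  qed
  also have "\<dots> \<le> (\<Sum>h<k. ennreal ?e) + (\<Sum>h<k. ennreal (2 * ?e))"
    by (intro add_mono sum_mono2) auto
  also have "\<dots> = ennreal (k * ?e + k * (2 * ?e))"
    by (simp add: ennreal_of_nat_eq_real_of_nat flip: ennreal_mult ennreal_plus)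
  also have "k * ?e + k * (2 * ?e) = 3 * k * ?e" by simp
  finally show ?thesis by (simp add: emeasure_eq_measure)
qed

lemma few_unlucky:
  fixes p r :: real
  assumes n: "0 < n" and A: "\<And>i. i < n \<Longrightarrow> A i \<in> sets M" and p: "\<And>i. i < n \<Longrightarrow> prob (A i) \<le> p" "0 < p"
  shows "prob {\<omega> \<in> space M. n * p * exp r \<le> real (card {i. i < n \<and> \<omega> \<in> A i})} \<le> exp (- r)"
    and "{\<omega> \<in> space M. n * p * exp r \<le> real (card {i. i < n \<and> \<omega> \<in> A i})} \<in> events"
proof -
  let ?f = "\<lambda>\<omega>. \<Sum>i<n. indicator (A i) \<omega> :: real"
  have f: "real (card {i. i < n \<and> \<omega> \<in> A i}) = ?f \<omega>" for \<omega>
    by (simp add: indicator_def sum_of_bool_eq[of "{..<n}"] Int_def)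
  have int: "integrable M ?f" using A by (intro Bochner_Integration.integrable_sum integrable_real_indicator)
    (auto simp: emeasure_eq_measure)
  have "prob {\<omega> \<in> space M. n * p * exp r \<le> ?f \<omega>} \<le> expectation ?f / (n * p * exp r)"
    using n p by (intro integral_Markov_inequality_measure[OF int]) (auto intro!: sum_nonneg)
  also have "expectation ?f = (\<Sum>i<n. prob (A i))"
    using A by (subst Bochner_Integration.integral_sum)
    (auto simp: emeasure_eq_measure intro!: integrable_real_indicator)
  also have "\<dots> / (n * p * exp r) \<le> (\<Sum>i<n. p) / (n * p * exp r)"
    using p by (intro divide_right_mono sum_mono) auto
  also have "\<dots> = exp (- r)" using n p by (simp add: exp_minus field_simps)
  finally show "prob {\<omega> \<in> space M. n * p * exp r \<le> real (card {i. i < n \<and> \<omega> \<in> A i})} \<le> exp (- r)"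
    unfolding f .
  show "{\<omega> \<in> space M. n * p * exp r \<le> real (card {i. i < n \<and> \<omega> \<in> A i})} \<in> events"
    unfolding f using A by (intro borel_measurable_le borel_measurable_const borel_measurable_sum borel_measurable_indicator) auto
qed

context
  fixes \<rho> m :: real
  assumes D: "0 < separation k \<theta>" and m: "0 < m" "\<And>h. h < k \<Longrightarrow> m \<le> card (cluster h)"
    and \<rho>: "0 < \<rho>" "k * noise_norm\<^sup>2 \<le> \<rho>\<^sup>2 * m * (separation k \<theta>)\<^sup>2"
begin

lemma tame_clusters:
  assumes "\<omega> \<in> tame_noise"
  shows "separated_clusters n k z (\<lambda>h. embed (\<theta> h)) (\<lambda>i. embed (w i \<omega>)) noise_norm (separation k \<theta>) m \<rho>"
proof
  show "separation k \<theta> \<le> norm (embed (\<theta> g) - embed (\<theta> h))" if "g < k" "h < k" "g \<noteq> h" for g h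
    using separation_le[OF that] centers[OF that(1)] centers[OF that(2)] by (simp flip: embed_diff add: norm_embed)
  show "operator_bound n noise_norm (\<lambda>i. embed (w i \<omega>))" by (rule tame_noise_operator_bound[OF assms])
qed (use labels D m \<rho> two_clusters in \<open>auto simp: cluster_def\<close>)

text \<open>
  A point of cluster \<open>h\<close> contributes at most \<open>noise_norm\<^sup>2 / m \<le> \<rho>\<^sup>2 * (separation k \<theta>)\<^sup>2\<close> to the inner product of
  its noise with the mean noise of \<open>h\<close>, which is at most half of the threshold in \<open>bad\<close>.
\<close>

lemma bad_unlucky:
  assumes \<omega>: "\<omega> \<in> tame_noise" and \<xi>: "16 * \<rho>\<^sup>2 \<le> \<xi>"
  shows "separated_clusters.bad n k z (\<lambda>h. embed (\<theta> h)) (\<lambda>i. embed (w i \<omega>)) (separation k \<theta>) \<eta> \<xi> \<subseteq>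
    {i. i < n \<and> \<omega> \<in> unlucky (1 - 2 * \<eta> - \<xi>) ((\<rho> * separation k \<theta>)\<^sup>2) (\<xi> * (separation k \<theta>)\<^sup>2 / 16) i}"
proof
  let ?D = "separation k \<theta>" and ?w = "\<lambda>i. embed (w i \<omega>)"
  interpret sc: separated_clusters n k z "\<lambda>h. embed (\<theta> h)" ?w noise_norm ?D m \<rho>
    by (rule tame_clusters[OF \<omega>])
  have sp: "\<omega> \<in> space M" using \<omega> by (simp add: tame_noise_def)
  have T: "sc.T h = cluster h" for h by (simp add: sc.T_def cluster_def)
  fix i assume bad: "i \<in> sc.bad \<eta> \<xi>"
  then have i: "i < n" by (simp add: sc.bad_def)
  have wi: "w i' \<omega> \<in> carrier_vec d" if "i' < n" for i' by (rule noise_carrier[OF that sp])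
  have inner_w: "inner (?w i) (row_seq d a) = (\<Sum>j<d. a j * w i \<omega> $ j)" for a
    using row_seq_vec_index[OF wi[OF i]] by (simp add: inner_row_seq mult.commute)
  consider h where "h < k" "h \<noteq> z i"
      "(1 - 2 * \<eta> - \<xi>) * (norm (embed (\<theta> h) - embed (\<theta> (z i))))\<^sup>2 / 2 \<le> inner (?w i) (embed (\<theta> h) - embed (\<theta> (z i)))"
    | h where "h < k" "\<xi> * ?D\<^sup>2 / 8 \<le> \<bar>inner (?w i) (sc.mean_noise h)\<bar>"
    using bad unfolding sc.bad_def by blast
  then have "\<omega> \<in> unlucky (1 - 2 * \<eta> - \<xi>) ((\<rho> * ?D)\<^sup>2) (\<xi> * ?D\<^sup>2 / 16) i"
  proof cases
    case 1
    have e: "embed (\<theta> h) - embed (\<theta> (z i)) = embed (\<theta> h - \<theta> (z i))"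
      using centers[OF 1(1)] centers[OF labels[OF i]] by (simp add: embed_diff)
    have "\<theta> h - \<theta> (z i) \<in> carrier_vec d" using centers[OF 1(1)] centers[OF labels[OF i]] by simp
    then have "inner (?w i) (embed (\<theta> h - \<theta> (z i))) = (\<Sum>j<d. (\<theta> h - \<theta> (z i)) $ j * w i \<omega> $ j)"
      by (simp only: row_seq_vec_index inner_w)
    then have "\<omega> \<in> towards (1 - 2 * \<eta> - \<xi>) i h"
      using 1(3) sp by (simp add: towards_def e norm_embed)
    then show ?thesis using 1 by (auto simp: unlucky_def)
  next
    case 2
    let ?A = "cluster h - {i}" and ?c = "real (card (cluster h))"
    let ?v = "row_seq d (other_mean i h \<omega>)"
    have c: "0 < ?c" "m \<le> ?c" using sc.card_T_pos[OF 2(1)] m(2)[OF 2(1)] by (simp_all add: T)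
    have v: "?c *\<^sub>R ?v = sum ?w ?A"
    proof (rule fin_seq_eqI)
      fix j
      have dim: "dim_vec (w i' \<omega>) = d" if "i' \<in> ?A" for i' using wi[of i'] that by (simp add: cluster_def)
      show "coord (?c *\<^sub>R ?v) j = coord (sum ?w ?A) j"
        using c by (simp add: coord_sum scaleR_fin_seq.rep_eq row_seq_def embed.rep_eq other_mean_def dim)
    qed
    have "?c * norm ?v = norm (sum ?w ?A)" unfolding v[symmetric] by simp
    also have "\<dots> \<le> noise_norm * sqrt (card ?A)"
      by (rule operator_bound_subset[OF sc.noise]) (auto simp: cluster_def)
    also have "\<dots> \<le> noise_norm * sqrt ?c"
      using sc.B_nonneg by (intro mult_left_mono real_sqrt_le_mono) (auto simp: cluster_def intro!: card_mono)
    finally have "(?c * norm ?v)\<^sup>2 \<le> (noise_norm * sqrt ?c)\<^sup>2" using c by (intro power_mono) auto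
    moreover have "(?c * norm ?v)\<^sup>2 = ?c * (?c * (norm ?v)\<^sup>2)" by (simp add: power2_eq_square)
    moreover have "(noise_norm * sqrt ?c)\<^sup>2 = ?c * noise_norm\<^sup>2" by (simp add: power_mult_distrib)
    ultimately have "?c * (?c * (norm ?v)\<^sup>2) \<le> ?c * noise_norm\<^sup>2" by (simp only:)
    then have "?c * (norm ?v)\<^sup>2 \<le> noise_norm\<^sup>2" using c by (simp only: mult_le_cancel_left_pos)
    then have "?c * (norm ?v)\<^sup>2 \<le> \<rho>\<^sup>2 * m * ?D\<^sup>2" using sc.B_sq_le by linarith
    also have "\<dots> \<le> \<rho>\<^sup>2 * ?c * ?D\<^sup>2" using c by (intro mult_right_mono mult_left_mono) auto
    also have "\<dots> = ?c * (\<rho> * ?D)\<^sup>2" by (simp add: power_mult_distrib mult_ac)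
    finally have "(norm ?v)\<^sup>2 \<le> (\<rho> * ?D)\<^sup>2" using c by (simp only: mult_le_cancel_left_pos)
    then have small: "(\<Sum>j<d. (other_mean i h \<omega> j)\<^sup>2) \<le> (\<rho> * ?D)\<^sup>2"
      by (simp add: norm_row_seq L2_set_def sum_nonneg)
    have self: "(norm (?w i))\<^sup>2 \<le> ?c * (\<xi> * ?D\<^sup>2 / 16)"
    proof -
      have "norm (sum ?w {i}) \<le> noise_norm * sqrt (card {i})"
        by (rule operator_bound_subset[OF sc.noise]) (use i in auto)
      then have "(norm (?w i))\<^sup>2 \<le> noise_norm\<^sup>2" by (intro power_mono) auto
      also have "\<dots> \<le> \<rho>\<^sup>2 * m * ?D\<^sup>2" by (rule sc.B_sq_le)
      also have "\<dots> \<le> \<xi> / 16 * ?c * ?D\<^sup>2"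
        using c m \<xi> order_trans[OF _ \<xi>, of 0] by (intro mult_right_mono mult_mono) auto
      finally show ?thesis by (simp add: mult_ac)
    qed
    let ?s = "if i \<in> cluster h then (norm (?w i))\<^sup>2 else 0"
    have "?c *\<^sub>R sc.mean_noise h = sum ?w (cluster h)" using sc.card_mean_noise[OF 2(1)] by (simp add: T)
    also have "\<dots> = ?c *\<^sub>R ?v + (if i \<in> cluster h then ?w i else 0)"
    proof (cases "i \<in> cluster h")
      case True
      have "finite (cluster h)" by (simp add: cluster_def)
      from sum.remove[OF this True, of ?w] show ?thesis using True unfolding v by (simp add: add.commute)
    qed (simp add: v)
    finally have "inner (?w i) (?c *\<^sub>R sc.mean_noise h) = inner (?w i) (?c *\<^sub>R ?v + (if i \<in> cluster h then ?w i else 0))"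
      by (rule arg_cong)
    then have eq: "?c * inner (?w i) (sc.mean_noise h) = ?c * inner (?w i) ?v + ?s"
      by (simp add: inner_add_right power2_norm_eq_inner split: if_splits)
    have "?c * \<bar>inner (?w i) (sc.mean_noise h)\<bar> = \<bar>?c * inner (?w i) (sc.mean_noise h)\<bar>"
      by (simp add: abs_mult)
    also have "\<dots> \<le> \<bar>?c * inner (?w i) ?v\<bar> + \<bar>?s\<bar>" unfolding eq by (rule abs_triangle_ineq)
    also have "\<dots> \<le> ?c * \<bar>inner (?w i) ?v\<bar> + (norm (?w i))\<^sup>2" by (simp add: abs_mult)
    finally have "?c * \<bar>inner (?w i) (sc.mean_noise h)\<bar> \<le> ?c * \<bar>inner (?w i) ?v\<bar> + (norm (?w i))\<^sup>2" .
    then have "?c * \<bar>inner (?w i) (sc.mean_noise h)\<bar> \<le> ?c * (\<bar>inner (?w i) ?v\<bar> + \<xi> * ?D\<^sup>2 / 16)"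
      using self by (simp add: distrib_left)
    then have "\<bar>inner (?w i) (sc.mean_noise h)\<bar> \<le> \<bar>inner (?w i) ?v\<bar> + \<xi> * ?D\<^sup>2 / 16"
      using c by (simp only: mult_le_cancel_left_pos)
    then have "\<xi> * ?D\<^sup>2 / 16 \<le> \<bar>inner (?w i) ?v\<bar>" using 2(2) by linarith
    then have "\<omega> \<in> aligned ((\<rho> * ?D)\<^sup>2) (\<xi> * ?D\<^sup>2 / 16) i h"
      using small sp by (simp add: aligned_def inner_w)
    then show ?thesis using 2 by (auto simp: unlucky_def)
  qed
  then show "i \<in> {i. i < n \<and> \<omega> \<in> unlucky (1 - 2 * \<eta> - \<xi>) ((\<rho> * ?D)\<^sup>2) (\<xi> * ?D\<^sup>2 / 16) i}"
    using i by simp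
qed

text \<open>
  The tolerance \<open>\<xi>\<close> of the bad points is set to \<open>sqrt \<rho>\<close>: it has to vanish with \<open>\<rho>\<close> in order not to affect the
  exponent, but it must dominate \<open>\<rho>\<close> for alignment with a mean noise vector to be negligible.
\<close>

theorem spectral_lloyd_loss:
  fixes C K \<gamma> r p :: real
  defines "\<gamma> \<equiv> 1 - 2 * (K * \<rho>) - sqrt \<rho>" and "r \<equiv> separation k \<theta> / \<sigma>"
  defines "p \<equiv> 3 * k * exp (- (\<gamma>\<^sup>2 * r\<^sup>2 / 8))"
  assumes n: "2 \<le> n" and K: "18 \<le> K" "20 * (1 + \<bar>C\<bar>) \<le> K\<^sup>2" "K * \<rho> \<le> 1 / 8" and \<rho>_small: "\<rho> \<le> 1 / 64"
    and few: "n * p * exp r \<le> m / 4"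
  shows "\<exists>E\<in>events. prob E \<ge> 1 - exp (- real n) - exp (- r) \<and>
    (\<forall>\<omega>\<in>E. \<forall>zh. spectral_lloyd_output C n d k (observation \<theta> z w \<omega>) (nat \<lceil>4 * ln n\<rceil>) zh \<longrightarrow>
       misclust_loss n k zh z \<le> 3 * p * exp r)"
proof -
  let ?D = "separation k \<theta>" and ?\<xi> = "sqrt \<rho>"
  let ?A = "unlucky \<gamma> ((\<rho> * ?D)\<^sup>2) (?\<xi> * ?D\<^sup>2 / 16)"
  define F where "F = {\<omega> \<in> space M. n * p * exp r \<le> real (card {i. i < n \<and> \<omega> \<in> ?A i})}"
  have n0: "0 < n" using n by simp
  have \<rho>2: "\<rho>\<^sup>2 \<le> \<rho> / 64" using mult_left_mono[OF \<rho>_small, of \<rho>] \<rho> by (simp add: power2_eq_square)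
  have \<xi>_sq: "?\<xi>\<^sup>2 = \<rho>" using \<rho> by simp
  have \<xi>_pos: "0 < ?\<xi>" using \<rho> by simp
  have \<xi>_le: "?\<xi> \<le> 1 / 8"
  proof -
    have "?\<xi> \<le> sqrt ((1 / 8)\<^sup>2)"
      by (rule real_sqrt_le_mono) (use \<rho>_small in \<open>simp add: power2_eq_square\<close>)
    then show ?thesis by (simp only: real_sqrt_abs abs_divide abs_one abs_numeral)
  qed
  have \<rho>_\<xi>: "\<rho> \<le> ?\<xi> / 8" using mult_left_mono[OF \<xi>_le, of ?\<xi>] \<xi>_pos \<rho> by simp
  have \<gamma>: "0 < \<gamma>" "\<gamma> \<le> 1"
    using K \<xi>_le \<rho> \<xi>_pos mult_nonneg_nonneg[of K \<rho>] unfolding \<gamma>_def by linarith+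
  have p: "prob (?A i) \<le> p" if "i < n" for i
  proof -
    have "\<gamma>\<^sup>2 * ?D\<^sup>2 / (8 * \<sigma>\<^sup>2) = \<gamma>\<^sup>2 * r\<^sup>2 / 8" by (simp add: r_def power_divide)
    moreover have "64 * \<rho>\<^sup>2 \<le> ?\<xi>\<^sup>2" unfolding \<xi>_sq using \<rho>2 by simp
    ultimately show ?thesis using prob_unlucky[OF that D \<gamma> \<rho>(1) \<xi>_pos] unfolding p_def by (simp only:)
  qed
  have p_pos: "0 < p" using two_clusters by (simp add: p_def)
  have F_prob: "prob F \<le> exp (- r)"
    unfolding F_def by (rule few_unlucky(1)[OF n0 unlucky_sets p p_pos])
  have F_sets: "F \<in> events"
    unfolding F_def by (rule few_unlucky(2)[OF n0 unlucky_sets p p_pos])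
  let ?E = "tame_noise - F"
  have "prob (space M - tame_noise) \<le> exp (- real n)"
    using tame_noise_prob[OF n0] by (simp add: emeasure_eq_measure)
  then have "prob tame_noise \<ge> 1 - exp (- real n)"
    using prob_compl[OF tame_noise_sets] by simp
  moreover have "prob tame_noise \<le> prob (?E \<union> F)"
    by (rule finite_measure_mono) (use tame_noise_sets F_sets in auto)
  moreover have "prob (?E \<union> F) \<le> prob ?E + prob F"
    by (rule measure_Un_le) (use tame_noise_sets F_sets in auto)
  ultimately have prob_E: "prob ?E \<ge> 1 - exp (- real n) - exp (- r)" using F_prob by linarith
  have "misclust_loss n k zh z \<le> 3 * p * exp r"
    if \<omega>: "\<omega> \<in> ?E" and algo: "spectral_lloyd_output C n d k (observation \<theta> z w \<omega>) (nat \<lceil>4 * ln n\<rceil>) zh" for \<omega> zh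
  proof -
    let ?bad = "separated_clusters.bad n k z (\<lambda>h. embed (\<theta> h)) (\<lambda>i. embed (w i \<omega>)) ?D (K * \<rho>) ?\<xi>"
    have tame: "\<omega> \<in> tame_noise" and sp: "\<omega> \<in> space M" and notF: "\<omega> \<notin> F"
      using \<omega> by (auto simp: tame_noise_def)
    have "card ?bad \<le> card {i. i < n \<and> \<omega> \<in> ?A i}"
      unfolding \<gamma>_def using \<rho>2 \<rho>_\<xi> \<xi>_pos \<rho>_small
      by (intro card_mono bad_unlucky[OF tame]) auto
    moreover have "real (card {i. i < n \<and> \<omega> \<in> ?A i}) < n * p * exp r" using notF sp unfolding F_def by (simp add: not_le)
    ultimately have bad: "card ?bad \<le> n * p * exp r" by linarith
    have "misclust_loss n k zh z \<le> 3 * card ?bad / n"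
    proof (rule spectral_lloyd_deterministic[OF tame_clusters[OF tame] centers _ _ n K \<xi>_pos])
      show "spectral_lloyd_output C n d k (\<lambda>i. \<theta> (z i) + w i \<omega>) (nat \<lceil>4 * ln n\<rceil>) zh"
        using algo by (simp add: observation_def[abs_def])
      show "w i \<omega> \<in> carrier_vec d" if "i < n" for i by (rule noise_carrier[OF that sp])
      have \<rho>1: "\<rho>\<^sup>2 \<le> 1 / 64 * (1 / 64)"
        using \<rho> \<rho>_small unfolding power2_eq_square by (intro mult_mono) auto
      have "(K * \<rho>)\<^sup>2 \<le> (1 / 8)\<^sup>2" using K \<rho> by (intro power_mono) auto
      then have "256 * (K * \<rho>)\<^sup>2 \<le> 4" by (simp only: power_divide) simp
      then have "256 * (K * \<rho>)\<^sup>2 * \<rho>\<^sup>2 \<le> 4 * \<rho>\<^sup>2" by (rule mult_right_mono) simp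
      then show "256 * (K * \<rho>)\<^sup>2 * \<rho>\<^sup>2 \<le> ?\<xi>\<^sup>2" using \<rho>2 \<rho> \<xi>_sq by linarith
      have "\<rho> ^ 4 = \<rho>\<^sup>2 * \<rho>\<^sup>2" by (simp add: power4_eq_xxxx power2_eq_square)
      also have "\<dots> \<le> 1 / 64 * (1 / 64) * (\<rho> / 64)" using \<rho>1 \<rho>2 \<rho> by (intro mult_mono) auto
      finally show "110592 * \<rho> ^ 4 \<le> ?\<xi>\<^sup>2" using \<rho> \<xi>_sq by simp
      show "real (card ?bad) \<le> m / 4" using bad few by linarith
    qed
    also have "\<dots> \<le> 3 * (n * p * exp r) / n" using bad by (intro divide_right_mono) auto
    finally show ?thesis using n0 by simp
  qed
  moreover have "?E \<in> events" using tame_noise_sets F_sets by auto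
  ultimately show ?thesis using prob_E by blast
qed

end

end

section \<open>The signal-to-noise ratio and the exponent\<close>

context sub_gaussian_mixture
begin

lemma separation_nonneg: "0 \<le> separation k \<theta>"
proof -
  let ?S = "{enorm (\<theta> g - \<theta> h) | g h. g < k \<and> h < k \<and> g \<noteq> h}"
  have "?S \<subseteq> (\<lambda>(g, h). enorm (\<theta> g - \<theta> h)) ` ({..<k} \<times> {..<k})" by auto
  then have fin: "finite ?S" by (rule finite_subset) simp
  have "enorm (\<theta> 0 - \<theta> 1) \<in> ?S" using two_clusters by (intro CollectI exI[of _ 0] exI[of _ 1]) auto
  then have "?S \<noteq> {}" by blast
  from Min_in[OF fin this] have "separation k \<theta> \<in> ?S" unfolding separation_def .
  then show ?thesis by (auto simp: norm_embed[symmetric])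
qed

lemma min_cluster:
  shows "h < k \<Longrightarrow> 0 < n \<Longrightarrow> min_cluster_frac n k z * n \<le> card (cluster h)"
    and "0 \<le> min_cluster_frac n k z" and "min_cluster_frac n k z \<le> 1"
proof -
  let ?m = "MIN h\<in>{..<k}. card {i. i < n \<and> z i = h}"
  have le: "?m \<le> card {i. i < n \<and> z i = h}" if "h < k" for h
    using that by (intro Min_le) auto
  show "min_cluster_frac n k z * n \<le> card (cluster h)" if "h < k" "0 < n"
    using le[OF that(1)] that(2) by (simp add: min_cluster_frac_def cluster_def)
  show "0 \<le> min_cluster_frac n k z" by (simp add: min_cluster_frac_def)
  have "?m \<le> card {i. i < n \<and> z i = 0}" using two_clusters by (intro le) simp
  also have "\<dots> \<le> card {..<n}" by (rule card_mono) auto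
  finally show "min_cluster_frac n k z \<le> 1" by (simp add: min_cluster_frac_def divide_le_eq)
qed

text \<open>
  The \<open>o(1)\<close> of the exponent.  The square is due to the reduced threshold in \<open>bad\<close>, the term \<open>8 / r\<close> to the
  factor \<open>exp r\<close> in Markov's inequality, and the logarithm to the factor \<open>9 * k = 3 * (3 * k)\<close>: three errors for
  a bad point, and \<open>3 * k\<close> tail events for each point.
\<close>

definition exponent_loss :: "real \<Rightarrow> real \<Rightarrow> real" where
  "exponent_loss K \<rho> = (1 - 2 * (K * \<rho>) - sqrt \<rho>)\<^sup>2 - 1
     - 8 / (separation k \<theta> / \<sigma>) - 8 * ln (9 * k) / (separation k \<theta> / \<sigma>)\<^sup>2"

context
  fixes S \<rho> r K C :: real
  assumes n: "2 \<le> n" and S_def: "S = snr_k n d k \<sigma> \<theta> z" and S: "0 < S"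
    and \<rho>_def: "\<rho> = sqrt (224 * k) / S" and r_def: "r = separation k \<theta> / \<sigma>"
begin

lemma signal_positive: "0 < separation k \<theta>" "0 < min_cluster_frac n k z" "0 < r" "0 < \<rho>"
proof -
  have "separation k \<theta> \<noteq> 0" "min_cluster_frac n k z \<noteq> 0"
    using S unfolding S_def snr_k_def by auto
  then show "0 < separation k \<theta>" "0 < min_cluster_frac n k z"
    using separation_nonneg min_cluster(2) by auto
  then show "0 < r" using sigma_pos by (simp add: r_def)
  show "0 < \<rho>" using two_clusters S by (simp add: \<rho>_def)
qed

lemma S_sq: "S\<^sup>2 * (1 + real k * real d / real n) = r\<^sup>2 * min_cluster_frac n k z"
proof -
  have pos: "0 < 1 + real k * real d / real n" by (simp add: add_pos_nonneg)
  have "S\<^sup>2 = r\<^sup>2 * (min_cluster_frac n k z / (1 + real k * real d / real n))"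
  proof -
    have "(sqrt (min_cluster_frac n k z / (1 + real k * real d / real n)))\<^sup>2 =
        min_cluster_frac n k z / (1 + real k * real d / real n)"
      using signal_positive(2) pos by (intro real_sqrt_pow2 divide_nonneg_nonneg less_imp_le)
    then show ?thesis unfolding S_def snr_k_def r_def by (simp only: power_mult_distrib)
  qed
  then show ?thesis using pos by simp
qed

lemma \<rho>_sq: "\<rho>\<^sup>2 * S\<^sup>2 = 224 * real k"
  using S by (simp add: \<rho>_def power_divide)

text \<open>
  The dimension enters the squared noise level as \<open>n + d\<close> and the squared signal-to-noise ratio as the divisor
  \<open>1 + k * d / n\<close>, and \<open>n + d \<le> n * (1 + k * d / n)\<close>.
\<close>

lemma noise_vs_signal:
  "k * noise_norm\<^sup>2 \<le> \<rho>\<^sup>2 * (min_cluster_frac n k z * n) * (separation k \<theta>)\<^sup>2"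
proof -
  have sep: "(separation k \<theta>)\<^sup>2 = \<sigma>\<^sup>2 * r\<^sup>2" using sigma_pos by (simp add: r_def power_divide)
  have k1: "1 * real d \<le> real k * real d" using two_clusters by (intro mult_right_mono) auto
  have "k * noise_norm\<^sup>2 = 224 * k * \<sigma>\<^sup>2 * (real n + real d)" by (simp add: noise_norm_def)
  also have "\<dots> \<le> 224 * k * \<sigma>\<^sup>2 * (real n + real k * real d)" using k1 by (intro mult_left_mono) auto
  also have "\<dots> = (224 * real k) * \<sigma>\<^sup>2 * (real n * (1 + real k * real d / real n))"
    using n by (simp add: distrib_left)
  also have "\<dots> = (\<rho>\<^sup>2 * S\<^sup>2) * \<sigma>\<^sup>2 * (real n * (1 + real k * real d / real n))"
    by (simp only: \<rho>_sq)
  also have "\<dots> = \<rho>\<^sup>2 * \<sigma>\<^sup>2 * real n * (S\<^sup>2 * (1 + real k * real d / real n))"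
    by (simp only: mult_ac)
  also have "\<dots> = \<rho>\<^sup>2 * (min_cluster_frac n k z * n) * (separation k \<theta>)\<^sup>2"
    unfolding S_sq sep by simp
  finally show ?thesis .
qed

lemma S_le: "S\<^sup>2 \<le> r\<^sup>2 * min_cluster_frac n k z" "S \<le> r"
proof -
  have "S\<^sup>2 * 1 \<le> S\<^sup>2 * (1 + real k * real d / real n)" by (intro mult_left_mono) auto
  then show *: "S\<^sup>2 \<le> r\<^sup>2 * min_cluster_frac n k z" unfolding S_sq by simp
  also have "\<dots> \<le> r\<^sup>2 * 1" using min_cluster(3) by (intro mult_left_mono) auto
  finally have "S\<^sup>2 \<le> r\<^sup>2" by simp
  then show "S \<le> r" by (rule power2_le_imp_le) (use signal_positive(3) in simp)
qed

text \<open>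
  Every term is controlled by \<open>\<rho>\<close> alone, since \<open>1 \<le> r * \<rho>\<close> and \<open>224 * k \<le> \<rho>\<^sup>2 * r\<^sup>2\<close>.
\<close>

lemma exponent_loss_small:
  assumes K: "0 \<le> K" "K * \<rho> \<le> 1 / 16" and \<rho>: "\<rho> \<le> 1 / 64"
  shows "\<bar>exponent_loss K \<rho>\<bar> \<le> 4 * (K * \<rho>) + 2 * sqrt \<rho> + 8 * \<rho> + \<rho>\<^sup>2"
proof -
  let ?x = "2 * (K * \<rho>) + sqrt \<rho>"
  have x: "0 \<le> ?x" using K signal_positive(4) by simp
  have r\<rho>: "1 \<le> r * \<rho>"
  proof -
    have "1 \<le> sqrt (224 * k)" using two_clusters by simp
    also have "\<dots> = S * \<rho>" using S by (simp add: \<rho>_def)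
    also have "\<dots> \<le> r * \<rho>" using S_le(2) signal_positive(4) by (intro mult_right_mono) auto
    finally show ?thesis .
  qed
  then have 1: "1 / r \<le> \<rho>" using signal_positive(3) by (simp only: pos_divide_le_eq mult.commute[of \<rho>])
  have "ln (9 * k) \<le> 9 * real k" using two_clusters ln_le_minus_one[of "9 * real k"] by simp
  also have "\<dots> = 9 / 224 * (\<rho>\<^sup>2 * S\<^sup>2)" unfolding \<rho>_sq by simp
  also have "\<dots> \<le> 9 / 224 * (\<rho>\<^sup>2 * r\<^sup>2)"
    using S_le(2) S by (intro mult_left_mono power_mono) auto
  finally have ln_le: "8 * ln (9 * k) \<le> 72 / 224 * \<rho>\<^sup>2 * r\<^sup>2" by simp
  have "0 < r\<^sup>2" using signal_positive(3) by simp
  with ln_le have 2: "8 * ln (9 * k) / r\<^sup>2 \<le> 72 / 224 * \<rho>\<^sup>2"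
    by (simp only: pos_divide_le_eq)
  have 3: "0 \<le> 8 * ln (9 * k) / r\<^sup>2" using two_clusters by simp
  have "(1 - 2 * (K * \<rho>) - sqrt \<rho>)\<^sup>2 - 1 = - 2 * ?x + ?x\<^sup>2" by (simp add: power2_eq_square algebra_simps)
  moreover have "?x\<^sup>2 \<le> 2 * ?x"
  proof -
    have "sqrt \<rho> \<le> 1" using \<rho> by simp
    then have "?x \<le> 2" using K by linarith
    from mult_right_mono[OF this x] show ?thesis by (simp add: power2_eq_square)
  qed
  moreover have "0 \<le> ?x\<^sup>2" by simp
  ultimately have Q: "- (2 * ?x) \<le> (1 - 2 * (K * \<rho>) - sqrt \<rho>)\<^sup>2 - 1" "(1 - 2 * (K * \<rho>) - sqrt \<rho>)\<^sup>2 - 1 \<le> 0"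
    by linarith+
  have 4: "8 / r \<le> 8 * \<rho>" "0 \<le> 8 / r" using 1 signal_positive(3) by auto
  have bound: "\<bar>Q - R - L\<bar> \<le> 2 * ?x + 8 * \<rho> + \<rho>\<^sup>2"
    if "- (2 * ?x) \<le> Q" "Q \<le> 0" "R \<le> 8 * \<rho>" "0 \<le> R" "L \<le> 72 / 224 * \<rho>\<^sup>2" "0 \<le> L" for Q R L
    using that x zero_le_power2[of \<rho>] by linarith
  have "\<bar>exponent_loss K \<rho>\<bar> \<le> 2 * ?x + 8 * \<rho> + \<rho>\<^sup>2"
    unfolding exponent_loss_def r_def[symmetric] by (rule bound[OF Q 4 2 3])
  then show ?thesis by simp
qed

text \<open>
  That the bad points are few in comparison with the smallest cluster is automatic: \<open>p * exp r\<close> is \<open>k\<close>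
  times a quantity exponentially small in \<open>r\<close>, whereas \<open>k\<close> divided by the smallest cluster fraction is at
  most \<open>r\<^sup>2\<close>.
\<close>

lemma spectral_lloyd_rate:
  assumes K: "18 \<le> K" "20 * (1 + \<bar>C\<bar>) \<le> K\<^sup>2" "K * \<rho> \<le> 1 / 16" and \<rho>: "\<rho> \<le> 1 / 64"
  shows "\<exists>E\<in>events. prob E > 1 - 5 / n - 2 * exp (- r) \<and>
    (\<forall>\<omega>\<in>E. \<forall>zh. spectral_lloyd_output C n d k (observation \<theta> z w \<omega>) (nat \<lceil>4 * ln n\<rceil>) zh \<longrightarrow>
       misclust_loss n k zh z \<le> exp (- (1 + exponent_loss K \<rho>) * r\<^sup>2 / 8))"
proof -
  let ?\<alpha> = "min_cluster_frac n k z"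
  define \<gamma> where "\<gamma> = 1 - 2 * (K * \<rho>) - sqrt \<rho>"
  define p where "p = 3 * k * exp (- (\<gamma>\<^sup>2 * r\<^sup>2 / 8))"
  have k0: "0 < real k" using two_clusters by simp
  have "sqrt \<rho> \<le> sqrt ((1 / 8)\<^sup>2)" by (rule real_sqrt_le_mono) (use \<rho> in \<open>simp add: power2_eq_square\<close>)
  then have "sqrt \<rho> \<le> 1 / 8" by (simp only: real_sqrt_abs abs_divide abs_one abs_numeral)
  then have "3 / 4 \<le> \<gamma>" using K by (simp add: \<gamma>_def)
  then have "(3 / 4)\<^sup>2 \<le> \<gamma>\<^sup>2" by (intro power_mono) auto
  then have \<gamma>: "1 / 2 \<le> \<gamma>\<^sup>2" by (simp add: power2_eq_square)
  have r: "64 \<le> r"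
  proof -
    have "64 * \<rho> \<le> 1" using \<rho> by simp
    also have "1 \<le> sqrt (224 * k)" using two_clusters by simp
    also have "\<dots> = S * \<rho>" using S by (simp add: \<rho>_def)
    finally have "64 \<le> S" using signal_positive(4) by simp
    then show ?thesis using S_le(2) by linarith
  qed
  have few: "n * p * exp r \<le> ?\<alpha> * n / 4"
  proof -
    have "64 * r \<le> r * r" using r by (intro mult_right_mono) auto
    then have "4 * r \<le> r\<^sup>2 / 16" by (simp add: power2_eq_square)
    also have "\<dots> \<le> \<gamma>\<^sup>2 * r\<^sup>2 / 8" using mult_right_mono[OF \<gamma>, of "r\<^sup>2"] by simp
    finally have "p * exp r \<le> 3 * k * exp (- (4 * r)) * exp r"
      unfolding p_def using k0 by (intro mult_right_mono mult_left_mono) auto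
    also have "\<dots> = 3 * k * exp (- (3 * r))" by (simp flip: exp_add)
    also have "\<dots> \<le> 3 * (?\<alpha> * r\<^sup>2) * exp (- (3 * r))"
    proof -
      have "\<rho>\<^sup>2 \<le> 1" using \<rho> signal_positive(4) by (simp add: power_le_one)
      then have "\<rho>\<^sup>2 * S\<^sup>2 \<le> 1 * (r\<^sup>2 * ?\<alpha>)" using S_le(1) by (intro mult_mono) auto
      then have "real k \<le> ?\<alpha> * r\<^sup>2" unfolding \<rho>_sq using k0 by (simp add: mult.commute)
      then show ?thesis by (intro mult_right_mono mult_left_mono) auto
    qed
    also have "\<dots> = 3 * ?\<alpha> * (r\<^sup>2 * exp (- (3 * r)))" by simp
    also have "\<dots> \<le> 3 * ?\<alpha> * (1 / 12)"
    proof (rule mult_left_mono)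
      have "r \<le> exp r" using exp_ge_add_one_self[of r] by linarith
      then have "r\<^sup>2 \<le> (exp r)\<^sup>2" using r by (intro power_mono) auto
      then have "r\<^sup>2 * exp (- (3 * r)) \<le> (exp r)\<^sup>2 * exp (- (3 * r))" by (intro mult_right_mono) auto
      also have "\<dots> = exp (- r)" by (simp add: power2_eq_square flip: exp_add)
      also have "\<dots> \<le> 1 / 12"
      proof -
        have "12 \<le> exp r" using exp_ge_add_one_self[of r] r by linarith
        then show ?thesis by (simp add: exp_minus divide_simps)
      qed
      finally show "r\<^sup>2 * exp (- (3 * r)) \<le> 1 / 12" .
    qed (use signal_positive(2) in auto)
    finally have "p * exp r \<le> ?\<alpha> / 4" by simp
    then have "n * (p * exp r) \<le> n * (?\<alpha> / 4)" by (intro mult_left_mono) auto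
    then show ?thesis by (simp add: mult_ac)
  qed
  have m: "0 < ?\<alpha> * n" using signal_positive(2) n by simp
  have K8: "K * \<rho> \<le> 1 / 8" using K by simp
  have n0: "0 < n" using n by simp
  obtain E where E: "E \<in> events" "prob E \<ge> 1 - exp (- real n) - exp (- r)"
    "\<And>\<omega> zh. \<omega> \<in> E \<Longrightarrow> spectral_lloyd_output C n d k (observation \<theta> z w \<omega>) (nat \<lceil>4 * ln n\<rceil>) zh \<Longrightarrow>
       misclust_loss n k zh z \<le> 3 * p * exp r"
    using spectral_lloyd_loss[OF signal_positive(1) m min_cluster(1)[OF _ n0] signal_positive(4) noise_vs_signal n K(1,2) K8 \<rho>]
      few unfolding p_def \<gamma>_def r_def by blast
  have "exp (- real n) < 5 / n"
  proof -
    have "exp (- real n) * n < exp (- real n) * exp n"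
    proof (rule mult_strict_left_mono)
      show "real n < exp n" using exp_ge_add_one_self[of n] by linarith
    qed simp
    also have "\<dots> = 1" by (simp flip: exp_add)
    finally show ?thesis using n by (simp add: less_divide_eq)
  qed
  then have "prob E > 1 - 5 / n - 2 * exp (- r)" using E(2) exp_gt_zero[of "- r"] by linarith
  moreover have "3 * p * exp r = exp (- (1 + exponent_loss K \<rho>) * r\<^sup>2 / 8)"
  proof -
    have r0: "r \<noteq> 0" using r by simp
    have "(8 / r) * r\<^sup>2 = 8 * r" "(8 * ln (9 * k) / r\<^sup>2) * r\<^sup>2 = 8 * ln (9 * k)"
      using r0 by (simp_all add: power2_eq_square)
    then have "(1 + exponent_loss K \<rho>) * r\<^sup>2 = \<gamma>\<^sup>2 * r\<^sup>2 - 8 * r - 8 * ln (9 * k)"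
      unfolding exponent_loss_def r_def[symmetric] \<gamma>_def[symmetric] by (simp only: left_diff_distrib distrib_right)
    then have "- (1 + exponent_loss K \<rho>) * r\<^sup>2 / 8 = ln (9 * k) + - (\<gamma>\<^sup>2 * r\<^sup>2 / 8) + r" by (simp add: field_simps)
    then have "exp (- (1 + exponent_loss K \<rho>) * r\<^sup>2 / 8) = exp (ln (9 * k)) * exp (- (\<gamma>\<^sup>2 * r\<^sup>2 / 8)) * exp r"
      by (simp only: exp_add)
    then show ?thesis using k0 by (simp add: p_def)
  qed
  ultimately show ?thesis using E(1,3) by (intro bexI[of _ E]) auto
qed

end

end

theorem corollary3p1:
  fixes M :: "nat \<Rightarrow> 'a measure" and d k :: "nat \<Rightarrow> nat" and \<sigma> :: "nat \<Rightarrow> real"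
    and \<theta> :: "nat \<Rightarrow> nat \<Rightarrow> real vec" and z :: "nat \<Rightarrow> nat \<Rightarrow> nat"
    and w :: "nat \<Rightarrow> nat \<Rightarrow> 'a \<Rightarrow> real vec"
    and C :: real and zhat :: "nat \<Rightarrow> 'a \<Rightarrow> nat \<Rightarrow> nat"
  assumes model: "\<And>n. sub_gaussian_mixture (M n) n (d n) (k n) (\<sigma> n) (\<theta> n) (z n) (w n)"
    and snr: "(\<lambda>n. sqrt (real (k n))) \<in> o(\<lambda>n. snr_k n (d n) (k n) (\<sigma> n) (\<theta> n) (z n))"
    and size: "(\<lambda>n. real (k n) * ln (real n)) \<in>
                 o(\<lambda>n. real n * (min_cluster_frac n (k n) (z n))\<^sup>2)"
    and algo: "\<And>n \<omega>. \<omega> \<in> space (M n) \<Longrightarrow>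
      spectral_lloyd_output C n (d n) (k n) (observation (\<theta> n) (z n) (w n) \<omega>)
        (nat \<lceil>4 * ln (real n)\<rceil>) (zhat n \<omega>)"
  shows "\<exists>\<epsilon> :: nat \<Rightarrow> real. \<epsilon> \<longlonglongrightarrow> 0 \<and>
    (\<forall>\<^sub>F n in sequentially. \<exists>E \<in> sets (M n).
       measure (M n) E > 1 - 5 / real n - 2 * exp (- separation (k n) (\<theta> n) / \<sigma> n) \<and>
       (\<forall>\<omega>\<in>E. misclust_loss n (k n) (zhat n \<omega>) (z n) \<le>
          exp (- (1 + \<epsilon> n) * (separation (k n) (\<theta> n))\<^sup>2 / (8 * (\<sigma> n)\<^sup>2))))"
proof -
  define S where "S = (\<lambda>n. snr_k n (d n) (k n) (\<sigma> n) (\<theta> n) (z n))"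
  define \<rho> where "\<rho> = (\<lambda>n. sqrt (224 * k n) / S n)"
  define K where "K = 20 * (1 + \<bar>C\<bar>)"
  have K: "18 \<le> K" "20 * (1 + \<bar>C\<bar>) \<le> K\<^sup>2"
    using self_le_power[of K 2] by (auto simp: K_def)
  define \<epsilon> where "\<epsilon> = (\<lambda>n. sub_gaussian_mixture.exponent_loss (k n) (\<sigma> n) (\<theta> n) K (\<rho> n))"
  have "(\<lambda>n. sqrt (k n) / S n) \<longlonglongrightarrow> 0"
    using snr unfolding S_def by (rule smalloD_tendsto)
  then have "(\<lambda>n. sqrt 224 * (sqrt (k n) / S n)) \<longlonglongrightarrow> sqrt 224 * 0" by (rule tendsto_mult_left)
  then have \<rho>_0: "\<rho> \<longlonglongrightarrow> 0" by (simp add: \<rho>_def real_sqrt_mult)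
  have S_pos: "\<forall>\<^sub>F n in sequentially. 0 < S n"
    using landau_o.smallD[OF snr, of 1, simplified]
  proof (rule eventually_mono)
    fix n
    interpret sub_gaussian_mixture "M n" n "d n" "k n" "\<sigma> n" "\<theta> n" "z n" "w n" by (rule model)
    assume "sqrt (real (k n)) \<le> \<bar>snr_k n (d n) (k n) (\<sigma> n) (\<theta> n) (z n)\<bar>"
    moreover have "0 < sqrt (real (k n))" using two_clusters by simp
    ultimately have "S n \<noteq> 0" unfolding S_def by auto
    moreover have "0 \<le> S n"
      unfolding S_def snr_k_def using separation_nonneg sigma_pos min_cluster(2)
      by (intro mult_nonneg_nonneg divide_nonneg_nonneg real_sqrt_ge_zero add_nonneg_nonneg) auto
    ultimately show "0 < S n" by simp
  qed
  have "(\<lambda>n. K * \<rho> n) \<longlonglongrightarrow> K * 0" by (intro tendsto_intros \<rho>_0)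
  then have K\<rho>: "\<forall>\<^sub>F n in sequentially. K * \<rho> n < 1 / 16" by (intro order_tendstoD(2)) auto
  have \<rho>_small: "\<forall>\<^sub>F n in sequentially. \<rho> n < 1 / 64" using \<rho>_0 by (intro order_tendstoD(2)) auto
  have good: "\<forall>\<^sub>F n in sequentially. 2 \<le> n \<and> 0 < S n \<and> K * \<rho> n < 1 / 16 \<and> \<rho> n < 1 / 64"
    using S_pos K\<rho> \<rho>_small eventually_ge_at_top[of 2] by eventually_elim simp
  have "(\<lambda>n. 4 * (K * \<rho> n) + 2 * sqrt (\<rho> n) + 8 * \<rho> n + (\<rho> n)\<^sup>2) \<longlonglongrightarrow> 4 * (K * 0) + 2 * sqrt 0 + 8 * 0 + 0\<^sup>2"
    by (intro tendsto_intros \<rho>_0)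
  then have bound_0: "(\<lambda>n. 4 * (K * \<rho> n) + 2 * sqrt (\<rho> n) + 8 * \<rho> n + (\<rho> n)\<^sup>2) \<longlonglongrightarrow> 0" by simp
  have "\<forall>\<^sub>F n in sequentially. norm (\<epsilon> n) \<le> 4 * (K * \<rho> n) + 2 * sqrt (\<rho> n) + 8 * \<rho> n + (\<rho> n)\<^sup>2"
    using good
  proof (rule eventually_mono)
    fix n assume *: "2 \<le> n \<and> 0 < S n \<and> K * \<rho> n < 1 / 16 \<and> \<rho> n < 1 / 64"
    interpret sub_gaussian_mixture "M n" n "d n" "k n" "\<sigma> n" "\<theta> n" "z n" "w n" by (rule model)
    show "norm (\<epsilon> n) \<le> 4 * (K * \<rho> n) + 2 * sqrt (\<rho> n) + 8 * \<rho> n + (\<rho> n)\<^sup>2"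
      unfolding \<epsilon>_def real_norm_def using * K
      by (intro exponent_loss_small[of "S n"]) (auto simp: S_def \<rho>_def)
  qed
  then have \<epsilon>_0: "\<epsilon> \<longlonglongrightarrow> 0" using bound_0 by (rule Lim_null_comparison)
  moreover have "\<forall>\<^sub>F n in sequentially. \<exists>E \<in> sets (M n).
       measure (M n) E > 1 - 5 / real n - 2 * exp (- separation (k n) (\<theta> n) / \<sigma> n) \<and>
       (\<forall>\<omega>\<in>E. misclust_loss n (k n) (zhat n \<omega>) (z n) \<le>
          exp (- (1 + \<epsilon> n) * (separation (k n) (\<theta> n))\<^sup>2 / (8 * (\<sigma> n)\<^sup>2)))"
    using good
  proof (rule eventually_mono)
    fix n assume *: "2 \<le> n \<and> 0 < S n \<and> K * \<rho> n < 1 / 16 \<and> \<rho> n < 1 / 64"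
    interpret sub_gaussian_mixture "M n" n "d n" "k n" "\<sigma> n" "\<theta> n" "z n" "w n" by (rule model)
    let ?r = "separation (k n) (\<theta> n) / \<sigma> n"
    obtain E where E: "E \<in> sets (M n)" "measure (M n) E > 1 - 5 / n - 2 * exp (- ?r)"
      "\<And>\<omega> zh. \<omega> \<in> E \<Longrightarrow> spectral_lloyd_output C n (d n) (k n) (observation (\<theta> n) (z n) (w n) \<omega>) (nat \<lceil>4 * ln n\<rceil>) zh \<Longrightarrow>
         misclust_loss n (k n) zh (z n) \<le> exp (- (1 + exponent_loss K (\<rho> n)) * ?r\<^sup>2 / 8)"
      using spectral_lloyd_rate[of "S n" "\<rho> n" ?r K C] * K by (auto simp: S_def \<rho>_def)
    have form: "- (1 + \<epsilon> n) * (separation (k n) (\<theta> n))\<^sup>2 / (8 * (\<sigma> n)\<^sup>2) = - (1 + exponent_loss K (\<rho> n)) * ?r\<^sup>2 / 8"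
      by (simp add: \<epsilon>_def power_divide)
    show "\<exists>E \<in> sets (M n).
       measure (M n) E > 1 - 5 / real n - 2 * exp (- separation (k n) (\<theta> n) / \<sigma> n) \<and>
       (\<forall>\<omega>\<in>E. misclust_loss n (k n) (zhat n \<omega>) (z n) \<le>
          exp (- (1 + \<epsilon> n) * (separation (k n) (\<theta> n))\<^sup>2 / (8 * (\<sigma> n)\<^sup>2)))"
    proof (intro bexI[OF _ E(1)] conjI ballI)
      show "measure (M n) E > 1 - 5 / real n - 2 * exp (- separation (k n) (\<theta> n) / \<sigma> n)"
        using E(2) by simp
      fix \<omega> assume \<omega>: "\<omega> \<in> E"
      then have "\<omega> \<in> space (M n)" using sets.sets_into_space[OF E(1)] by blast
      from E(3)[OF \<omega> algo[OF this]] show "misclust_loss n (k n) (zhat n \<omega>) (z n) \<le>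
          exp (- (1 + \<epsilon> n) * (separation (k n) (\<theta> n))\<^sup>2 / (8 * (\<sigma> n)\<^sup>2))"
        unfolding form .
    qed
  qed
  ultimately show ?thesis by blast
qed

end
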